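(* If $\mathcal V$ is a large category with a strict initial object and finite products, then the category $\mathcal V\text{-}\mathbf{Cat}$ of small $\mathcal V$-categories (enriched with respect to the cartesian monoidal structure of $\mathcal V$) and $\mathcal V$-functors is extensive.
   Context: Sizes: universes $\mathcal U_1\in\mathcal U_2$ are fixed; "small"/"large" means being an element of $\mathcal U_1$/$\mathcal U_2$. An initial object $0$ is strict if every morphism with codomain $0$ is an isomorphism. A large category $\mathcal V$ is extensive if it has all small coproducts and for every small set $I$ and every family $(X_i)_{i\in I}$ of objects of $\mathcal V$ the functor $\prod_{i\in I}(\mathcal V/X_i)\to\mathcal V/\coprod_{i\in I}X_i$, $(f_i\colon A_i\to X_i)_i\mapsto\coprod_i f_i$, is an equivalence of categories. *)

theory Defs
  imports Main "HOL-Library.FuncSet" "HOL-Library.Equipollence"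
begin

section \<open>Universes\<close>

text \<open>
  The ambient set theory is a type \<open>'s\<close> of sets, where \<open>elts x\<close> is the collection of all members
  of \<open>x\<close>. Subcollections and functions occurring in the closure conditions of a universe are
  arbitrary HOL sets and HOL functions, so universes are full (second-order), as they are in set
  theory. An infinite member is not demanded of a universe.
\<close>

definition membership_structure :: "('s \<Rightarrow> 's set) \<Rightarrow> bool" where
  "membership_structure elts \<longleftrightarrow> inj elts \<and> wf {(x, y). x \<in> elts y}"

definition grothendieck_universe :: "('s \<Rightarrow> 's set) \<Rightarrow> 's \<Rightarrow> bool" where
  "grothendieck_universe elts U \<longleftrightarrow>
     elts U \<noteq> {} \<and>
     (\<forall>x\<in>elts U. elts x \<subseteq> elts U) \<and>
     (\<forall>x\<in>elts U. \<forall>y\<in>elts U. \<exists>p\<in>elts U. elts p = {x, y}) \<and>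
     (\<forall>x\<in>elts U. \<exists>p\<in>elts U. elts ` elts p = Pow (elts x)) \<and>
     (\<forall>x\<in>elts U. \<forall>f\<in>elts x \<rightarrow> elts U. \<exists>s\<in>elts U. elts s = (\<Union>i\<in>elts x. elts (f i)))"

definition universes :: "('s \<Rightarrow> 's set) \<Rightarrow> 's \<Rightarrow> 's \<Rightarrow> bool" where
  "universes elts U1 U2 \<longleftrightarrow>
     membership_structure elts \<and> grothendieck_universe elts U1 \<and> grothendieck_universe elts U2 \<and>
     U1 \<in> elts U2"


section \<open>Categories\<close>

text \<open>\<open>Comp C g f\<close> is the composite \<open>g \<circ> f\<close>; it is meaningful only when \<open>Cod C f = Dom C g\<close>.\<close>

record ('o, 'a) category =
  Obj :: "'o set"
  Arr :: "'a set"
  Dom :: "'a \<Rightarrow> 'o"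
  Cod :: "'a \<Rightarrow> 'o"
  Ident :: "'o \<Rightarrow> 'a"
  Comp :: "'a \<Rightarrow> 'a \<Rightarrow> 'a"

definition Hom :: "('o, 'a) category \<Rightarrow> 'o \<Rightarrow> 'o \<Rightarrow> 'a set" where
  "Hom C x y = {f \<in> Arr C. Dom C f = x \<and> Cod C f = y}"

definition is_category :: "('o, 'a) category \<Rightarrow> bool" where
  "is_category C \<longleftrightarrow>
     (\<forall>f\<in>Arr C. Dom C f \<in> Obj C \<and> Cod C f \<in> Obj C) \<and>
     (\<forall>x\<in>Obj C. Ident C x \<in> Hom C x x) \<and>
     (\<forall>f\<in>Arr C. \<forall>g\<in>Arr C. Cod C f = Dom C g \<longrightarrow> Comp C g f \<in> Hom C (Dom C f) (Cod C g)) \<and>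
     (\<forall>f\<in>Arr C. Comp C f (Ident C (Dom C f)) = f \<and> Comp C (Ident C (Cod C f)) f = f) \<and>
     (\<forall>f\<in>Arr C. \<forall>g\<in>Arr C. \<forall>h\<in>Arr C. Cod C f = Dom C g \<longrightarrow> Cod C g = Dom C h \<longrightarrow>
        Comp C h (Comp C g f) = Comp C (Comp C h g) f)"

text \<open>
  Objects and arrows live in arbitrary types, so being an element of the universe \<open>U2\<close> is
  understood up to bijection.
\<close>

definition large_category :: "('s \<Rightarrow> 's set) \<Rightarrow> 's \<Rightarrow> ('o, 'a) category \<Rightarrow> bool" where
  "large_category elts U2 C \<longleftrightarrow>
     is_category C \<and> (\<exists>u\<in>elts U2. Obj C \<approx> elts u) \<and> (\<exists>u\<in>elts U2. Arr C \<approx> elts u)"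

definition is_iso :: "('o, 'a) category \<Rightarrow> 'a \<Rightarrow> bool" where
  "is_iso C f \<longleftrightarrow> f \<in> Arr C \<and>
     (\<exists>g\<in>Hom C (Cod C f) (Dom C f).
        Comp C g f = Ident C (Dom C f) \<and> Comp C f g = Ident C (Cod C f))"

definition is_initial :: "('o, 'a) category \<Rightarrow> 'o \<Rightarrow> bool" where
  "is_initial C z \<longleftrightarrow> z \<in> Obj C \<and> (\<forall>x\<in>Obj C. \<exists>!f. f \<in> Hom C z x)"

definition is_strict_initial :: "('o, 'a) category \<Rightarrow> 'o \<Rightarrow> bool" where
  "is_strict_initial C z \<longleftrightarrow> is_initial C z \<and> (\<forall>f\<in>Arr C. Cod C f = z \<longrightarrow> is_iso C f)"

definition is_terminal :: "('o, 'a) category \<Rightarrow> 'o \<Rightarrow> bool" where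
  "is_terminal C t \<longleftrightarrow> t \<in> Obj C \<and> (\<forall>x\<in>Obj C. \<exists>!f. f \<in> Hom C x t)"

definition is_binary_product ::
    "('o, 'a) category \<Rightarrow> 'o \<Rightarrow> 'o \<Rightarrow> 'o \<Rightarrow> 'a \<Rightarrow> 'a \<Rightarrow> bool" where
  "is_binary_product C x y p p1 p2 \<longleftrightarrow>
     p \<in> Obj C \<and> p1 \<in> Hom C p x \<and> p2 \<in> Hom C p y \<and>
     (\<forall>t\<in>Obj C. \<forall>f\<in>Hom C t x. \<forall>g\<in>Hom C t y.
        \<exists>!h. h \<in> Hom C t p \<and> Comp C p1 h = f \<and> Comp C p2 h = g)"

definition is_product ::
    "('o, 'a) category \<Rightarrow> 'i set \<Rightarrow> ('i \<Rightarrow> 'o) \<Rightarrow> 'o \<Rightarrow> ('i \<Rightarrow> 'a) \<Rightarrow> bool" where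
  "is_product C I X p \<pi> \<longleftrightarrow>
     p \<in> Obj C \<and> (\<forall>i\<in>I. \<pi> i \<in> Hom C p (X i)) \<and>
     (\<forall>t\<in>Obj C. \<forall>f. (\<forall>i\<in>I. f i \<in> Hom C t (X i)) \<longrightarrow>
        (\<exists>!h. h \<in> Hom C t p \<and> (\<forall>i\<in>I. Comp C (\<pi> i) h = f i)))"

definition is_coproduct ::
    "('o, 'a) category \<Rightarrow> 'i set \<Rightarrow> ('i \<Rightarrow> 'o) \<Rightarrow> 'o \<Rightarrow> ('i \<Rightarrow> 'a) \<Rightarrow> bool" where
  "is_coproduct C I X s \<iota> \<longleftrightarrow>
     s \<in> Obj C \<and> (\<forall>i\<in>I. \<iota> i \<in> Hom C (X i) s) \<and>
     (\<forall>t\<in>Obj C. \<forall>f. (\<forall>i\<in>I. f i \<in> Hom C (X i) t) \<longrightarrow>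
        (\<exists>!h. h \<in> Hom C s t \<and> (\<forall>i\<in>I. Comp C h (\<iota> i) = f i)))"

definition has_finite_products :: "('o, 'a) category \<Rightarrow> bool" where
  "has_finite_products C \<longleftrightarrow>
     (\<forall>(n::nat) X. (\<forall>i<n. X i \<in> Obj C) \<longrightarrow> (\<exists>p \<pi>. is_product C {..<n} X p \<pi>))"

definition has_small_coproducts :: "('s \<Rightarrow> 's set) \<Rightarrow> 's \<Rightarrow> ('o, 'a) category \<Rightarrow> bool" where
  "has_small_coproducts elts U1 C \<longleftrightarrow>
     (\<forall>u\<in>elts U1. \<forall>X. (\<forall>i\<in>elts u. X i \<in> Obj C) \<longrightarrow> (\<exists>s \<iota>. is_coproduct C (elts u) X s \<iota>))"


section \<open>Functors and equivalences\<close>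

record ('o, 'a, 'p, 'b) functor_data =
  FObj :: "'o \<Rightarrow> 'p"
  FArr :: "'a \<Rightarrow> 'b"

definition is_functor ::
    "('o, 'a) category \<Rightarrow> ('p, 'b) category \<Rightarrow> ('o, 'a, 'p, 'b) functor_data \<Rightarrow> bool" where
  "is_functor C D F \<longleftrightarrow>
     (\<forall>x\<in>Obj C. FObj F x \<in> Obj D) \<and>
     (\<forall>f\<in>Arr C. FArr F f \<in> Hom D (FObj F (Dom C f)) (FObj F (Cod C f))) \<and>
     (\<forall>x\<in>Obj C. FArr F (Ident C x) = Ident D (FObj F x)) \<and>
     (\<forall>f\<in>Arr C. \<forall>g\<in>Arr C. Cod C f = Dom C g \<longrightarrow>
        FArr F (Comp C g f) = Comp D (FArr F g) (FArr F f))"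

definition id_functor :: "('o, 'a, 'o, 'a) functor_data" where
  "id_functor = \<lparr>FObj = (\<lambda>x. x), FArr = (\<lambda>f. f)\<rparr>"

definition comp_functor ::
    "('p, 'b, 'q, 'c) functor_data \<Rightarrow> ('o, 'a, 'p, 'b) functor_data
       \<Rightarrow> ('o, 'a, 'q, 'c) functor_data" where
  "comp_functor G F = \<lparr>FObj = FObj G \<circ> FObj F, FArr = FArr G \<circ> FArr F\<rparr>"

definition naturally_isomorphic ::
    "('o, 'a) category \<Rightarrow> ('p, 'b) category
       \<Rightarrow> ('o, 'a, 'p, 'b) functor_data \<Rightarrow> ('o, 'a, 'p, 'b) functor_data \<Rightarrow> bool" where
  "naturally_isomorphic C D F G \<longleftrightarrow>
     (\<exists>\<tau>. (\<forall>x\<in>Obj C. \<tau> x \<in> Hom D (FObj F x) (FObj G x) \<and> is_iso D (\<tau> x)) \<and>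
          (\<forall>f\<in>Arr C. Comp D (FArr G f) (\<tau> (Dom C f)) = Comp D (\<tau> (Cod C f)) (FArr F f)))"

definition is_equivalence ::
    "('o, 'a) category \<Rightarrow> ('p, 'b) category \<Rightarrow> ('o, 'a, 'p, 'b) functor_data \<Rightarrow> bool" where
  "is_equivalence C D F \<longleftrightarrow> is_functor C D F \<and>
     (\<exists>G. is_functor D C G \<and>
          naturally_isomorphic C C (comp_functor G F) id_functor \<and>
          naturally_isomorphic D D (comp_functor F G) id_functor)"


section \<open>Extensive categories\<close>

text \<open>An arrow \<open>(f, h, g)\<close> of the slice is the morphism \<open>h : f \<rightarrow> g\<close> over \<open>x\<close>.\<close>

definition slice :: "('o, 'a) category \<Rightarrow> 'o \<Rightarrow> ('a, 'a \<times> 'a \<times> 'a) category" where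
  "slice C x = \<lparr>
     Obj = {f \<in> Arr C. Cod C f = x},
     Arr = {(f, h, g). f \<in> Arr C \<and> Cod C f = x \<and> g \<in> Arr C \<and> Cod C g = x \<and>
                       h \<in> Hom C (Dom C f) (Dom C g) \<and> Comp C g h = f},
     Dom = (\<lambda>(f, h, g). f),
     Cod = (\<lambda>(f, h, g). g),
     Ident = (\<lambda>f. (f, Ident C (Dom C f), f)),
     Comp = (\<lambda>(g, k, l) (f, h, g'). (f, Comp C k h, l))\<rparr>"

definition product_category ::
    "'i set \<Rightarrow> ('i \<Rightarrow> ('o, 'a) category) \<Rightarrow> ('i \<Rightarrow> 'o, 'i \<Rightarrow> 'a) category" where
  "product_category I D = \<lparr>
     Obj = (\<Pi>\<^sub>E i\<in>I. Obj (D i)),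
     Arr = (\<Pi>\<^sub>E i\<in>I. Arr (D i)),
     Dom = (\<lambda>f. \<lambda>i\<in>I. Dom (D i) (f i)),
     Cod = (\<lambda>f. \<lambda>i\<in>I. Cod (D i) (f i)),
     Ident = (\<lambda>x. \<lambda>i\<in>I. Ident (D i) (x i)),
     Comp = (\<lambda>g f. \<lambda>i\<in>I. Comp (D i) (g i) (f i))\<rparr>"

text \<open>
  A choice \<open>K\<close> of \<open>I\<close>-indexed coproducts sends a family to its coproduct object together with the
  coproduct injections.
\<close>

definition is_coproduct_choice ::
    "('o, 'a) category \<Rightarrow> 'i set \<Rightarrow> (('i \<Rightarrow> 'o) \<Rightarrow> 'o \<times> ('i \<Rightarrow> 'a)) \<Rightarrow> bool" where
  "is_coproduct_choice C I K \<longleftrightarrow>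
     (\<forall>A\<in>I \<rightarrow>\<^sub>E Obj C. is_coproduct C I A (fst (K A)) (snd (K A)))"

definition coproduct_arrow ::
    "('o, 'a) category \<Rightarrow> 'i set \<Rightarrow> (('i \<Rightarrow> 'o) \<Rightarrow> 'o \<times> ('i \<Rightarrow> 'a)) \<Rightarrow> ('i \<Rightarrow> 'a) \<Rightarrow> 'a" where
  "coproduct_arrow C I K f =
     (let A = (\<lambda>i\<in>I. Dom C (f i)); X = (\<lambda>i\<in>I. Cod C (f i)) in
      THE h. h \<in> Hom C (fst (K A)) (fst (K X)) \<and>
             (\<forall>i\<in>I. Comp C h (snd (K A) i) = Comp C (snd (K X) i) (f i)))"

definition coproduct_functor ::
    "('o, 'a) category \<Rightarrow> 'i set \<Rightarrow> (('i \<Rightarrow> 'o) \<Rightarrow> 'o \<times> ('i \<Rightarrow> 'a))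
       \<Rightarrow> ('i \<Rightarrow> 'a, 'i \<Rightarrow> 'a \<times> 'a \<times> 'a, 'a, 'a \<times> 'a \<times> 'a) functor_data" where
  "coproduct_functor C I K = \<lparr>
     FObj = coproduct_arrow C I K,
     FArr = (\<lambda>\<phi>. (coproduct_arrow C I K (\<lambda>i\<in>I. fst (\<phi> i)),
                  coproduct_arrow C I K (\<lambda>i\<in>I. fst (snd (\<phi> i))),
                  coproduct_arrow C I K (\<lambda>i\<in>I. snd (snd (\<phi> i)))))\<rparr>"

definition extensive :: "('s \<Rightarrow> 's set) \<Rightarrow> 's \<Rightarrow> 's \<Rightarrow> ('o, 'a) category \<Rightarrow> bool" where
  "extensive elts U1 U2 C \<longleftrightarrow>
     large_category elts U2 C \<and>
     has_small_coproducts elts U1 C \<and>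
     (\<forall>u\<in>elts U1. \<forall>K. is_coproduct_choice C (elts u) K \<longrightarrow>
        (\<forall>X\<in>elts u \<rightarrow>\<^sub>E Obj C.
           is_equivalence (product_category (elts u) (\<lambda>i. slice C (X i)))
                          (slice C (fst (K X)))
                          (coproduct_functor C (elts u) K)))"


section \<open>The cartesian monoidal structure\<close>

text \<open>
  A choice of terminal object and binary products, which determines the cartesian monoidal
  structure.
\<close>

record ('o, 'a) cartesian =
  Unit :: 'o
  Prod :: "'o \<Rightarrow> 'o \<Rightarrow> 'o"
  Fst :: "'o \<Rightarrow> 'o \<Rightarrow> 'a"
  Snd :: "'o \<Rightarrow> 'o \<Rightarrow> 'a"

definition is_cartesian_structure :: "('o, 'a) category \<Rightarrow> ('o, 'a) cartesian \<Rightarrow> bool" where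
  "is_cartesian_structure V M \<longleftrightarrow>
     is_terminal V (Unit M) \<and>
     (\<forall>x\<in>Obj V. \<forall>y\<in>Obj V. is_binary_product V x y (Prod M x y) (Fst M x y) (Snd M x y))"

definition pair_arrow :: "('o, 'a) category \<Rightarrow> ('o, 'a) cartesian \<Rightarrow> 'a \<Rightarrow> 'a \<Rightarrow> 'a" where
  "pair_arrow V M f g =
     (THE h. h \<in> Hom V (Dom V f) (Prod M (Cod V f) (Cod V g)) \<and>
             Comp V (Fst M (Cod V f) (Cod V g)) h = f \<and>
             Comp V (Snd M (Cod V f) (Cod V g)) h = g)"

definition prod_arrow :: "('o, 'a) category \<Rightarrow> ('o, 'a) cartesian \<Rightarrow> 'a \<Rightarrow> 'a \<Rightarrow> 'a" where
  "prod_arrow V M f g =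
     pair_arrow V M (Comp V f (Fst M (Dom V f) (Dom V g)))
                    (Comp V g (Snd M (Dom V f) (Dom V g)))"

text \<open>
  The associator \<open>(x \<times> y) \<times> z \<rightarrow> x \<times> (y \<times> z)\<close>. The unitors are the projections
  \<open>Snd M (Unit M) x\<close> and \<open>Fst M x (Unit M)\<close>.
\<close>

definition assoc_arrow :: "('o, 'a) category \<Rightarrow> ('o, 'a) cartesian \<Rightarrow> 'o \<Rightarrow> 'o \<Rightarrow> 'o \<Rightarrow> 'a" where
  "assoc_arrow V M x y z =
     (let p = Fst M (Prod M x y) z; q = Snd M (Prod M x y) z in
      pair_arrow V M (Comp V (Fst M x y) p) (pair_arrow V M (Comp V (Snd M x y) p) q))"


section \<open>Enriched categories\<close>

text \<open>
  \<open>VComp A (x, y, z)\<close> is the composition \<open>A(y,z) \<times> A(x,y) \<rightarrow> A(x,z)\<close>. All components are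
  extensional, so that equality of records is equality of \<open>V\<close>-categories and \<open>V\<close>-functors.
\<close>

record ('s, 'o, 'a) vcat =
  VObj :: "'s set"
  VHom :: "'s \<times> 's \<Rightarrow> 'o"
  VComp :: "'s \<times> 's \<times> 's \<Rightarrow> 'a"
  VIdent :: "'s \<Rightarrow> 'a"

definition is_vcat ::
    "('o, 'a) category \<Rightarrow> ('o, 'a) cartesian \<Rightarrow> ('s, 'o, 'a) vcat \<Rightarrow> bool" where
  "is_vcat V M A \<longleftrightarrow>
     VHom A \<in> VObj A \<times> VObj A \<rightarrow>\<^sub>E Obj V \<and>
     VComp A \<in> (\<Pi>\<^sub>E (x, y, z)\<in>VObj A \<times> VObj A \<times> VObj A.
                  Hom V (Prod M (VHom A (y, z)) (VHom A (x, y))) (VHom A (x, z))) \<and>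
     VIdent A \<in> (\<Pi>\<^sub>E x\<in>VObj A. Hom V (Unit M) (VHom A (x, x))) \<and>
     (\<forall>w\<in>VObj A. \<forall>x\<in>VObj A. \<forall>y\<in>VObj A. \<forall>z\<in>VObj A.
        Comp V (VComp A (w, x, z))
               (prod_arrow V M (VComp A (x, y, z)) (Ident V (VHom A (w, x)))) =
        Comp V (Comp V (VComp A (w, y, z))
                       (prod_arrow V M (Ident V (VHom A (y, z))) (VComp A (w, x, y))))
               (assoc_arrow V M (VHom A (y, z)) (VHom A (x, y)) (VHom A (w, x)))) \<and>
     (\<forall>x\<in>VObj A. \<forall>y\<in>VObj A.
        Comp V (VComp A (x, y, y)) (prod_arrow V M (VIdent A y) (Ident V (VHom A (x, y)))) =
          Snd M (Unit M) (VHom A (x, y)) \<and>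
        Comp V (VComp A (x, x, y)) (prod_arrow V M (Ident V (VHom A (x, y))) (VIdent A x)) =
          Fst M (VHom A (x, y)) (Unit M))"

definition is_small_vcat ::
    "('s \<Rightarrow> 's set) \<Rightarrow> 's \<Rightarrow> ('o, 'a) category \<Rightarrow> ('o, 'a) cartesian
       \<Rightarrow> ('s, 'o, 'a) vcat \<Rightarrow> bool" where
  "is_small_vcat elts U1 V M A \<longleftrightarrow> is_vcat V M A \<and> (\<exists>u\<in>elts U1. VObj A = elts u)"

record ('s, 'o, 'a) vfunctor =
  VSrc :: "('s, 'o, 'a) vcat"
  VTgt :: "('s, 'o, 'a) vcat"
  VFObj :: "'s \<Rightarrow> 's"
  VFHom :: "'s \<times> 's \<Rightarrow> 'a"

definition is_vfunctor ::
    "('o, 'a) category \<Rightarrow> ('o, 'a) cartesian \<Rightarrow> ('s, 'o, 'a) vfunctor \<Rightarrow> bool" where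
  "is_vfunctor V M F \<longleftrightarrow>
     (let A = VSrc F; B = VTgt F; T = VFObj F in
      is_vcat V M A \<and> is_vcat V M B \<and>
      T \<in> VObj A \<rightarrow>\<^sub>E VObj B \<and>
      VFHom F \<in> (\<Pi>\<^sub>E (x, y)\<in>VObj A \<times> VObj A. Hom V (VHom A (x, y)) (VHom B (T x, T y))) \<and>
      (\<forall>x\<in>VObj A. \<forall>y\<in>VObj A. \<forall>z\<in>VObj A.
         Comp V (VFHom F (x, z)) (VComp A (x, y, z)) =
         Comp V (VComp B (T x, T y, T z)) (prod_arrow V M (VFHom F (y, z)) (VFHom F (x, y)))) \<and>
      (\<forall>x\<in>VObj A. Comp V (VFHom F (x, x)) (VIdent A x) = VIdent B (T x)))"

definition vfunctor_ident ::
    "('o, 'a) category \<Rightarrow> ('s, 'o, 'a) vcat \<Rightarrow> ('s, 'o, 'a) vfunctor" where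
  "vfunctor_ident V A = \<lparr>
     VSrc = A, VTgt = A,
     VFObj = (\<lambda>x\<in>VObj A. x),
     VFHom = (\<lambda>p\<in>VObj A \<times> VObj A. Ident V (VHom A p))\<rparr>"

definition vfunctor_comp ::
    "('o, 'a) category \<Rightarrow> ('s, 'o, 'a) vfunctor \<Rightarrow> ('s, 'o, 'a) vfunctor
       \<Rightarrow> ('s, 'o, 'a) vfunctor" where
  "vfunctor_comp V G F = \<lparr>
     VSrc = VSrc F, VTgt = VTgt G,
     VFObj = (\<lambda>x\<in>VObj (VSrc F). VFObj G (VFObj F x)),
     VFHom = (\<lambda>(x, y)\<in>VObj (VSrc F) \<times> VObj (VSrc F).
                Comp V (VFHom G (VFObj F x, VFObj F y)) (VFHom F (x, y)))\<rparr>"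

definition VCat ::
    "('s \<Rightarrow> 's set) \<Rightarrow> 's \<Rightarrow> ('o, 'a) category \<Rightarrow> ('o, 'a) cartesian
       \<Rightarrow> (('s, 'o, 'a) vcat, ('s, 'o, 'a) vfunctor) category" where
  "VCat elts U1 V M = \<lparr>
     Obj = {A. is_small_vcat elts U1 V M A},
     Arr = {F. is_vfunctor V M F \<and> is_small_vcat elts U1 V M (VSrc F) \<and>
               is_small_vcat elts U1 V M (VTgt F)},
     Dom = VSrc,
     Cod = VTgt,
     Ident = vfunctor_ident V,
     Comp = vfunctor_comp V\<rparr>"

end

theory Submission imports Defs begin

text \<open>
  Strictness makes every object that maps to the initial object initial, so any product with an
  initial factor is initial. Hence a family of \<open>V\<close>-categories can be glued by taking initial
  hom-objects between different summands: every composition law and axiom that mixes summands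
  concerns arrows out of an initial object and holds automatically. The coproducts of
  \<open>V\<close>-categories are exactly these partitions into full subcategories with initial hom-objects in
  between. Such a partition of a codomain pulls back along any \<open>V\<close>-functor, because a hom-object
  mapping to an initial one is initial; this gives essential surjectivity of the coproduct functor
  on slices. Full faithfulness holds since a \<open>V\<close>-functor factors uniquely through a full
  subcategory that contains its image.
\<close>

section \<open>Categories\<close>

text \<open>Extensivity speaks about every choice of coproducts, not about a convenient one. A
  coproduct of \<open>V\<close>-categories is therefore never assumed to have a particular shape:
  one explicit coproduct is glued together, and its description is carried along the comparison
  isomorphism to any other. This is why injections are treated as embeddings, injective on objects
  and invertible on hom-objects, and not as literal inclusions of subcategories.

  Gluing never joins two hom-objects by a coproduct in \<open>V\<close>; it only inserts the initial
  object between summands. An identity of the glued category joins an object to itself, so no arrow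
  from the unit to the initial object is ever called for.

  Two further demands come from the setting. The objects of a small \<open>V\<close>-category form a
  set named by a member of the universe, so the disjoint union is made of ordered pairs built inside
  the universe. A large category must have sets of objects and arrows of the size of a member of
  \<open>U2\<close>, which calls for an explicit bound on the \<open>V\<close>-categories and
  \<open>V\<close>-functors.\<close>

lemma HomI: "f \<in> Arr C \<Longrightarrow> f \<in> Hom C (Dom C f) (Cod C f)"
  by (simp add: Hom_def)

lemma HomD: "f \<in> Hom C x y \<Longrightarrow> f \<in> Arr C \<and> Dom C f = x \<and> Cod C f = y"
  by (simp add: Hom_def)

locale cat =
  fixes C :: "('o, 'a) category"
  assumes is_cat: "is_category C"
begin

abbreviation comp (infixr "\<cdot>" 70) where "g \<cdot> f \<equiv> Comp C g f"

lemma Hom_Obj: "f \<in> Hom C x y \<Longrightarrow> x \<in> Obj C" "f \<in> Hom C x y \<Longrightarrow> y \<in> Obj C"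
  using is_cat unfolding is_category_def Hom_def by auto

lemma Arr_Obj: "f \<in> Arr C \<Longrightarrow> Dom C f \<in> Obj C" "f \<in> Arr C \<Longrightarrow> Cod C f \<in> Obj C"
  using is_cat unfolding is_category_def by auto

lemma ident_hom: "x \<in> Obj C \<Longrightarrow> Ident C x \<in> Hom C x x"
  using is_cat unfolding is_category_def by auto

lemma comp_hom: "\<lbrakk>g \<in> Hom C y z; f \<in> Hom C x y\<rbrakk> \<Longrightarrow> g \<cdot> f \<in> Hom C x z"
  using is_cat unfolding is_category_def Hom_def by auto

lemma comp_assoc:
  "\<lbrakk>h \<in> Hom C y z; g \<in> Hom C x y; f \<in> Hom C w x\<rbrakk> \<Longrightarrow> (h \<cdot> g) \<cdot> f = h \<cdot> g \<cdot> f"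
  using is_cat unfolding is_category_def Hom_def by auto

lemma comp_ident_right: "f \<in> Hom C x y \<Longrightarrow> f \<cdot> Ident C x = f"
  and comp_ident_left: "f \<in> Hom C x y \<Longrightarrow> Ident C y \<cdot> f = f"
  using is_cat unfolding is_category_def Hom_def by auto

lemma is_isoI:
  "\<lbrakk>f \<in> Hom C x y; g \<in> Hom C y x; g \<cdot> f = Ident C x; f \<cdot> g = Ident C y\<rbrakk> \<Longrightarrow> is_iso C f"
  unfolding is_iso_def Hom_def by auto

lemma is_isoE:
  assumes "is_iso C f" "f \<in> Hom C x y"
  obtains g where "g \<in> Hom C y x" "g \<cdot> f = Ident C x" "f \<cdot> g = Ident C y"
  using assms unfolding is_iso_def Hom_def by auto

lemma iso_cancel_left:
  assumes "is_iso C m" "m \<in> Hom C x y" "f \<in> Hom C w x" "g \<in> Hom C w x" "m \<cdot> f = m \<cdot> g"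
  shows "f = g"
proof -
  obtain n where n: "n \<in> Hom C y x" "n \<cdot> m = Ident C x" using is_isoE assms by metis
  have "f = (n \<cdot> m) \<cdot> f" using n assms comp_ident_left by simp
  also have "\<dots> = (n \<cdot> m) \<cdot> g"
    using comp_assoc[OF n(1) assms(2,3)] comp_assoc[OF n(1) assms(2,4)] assms(5) by simp
  also have "\<dots> = g" using n assms comp_ident_left by simp
  finally show ?thesis .
qed

lemma iso_cancel_right:
  assumes "is_iso C e" "e \<in> Hom C x y" "f \<in> Hom C y z" "g \<in> Hom C y z" "f \<cdot> e = g \<cdot> e"
  shows "f = g"
proof -
  obtain n where n: "n \<in> Hom C y x" "e \<cdot> n = Ident C y" using is_isoE assms by metis
  have "f = f \<cdot> e \<cdot> n" using n assms comp_ident_right by simp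
  also have "\<dots> = g \<cdot> e \<cdot> n" using n assms comp_assoc by metis
  also have "\<dots> = g" using n assms comp_ident_right by simp
  finally show ?thesis .
qed

lemma iso_ident: "x \<in> Obj C \<Longrightarrow> is_iso C (Ident C x)"
  using is_isoI ident_hom comp_ident_left by metis

lemma comp_middle:
  assumes "a \<in> Hom C y z" "b \<in> Hom C x y" "c \<in> Hom C w x" "d \<in> Hom C v w"
  shows "(a \<cdot> b) \<cdot> c \<cdot> d = a \<cdot> (b \<cdot> c) \<cdot> d"
  using comp_assoc[OF assms(1,2) comp_hom[OF assms(3,4)]] comp_assoc[OF assms(2,3,4)] by simp

lemma iso_comp:
  assumes "is_iso C f" "is_iso C g" "f \<in> Hom C x y" "g \<in> Hom C y z"
  shows "is_iso C (g \<cdot> f)"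
proof -
  obtain f' where f': "f' \<in> Hom C y x" "f' \<cdot> f = Ident C x" "f \<cdot> f' = Ident C y"
    using is_isoE assms by metis
  obtain g' where g': "g' \<in> Hom C z y" "g' \<cdot> g = Ident C y" "g \<cdot> g' = Ident C z"
    using is_isoE assms by metis
  show ?thesis
  proof (rule is_isoI[where g = "f' \<cdot> g'"])
    show "g \<cdot> f \<in> Hom C x z" "f' \<cdot> g' \<in> Hom C z x" using assms f' g' comp_hom by auto
    show "(f' \<cdot> g') \<cdot> g \<cdot> f = Ident C x"
      by (simp add: comp_middle[OF f'(1) g'(1) assms(4,3)] f' g' comp_ident_left[OF assms(3)])
    show "(g \<cdot> f) \<cdot> f' \<cdot> g' = Ident C z"
      by (simp add: comp_middle[OF assms(4,3) f'(1) g'(1)] f' g' comp_ident_left[OF g'(1)])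
  qed
qed

lemma coproduct_ex1:
  assumes "is_coproduct C I X s \<iota>" "t \<in> Obj C" "\<And>i. i \<in> I \<Longrightarrow> f i \<in> Hom C (X i) t"
  shows "\<exists>!h. h \<in> Hom C s t \<and> (\<forall>i\<in>I. h \<cdot> \<iota> i = f i)"
  using assms unfolding is_coproduct_def by auto

lemma coproduct_eqI:
  assumes "is_coproduct C I X s \<iota>" "h \<in> Hom C s t" "k \<in> Hom C s t"
    and "\<And>i. i \<in> I \<Longrightarrow> h \<cdot> \<iota> i = k \<cdot> \<iota> i"
  shows "h = k"
proof -
  have "\<exists>!l. l \<in> Hom C s t \<and> (\<forall>i\<in>I. l \<cdot> \<iota> i = k \<cdot> \<iota> i)"
  proof (rule coproduct_ex1[OF assms(1)])
    show "t \<in> Obj C" using assms Hom_Obj by metis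
    show "k \<cdot> \<iota> i \<in> Hom C (X i) t" if "i \<in> I" for i
      using that assms comp_hom unfolding is_coproduct_def by metis
  qed
  then show ?thesis using assms by metis
qed

lemma coproduct_injection: "\<lbrakk>is_coproduct C I X s \<iota>; i \<in> I\<rbrakk> \<Longrightarrow> \<iota> i \<in> Hom C (X i) s"
  by (simp add: is_coproduct_def)

text \<open>Each universal property induces an arrow, and both round trips agree with the identity
  on all injections. The result serves twice: it relates an arbitrary coproduct to one built by
  hand, and a chosen coproduct to a given one.\<close>

lemma coproduct_comparison:
  assumes c: "is_coproduct C I X s \<iota>" and d: "is_coproduct C I X t \<kappa>"
  obtains \<theta> where "\<theta> \<in> Hom C s t" "is_iso C \<theta>" "\<And>i. i \<in> I \<Longrightarrow> \<theta> \<cdot> \<iota> i = \<kappa> i"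
proof -
  have st: "s \<in> Obj C" "t \<in> Obj C" using c d by (auto simp: is_coproduct_def)
  obtain h where h: "h \<in> Hom C s t" "\<And>i. i \<in> I \<Longrightarrow> h \<cdot> \<iota> i = \<kappa> i"
    using coproduct_ex1[OF c st(2)] coproduct_injection[OF d] by metis
  obtain k where k: "k \<in> Hom C t s" "\<And>i. i \<in> I \<Longrightarrow> k \<cdot> \<kappa> i = \<iota> i"
    using coproduct_ex1[OF d st(1)] coproduct_injection[OF c] by metis
  have "k \<cdot> h = Ident C s"
  proof (rule coproduct_eqI[OF c])
    show "k \<cdot> h \<in> Hom C s s" "Ident C s \<in> Hom C s s" using h k comp_hom ident_hom st by auto
    show "(k \<cdot> h) \<cdot> \<iota> i = Ident C s \<cdot> \<iota> i" if "i \<in> I" for i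
      using that coproduct_injection[OF c that] comp_assoc[OF k(1) h(1)] h k comp_ident_left by simp
  qed
  moreover have "h \<cdot> k = Ident C t"
  proof (rule coproduct_eqI[OF d])
    show "h \<cdot> k \<in> Hom C t t" "Ident C t \<in> Hom C t t" using h k comp_hom ident_hom st by auto
    show "(h \<cdot> k) \<cdot> \<kappa> i = Ident C t \<cdot> \<kappa> i" if "i \<in> I" for i
      using that coproduct_injection[OF d that] comp_assoc[OF h(1) k(1)] h k comp_ident_left by simp
  qed
  ultimately show thesis using that h k is_isoI by metis
qed

end

section \<open>Equivalences of categories\<close>

lemma functor_Obj: "\<lbrakk>is_functor C D F; x \<in> Obj C\<rbrakk> \<Longrightarrow> FObj F x \<in> Obj D"
  and functor_Ident: "\<lbrakk>is_functor C D F; x \<in> Obj C\<rbrakk> \<Longrightarrow> FArr F (Ident C x) = Ident D (FObj F x)"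
  unfolding is_functor_def by auto

lemma functor_Hom: "\<lbrakk>is_functor C D F; f \<in> Hom C x y\<rbrakk> \<Longrightarrow> FArr F f \<in> Hom D (FObj F x) (FObj F y)"
  unfolding is_functor_def by (auto simp: Hom_def)

lemma functor_Comp: "\<lbrakk>is_functor C D F; g \<in> Hom C y z; f \<in> Hom C x y\<rbrakk>
    \<Longrightarrow> FArr F (Comp C g f) = Comp D (FArr F g) (FArr F f)"
  unfolding is_functor_def by (auto simp: Hom_def)

text \<open>An equivalence is defined by an actual quasi-inverse, so one is assembled from choices:
  objects come from essential surjectivity, arrows are unique lifts along \<open>F\<close>.
  Uniqueness of lifts (\<open>faith\<close>) reduces every equation in \<open>C\<close> to its image
  in \<open>D\<close>.\<close>

theorem fully_faithful_essentially_surjective_equivalence: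
  assumes C: "is_category C" and D: "is_category D" and F: "is_functor C D F"
    and full: "\<And>x y k. \<lbrakk>x \<in> Obj C; y \<in> Obj C; k \<in> Hom D (FObj F x) (FObj F y)\<rbrakk>
                 \<Longrightarrow> \<exists>!l. l \<in> Hom C x y \<and> FArr F l = k"
    and surj: "\<And>d. d \<in> Obj D \<Longrightarrow> \<exists>x\<in>Obj C. \<exists>e\<in>Hom D (FObj F x) d. is_iso D e"
  shows "is_equivalence C D F"
proof -
  interpret C: cat C by unfold_locales (rule C)
  interpret D: cat D by unfold_locales (rule D)
  note FO = functor_Obj[OF F] and FH = functor_Hom[OF F] and FC = functor_Comp[OF F]
    and FI = functor_Ident[OF F]
  have faith: "l = l'" if "l \<in> Hom C x y" "l' \<in> Hom C x y" "FArr F l = FArr F l'" for l l' x y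
    using full[of x y "FArr F l"] that FH C.Hom_Obj by metis
  have "\<forall>d\<in>Obj D. \<exists>x e e'. x \<in> Obj C \<and> e \<in> Hom D (FObj F x) d \<and> e' \<in> Hom D d (FObj F x)
          \<and> D.comp e' e = Ident D (FObj F x) \<and> D.comp e e' = Ident D d"
    using surj D.is_isoE by metis
  then obtain g e e' where
    g: "\<And>d. d \<in> Obj D \<Longrightarrow> g d \<in> Obj C" and
    e: "\<And>d. d \<in> Obj D \<Longrightarrow> e d \<in> Hom D (FObj F (g d)) d" and
    e': "\<And>d. d \<in> Obj D \<Longrightarrow> e' d \<in> Hom D d (FObj F (g d))" and
    e'e: "\<And>d. d \<in> Obj D \<Longrightarrow> D.comp (e' d) (e d) = Ident D (FObj F (g d))" and
    ee': "\<And>d. d \<in> Obj D \<Longrightarrow> D.comp (e d) (e' d) = Ident D d"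
    by metis
  \<comment> \<open>On arrows, \<open>G\<close> is the unique lift of the conjugate of
    \<open>k\<close> by the isomorphisms \<open>e\<close>. With this choice \<open>e\<close> itself
    is natural from \<open>F\<close> after \<open>G\<close> to the identity.\<close>
  define G where "G = \<lparr>FObj = g,
    FArr = (\<lambda>k. THE l. l \<in> Hom C (g (Dom D k)) (g (Cod D k)) \<and>
              FArr F l = D.comp (e' (Cod D k)) (D.comp k (e (Dom D k))))\<rparr>"
  have GO: "FObj G d = g d" for d by (simp add: G_def)
  have GA: "FArr G k \<in> Hom C (g x) (g y) \<and> FArr F (FArr G k) = D.comp (e' y) (D.comp k (e x))"
    if k: "k \<in> Hom D x y" for k x y
  proof -
    have xy: "x \<in> Obj D" "y \<in> Obj D" using D.Hom_Obj k by auto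
    have "D.comp (e' y) (D.comp k (e x)) \<in> Hom D (FObj F (g x)) (FObj F (g y))"
      using D.comp_hom e e' xy k by blast
    then have "\<exists>!l. l \<in> Hom C (g x) (g y) \<and> FArr F l = D.comp (e' y) (D.comp k (e x))"
      using full g xy by blast
    from theI'[OF this] show ?thesis using k by (simp add: G_def Hom_def)
  qed
  have G: "is_functor D C G"
    unfolding is_functor_def
  proof (intro conjI ballI impI)
    show "FObj G x \<in> Obj C" if "x \<in> Obj D" for x using that g GO by simp
    show "FArr G k \<in> Hom C (FObj G (Dom D k)) (FObj G (Cod D k))" if "k \<in> Arr D" for k
      using GA[OF HomI[OF that]] GO by simp
    show "FArr G (Ident D x) = Ident C (FObj G x)" if x: "x \<in> Obj D" for x
    proof (rule faith)
      show "FArr G (Ident D x) \<in> Hom C (g x) (g x)" using GA D.ident_hom x by blast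
      show "Ident C (FObj G x) \<in> Hom C (g x) (g x)" using g x GO C.ident_hom by simp
      show "FArr F (FArr G (Ident D x)) = FArr F (Ident C (FObj G x))"
        using GA[OF D.ident_hom[OF x]] e[OF x] e'e[OF x] FI[OF g[OF x]] GO
        by (simp add: D.comp_ident_left)
    qed
    show "FArr G (D.comp k j) = C.comp (FArr G k) (FArr G j)"
      if "j \<in> Arr D" "k \<in> Arr D" "Cod D j = Dom D k" for j k
    proof -
      define x y z where "x = Dom D j" "y = Dom D k" "z = Cod D k"
      have j: "j \<in> Hom D x y" and k: "k \<in> Hom D y z" using that by (auto simp: Hom_def x_y_z_def)
      have xyz: "x \<in> Obj D" "y \<in> Obj D" "z \<in> Obj D" using D.Hom_Obj j k by auto
      note kj = D.comp_hom[OF k j]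
      show ?thesis
      proof (rule faith)
        show "FArr G (D.comp k j) \<in> Hom C (g x) (g z)" using GA kj by blast
        show "C.comp (FArr G k) (FArr G j) \<in> Hom C (g x) (g z)" using GA j k C.comp_hom by blast
        have 1: "D.comp k (e y) \<in> Hom D (FObj F (g y)) z" "D.comp j (e x) \<in> Hom D (FObj F (g x)) y"
          using D.comp_hom j k e xyz by auto
        have 2: "D.comp (e' y) (D.comp j (e x)) \<in> Hom D (FObj F (g x)) (FObj F (g y))"
          using D.comp_hom 1 e' xyz by blast
        have "FArr F (C.comp (FArr G k) (FArr G j)) =
            D.comp (D.comp (e' z) (D.comp k (e y))) (D.comp (e' y) (D.comp j (e x)))"
          using FC[of "FArr G k" "g y" "g z"] GA[OF j] GA[OF k] by metis
        also have "\<dots> = D.comp (e' z) (D.comp (D.comp k (e y)) (D.comp (e' y) (D.comp j (e x))))"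
          using D.comp_assoc[OF e'[OF xyz(3)] 1(1) 2] .
        also have "D.comp (D.comp k (e y)) (D.comp (e' y) (D.comp j (e x)))
            = D.comp k (D.comp (e y) (D.comp (e' y) (D.comp j (e x))))"
          using D.comp_assoc[OF k e[OF xyz(2)] 2] .
        also have "D.comp (e y) (D.comp (e' y) (D.comp j (e x))) = D.comp j (e x)"
          using D.comp_assoc[OF e[OF xyz(2)] e'[OF xyz(2)] 1(2)] ee'[OF xyz(2)]
            D.comp_ident_left[OF 1(2)] by simp
        also have "D.comp k (D.comp j (e x)) = D.comp (D.comp k j) (e x)"
          using D.comp_assoc[OF k j e[OF xyz(1)]] by simp
        finally show "FArr F (FArr G (D.comp k j)) = FArr F (C.comp (FArr G k) (FArr G j))"
          using GA[OF kj] by simp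
      qed
    qed
  qed
  have "naturally_isomorphic D D (comp_functor F G) id_functor"
    unfolding naturally_isomorphic_def
  proof (intro exI[of _ e] conjI ballI)
    fix d assume d: "d \<in> Obj D"
    show "e d \<in> Hom D (FObj (comp_functor F G) d) (FObj id_functor d)"
      using e[OF d] GO by (simp add: comp_functor_def id_functor_def)
    show "is_iso D (e d)" using D.is_isoI e e' ee' e'e d by blast
  next
    fix k assume "k \<in> Arr D"
    then obtain x y where k: "k \<in> Hom D x y" using HomI by metis
    have xy: "x \<in> Obj D" "y \<in> Obj D" using D.Hom_Obj k by auto
    have 1: "D.comp k (e x) \<in> Hom D (FObj F (g x)) y" using D.comp_hom k e xy by blast
    have "D.comp (e y) (D.comp (e' y) (D.comp k (e x))) = D.comp k (e x)"
      using D.comp_assoc[OF e[OF xy(2)] e'[OF xy(2)] 1] ee'[OF xy(2)]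
            D.comp_ident_left[OF 1] by simp
    then show "D.comp (FArr id_functor k) (e (Dom D k))
        = D.comp (e (Cod D k)) (FArr (comp_functor F G) k)"
      using GA[OF k] HomD[OF k] by (simp add: comp_functor_def id_functor_def)
  qed
  moreover
  \<comment> \<open>The second natural isomorphism lifts the first: \<open>F\<close> takes
    \<open>\<eta> x\<close> to \<open>e (FObj F x)\<close>, so its inverse and its naturality can be
    lifted from \<open>D\<close> as well.\<close>
  define \<eta> where "\<eta> x = (THE l. l \<in> Hom C (g (FObj F x)) x \<and> FArr F l = e (FObj F x))" for x
  have \<eta>: "\<eta> x \<in> Hom C (g (FObj F x)) x \<and> FArr F (\<eta> x) = e (FObj F x)" if x: "x \<in> Obj C" for x
    unfolding \<eta>_def by (rule theI', rule full) (use x g e FO in auto)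
  have \<eta>_iso: "is_iso C (\<eta> x)" if x: "x \<in> Obj C" for x
  proof -
    note d = FO[OF x]
    obtain l where l: "l \<in> Hom C x (g (FObj F x))" "FArr F l = e' (FObj F x)"
      using full[OF x g[OF d] e'[OF d]] by blast
    note h = conjunct1[OF \<eta>[OF x]]
    show ?thesis
    proof (rule C.is_isoI[OF h l(1)])
      show "C.comp l (\<eta> x) = Ident C (g (FObj F x))"
        by (rule faith[OF C.comp_hom[OF l(1) h] C.ident_hom[OF g[OF d]]])
          (simp add: FC[OF l(1) h] FI[OF g[OF d]] l \<eta>[OF x] e'e[OF d])
      show "C.comp (\<eta> x) l = Ident C x"
        by (rule faith[OF C.comp_hom[OF h l(1)] C.ident_hom[OF x]])
          (simp add: FC[OF h l(1)] FI[OF x] l \<eta>[OF x] ee'[OF d])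
    qed
  qed
  have "naturally_isomorphic C C (comp_functor G F) id_functor"
    unfolding naturally_isomorphic_def
  proof (intro exI[of _ \<eta>] conjI ballI)
    fix x assume x: "x \<in> Obj C"
    show "\<eta> x \<in> Hom C (FObj (comp_functor G F) x) (FObj id_functor x)"
      using \<eta>[OF x] GO by (simp add: comp_functor_def id_functor_def)
    show "is_iso C (\<eta> x)" using \<eta>_iso x .
  next
    fix l assume "l \<in> Arr C"
    then obtain x y where l: "l \<in> Hom C x y" using HomI by metis
    have xy: "x \<in> Obj C" "y \<in> Obj C" using C.Hom_Obj l by auto
    note Fl = FH[OF l] and hx = conjunct1[OF \<eta>[OF xy(1)]] and hy = conjunct1[OF \<eta>[OF xy(2)]]
    note Gl = GA[OF Fl, THEN conjunct1]
    have "C.comp l (\<eta> x) = C.comp (\<eta> y) (FArr G (FArr F l))"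
    proof (rule faith[OF C.comp_hom[OF l hx] C.comp_hom[OF hy Gl]])
      have 1: "D.comp (FArr F l) (e (FObj F x)) \<in> Hom D (FObj F (g (FObj F x))) (FObj F y)"
        using D.comp_hom Fl e FO xy by blast
      note d = FO[OF xy(2)]
      have "D.comp (e (FObj F y)) (D.comp (e' (FObj F y)) (D.comp (FArr F l) (e (FObj F x))))
          = D.comp (FArr F l) (e (FObj F x))"
        using D.comp_assoc[OF e[OF d] e'[OF d] 1] ee'[OF d] D.comp_ident_left[OF 1] by simp
      then show "FArr F (C.comp l (\<eta> x)) = FArr F (C.comp (\<eta> y) (FArr G (FArr F l)))"
        using FC[OF l hx] FC[OF hy Gl] GA[OF Fl] \<eta> xy by simp
    qed
    then show "C.comp (FArr id_functor l) (\<eta> (Dom C l))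
        = C.comp (\<eta> (Cod C l)) (FArr (comp_functor G F) l)"
      using HomD[OF l] by (simp add: comp_functor_def id_functor_def)
  qed
  ultimately show ?thesis using F G unfolding is_equivalence_def by blast
qed


section \<open>Slices, products and the coproduct functor\<close>

context cat
begin

lemma slice_Obj: "Obj (slice C x) = {f \<in> Arr C. Cod C f = x}"
  by (simp add: slice_def)

lemma slice_Hom: "\<phi> \<in> Hom (slice C x) f g \<longleftrightarrow>
    f \<in> Arr C \<and> Cod C f = x \<and> g \<in> Arr C \<and> Cod C g = x \<and>
    (\<exists>h. \<phi> = (f, h, g) \<and> h \<in> Hom C (Dom C f) (Dom C g) \<and> g \<cdot> h = f)"
  unfolding slice_def Hom_def by auto

lemma slice_Arr: "\<phi> \<in> Arr (slice C x) \<longleftrightarrow>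
    (\<exists>f h g. \<phi> = (f, h, g) \<and> f \<in> Arr C \<and> Cod C f = x \<and> g \<in> Arr C \<and> Cod C g = x \<and>
      h \<in> Hom C (Dom C f) (Dom C g) \<and> g \<cdot> h = f)"
  unfolding slice_def by auto

lemma slice_simps [simp]:
  "Dom (slice C x) (f, h, g) = f"
  "Cod (slice C x) (f, h, g) = g"
  "Ident (slice C x) f = (f, Ident C (Dom C f), f)"
  "Comp (slice C x) (g, k, l) (f, h, g') = (f, k \<cdot> h, l)"
  by (simp_all add: slice_def)

lemma slice_category: "is_category (slice C x)"
  unfolding is_category_def
proof (intro conjI ballI impI)
  fix \<phi> assume \<phi>: "\<phi> \<in> Arr (slice C x)"
  then show "Dom (slice C x) \<phi> \<in> Obj (slice C x)" "Cod (slice C x) \<phi> \<in> Obj (slice C x)"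
    by (auto simp: slice_Arr slice_Obj)
  show "Comp (slice C x) \<phi> (Ident (slice C x) (Dom (slice C x) \<phi>)) = \<phi>"
    "Comp (slice C x) (Ident (slice C x) (Cod (slice C x) \<phi>)) \<phi> = \<phi>"
    using \<phi> by (auto simp: slice_Arr comp_ident_left comp_ident_right)
next
  fix f assume "f \<in> Obj (slice C x)"
  then have f: "f \<in> Arr C" "Cod C f = x" by (auto simp: slice_Obj)
  then show "Ident (slice C x) f \<in> Hom (slice C x) f f"
    using ident_hom[OF Arr_Obj(1)] comp_ident_right[OF HomI] by (auto simp: slice_Hom)
next
  fix \<phi> \<psi> assume as: "\<phi> \<in> Arr (slice C x)" "\<psi> \<in> Arr (slice C x)"
    "Cod (slice C x) \<phi> = Dom (slice C x) \<psi>"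
  obtain f h g where \<phi>: "\<phi> = (f, h, g)" "f \<in> Arr C" "Cod C f = x" "g \<in> Arr C" "Cod C g = x"
    "h \<in> Hom C (Dom C f) (Dom C g)" "g \<cdot> h = f"
    using as unfolding slice_Arr by blast
  obtain g' k l where \<psi>': "\<psi> = (g', k, l)" "l \<in> Arr C" "Cod C l = x"
    "k \<in> Hom C (Dom C g') (Dom C l)" "l \<cdot> k = g'"
    using as(2) unfolding slice_Arr by blast
  have "g' = g" using as(3) \<phi>(1) \<psi>'(1) by simp
  note \<psi> = \<psi>'[unfolded this]
  have "l \<cdot> k \<cdot> h = f" using comp_assoc[OF HomI[OF \<psi>(2)] \<psi>(4) \<phi>(6)] \<phi> \<psi> by simp
  then show "Comp (slice C x) \<psi> \<phi> \<in> Hom (slice C x) (Dom (slice C x) \<phi>) (Cod (slice C x) \<psi>)"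
    using \<phi> \<psi> comp_hom by (auto simp: slice_Hom)
  fix \<chi> assume "\<chi> \<in> Arr (slice C x)" "Cod (slice C x) \<psi> = Dom (slice C x) \<chi>"
  then obtain m n where \<chi>: "\<chi> = (l, m, n)" "m \<in> Hom C (Dom C l) (Dom C n)"
    using \<psi> unfolding slice_Arr by auto
  show "Comp (slice C x) \<chi> (Comp (slice C x) \<psi> \<phi>) = Comp (slice C x) (Comp (slice C x) \<chi> \<psi>) \<phi>"
    using \<phi> \<psi> \<chi> comp_assoc[OF \<chi>(2) \<psi>(4) \<phi>(6)] by simp
qed

text \<open>The inverse \<open>k\<close> of \<open>h\<close> lies over \<open>x\<close> of its own
  accord: \<open>g \<cdot> h = f\<close> gives \<open>f \<cdot> k = g\<close>.\<close>

lemma slice_iso: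
  assumes f: "f \<in> Hom C y x" and g: "g \<in> Hom C z x" and h: "h \<in> Hom C y z" "is_iso C h"
    and e: "g \<cdot> h = f"
  shows "(f, h, g) \<in> Hom (slice C x) f g" "is_iso (slice C x) (f, h, g)"
proof -
  interpret S: cat "slice C x" by unfold_locales (rule slice_category)
  obtain k where k: "k \<in> Hom C z y" "k \<cdot> h = Ident C y" "h \<cdot> k = Ident C z"
    using is_isoE h by metis
  show 1: "(f, h, g) \<in> Hom (slice C x) f g"
    unfolding slice_Hom using f g h e by (auto simp: Hom_def)
  have "f \<cdot> k = g"
    using comp_assoc[OF g h(1) k(1)] k comp_ident_right[OF g] e by simp
  then have 2: "(g, k, f) \<in> Hom (slice C x) g f"
    unfolding slice_Hom using f g k by (auto simp: Hom_def)
  show "is_iso (slice C x) (f, h, g)"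
    using S.is_isoI[OF 1 2] k f g by (simp add: Hom_def)
qed

end

lemma product_category_simps [simp]:
  "Obj (product_category I D) = (\<Pi>\<^sub>E i\<in>I. Obj (D i))"
  "Arr (product_category I D) = (\<Pi>\<^sub>E i\<in>I. Arr (D i))"
  "Dom (product_category I D) f = (\<lambda>i\<in>I. Dom (D i) (f i))"
  "Cod (product_category I D) f = (\<lambda>i\<in>I. Cod (D i) (f i))"
  "Ident (product_category I D) x = (\<lambda>i\<in>I. Ident (D i) (x i))"
  "Comp (product_category I D) g f = (\<lambda>i\<in>I. Comp (D i) (g i) (f i))"
  by (simp_all add: product_category_def)

text \<open>Domain and codomain of a family are functions restricted to \<open>I\<close>. Since
  \<open>x\<close> and \<open>y\<close> are extensional, an equation between such functions is the
  same as equality at each index.\<close>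

lemma product_category_Hom:
  assumes "x \<in> (\<Pi>\<^sub>E i\<in>I. Obj (D i))" "y \<in> (\<Pi>\<^sub>E i\<in>I. Obj (D i))"
  shows "Hom (product_category I D) x y = (\<Pi>\<^sub>E i\<in>I. Hom (D i) (x i) (y i))"
proof -
  have "(\<lambda>i\<in>I. Dom (D i) (f i)) = x \<longleftrightarrow> (\<forall>i\<in>I. Dom (D i) (f i) = x i)"
    "(\<lambda>i\<in>I. Cod (D i) (f i)) = y \<longleftrightarrow> (\<forall>i\<in>I. Cod (D i) (f i) = y i)" for f
    using assms by (auto simp: fun_eq_iff restrict_def PiE_def extensional_def)
  then show ?thesis
    unfolding Hom_def by (auto simp: PiE_iff extensional_def)
qed

lemma product_category_category:
  assumes "\<And>i. i \<in> I \<Longrightarrow> is_category (D i)"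
  shows "is_category (product_category I D)"
proof -
  have D: "cat (D i)" if "i \<in> I" for i using assms[OF that] by unfold_locales
  show ?thesis
    unfolding is_category_def
  proof (intro conjI ballI impI)
    fix f assume f: "f \<in> Arr (product_category I D)"
    then have fi: "f i \<in> Arr (D i)" if "i \<in> I" for i using that by auto
    show "Dom (product_category I D) f \<in> Obj (product_category I D)"
      "Cod (product_category I D) f \<in> Obj (product_category I D)"
      using cat.Arr_Obj[OF D] fi by auto
    show "Comp (product_category I D) f
            (Ident (product_category I D) (Dom (product_category I D) f)) = f"
      using f cat.comp_ident_right[OF D HomI[OF fi]]
      by (auto simp: PiE_iff intro!: extensionalityI[of _ I])
    show "Comp (product_category I D)
            (Ident (product_category I D) (Cod (product_category I D) f)) f = f"
      using f cat.comp_ident_left[OF D HomI[OF fi]]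
      by (auto simp: PiE_iff intro!: extensionalityI[of _ I])
  next
    fix x assume x: "x \<in> Obj (product_category I D)"
    then show "Ident (product_category I D) x \<in> Hom (product_category I D) x x"
      using cat.ident_hom[OF D] by (subst product_category_Hom) auto
  next
    fix f g assume f: "f \<in> Arr (product_category I D)" and g: "g \<in> Arr (product_category I D)"
      and "Cod (product_category I D) f = Dom (product_category I D) g"
    then have fg: "Cod (D i) (f i) = Dom (D i) (g i)" if "i \<in> I" for i
      using that by (auto simp: fun_eq_iff split: if_splits)
    have fi: "f i \<in> Hom (D i) (Dom (D i) (f i)) (Dom (D i) (g i))"
      and gi: "g i \<in> Hom (D i) (Dom (D i) (g i)) (Cod (D i) (g i))" if "i \<in> I" for i
      using that f g fg by (auto simp: Hom_def)
    show "Comp (product_category I D) g f \<in> Hom (product_category I D)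
            (Dom (product_category I D) f) (Cod (product_category I D) g)"
      using cat.comp_hom[OF D gi fi] cat.Hom_Obj[OF D fi] cat.Hom_Obj[OF D gi]
      by (subst product_category_Hom) auto
    fix h assume h: "h \<in> Arr (product_category I D)"
      and "Cod (product_category I D) g = Dom (product_category I D) h"
    then have gh: "Cod (D i) (g i) = Dom (D i) (h i)" if "i \<in> I" for i
      using that by (auto simp: fun_eq_iff split: if_splits)
    have hi: "h i \<in> Hom (D i) (Cod (D i) (g i)) (Cod (D i) (h i))" if "i \<in> I" for i
      using that h gh by (auto simp: Hom_def)
    show "Comp (product_category I D) h (Comp (product_category I D) g f)
        = Comp (product_category I D) (Comp (product_category I D) h g) f"
      using cat.comp_assoc[OF D hi gi fi] by (auto intro!: restrict_ext)
  qed
qed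

section \<open>The functor on slices induced by a choice of coproducts\<close>

locale coproduct_choice = cat C for C :: "('o, 'a) category" +
  fixes I :: "'i set" and K :: "('i \<Rightarrow> 'o) \<Rightarrow> 'o \<times> ('i \<Rightarrow> 'a)"
  assumes choice: "is_coproduct_choice C I K"
begin

lemma chosen: "A \<in> I \<rightarrow>\<^sub>E Obj C \<Longrightarrow> is_coproduct C I A (fst (K A)) (snd (K A))"
  using choice by (simp add: is_coproduct_choice_def)

text \<open>The definition reads its source and target families off \<open>f\<close> as restrictions
  to \<open>I\<close>; the extensional families \<open>A\<close> and \<open>B\<close> are equal to
  these, so the universal property of the chosen coproduct of \<open>A\<close> applies to the
  definite description.\<close>

lemma coproduct_arrow:
  assumes A: "A \<in> I \<rightarrow>\<^sub>E Obj C" and B: "B \<in> I \<rightarrow>\<^sub>E Obj C"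
    and f: "\<And>i. i \<in> I \<Longrightarrow> f i \<in> Hom C (A i) (B i)"
  shows "coproduct_arrow C I K f \<in> Hom C (fst (K A)) (fst (K B))"
    and "\<And>i. i \<in> I \<Longrightarrow> coproduct_arrow C I K f \<cdot> snd (K A) i = snd (K B) i \<cdot> f i"
    and "\<And>h. \<lbrakk>h \<in> Hom C (fst (K A)) (fst (K B)); \<And>i. i \<in> I \<Longrightarrow> h \<cdot> snd (K A) i = snd (K B) i \<cdot> f i\<rbrakk>
           \<Longrightarrow> coproduct_arrow C I K f = h"
proof -
  have eq: "(\<lambda>i\<in>I. Dom C (f i)) = A" "(\<lambda>i\<in>I. Cod C (f i)) = B"
    using A B HomD[OF f] by (auto simp: PiE_iff intro!: extensionalityI[of _ I])
  have "\<exists>!h. h \<in> Hom C (fst (K A)) (fst (K B)) \<and> (\<forall>i\<in>I. h \<cdot> snd (K A) i = snd (K B) i \<cdot> f i)"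
  proof (rule coproduct_ex1[OF chosen[OF A]])
    show "fst (K B) \<in> Obj C" using chosen[OF B] by (simp add: is_coproduct_def)
    show "snd (K B) i \<cdot> f i \<in> Hom C (A i) (fst (K B))" if "i \<in> I" for i
      using that f comp_hom coproduct_injection[OF chosen[OF B]] by blast
  qed
  then have ex: "\<exists>!h. h \<in> Hom C (fst (K A)) (fst (K B)) \<and>
      (\<forall>i\<in>I. h \<cdot> snd (K A) i = snd (K B) i \<cdot> f i)" .
  have def: "coproduct_arrow C I K f = (THE h. h \<in> Hom C (fst (K A)) (fst (K B)) \<and>
      (\<forall>i\<in>I. h \<cdot> snd (K A) i = snd (K B) i \<cdot> f i))"
    by (simp add: coproduct_arrow_def eq)
  show "coproduct_arrow C I K f \<in> Hom C (fst (K A)) (fst (K B))"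
    "\<And>i. i \<in> I \<Longrightarrow> coproduct_arrow C I K f \<cdot> snd (K A) i = snd (K B) i \<cdot> f i"
    using theI'[OF ex] unfolding def by auto
  show "\<And>h. \<lbrakk>h \<in> Hom C (fst (K A)) (fst (K B)); \<And>i. i \<in> I \<Longrightarrow> h \<cdot> snd (K A) i = snd (K B) i \<cdot> f i\<rbrakk>
           \<Longrightarrow> coproduct_arrow C I K f = h"
    unfolding def by (rule the1_equality[OF ex]) auto
qed

lemma coproduct_arrow_ident:
  assumes "A \<in> I \<rightarrow>\<^sub>E Obj C" "\<And>i. i \<in> I \<Longrightarrow> f i = Ident C (A i)"
  shows "coproduct_arrow C I K f = Ident C (fst (K A))"
proof (rule coproduct_arrow(3)[OF assms(1) assms(1)])
  have A: "A i \<in> Obj C" if "i \<in> I" for i using that assms by auto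
  show "f i \<in> Hom C (A i) (A i)" if "i \<in> I" for i using that A ident_hom assms by simp
  show "Ident C (fst (K A)) \<in> Hom C (fst (K A)) (fst (K A))"
    using chosen[OF assms(1)] ident_hom by (simp add: is_coproduct_def)
  show "Ident C (fst (K A)) \<cdot> snd (K A) i = snd (K A) i \<cdot> f i" if "i \<in> I" for i
    using that coproduct_injection[OF chosen[OF assms(1)] that] assms
    by (simp add: comp_ident_left comp_ident_right)
qed

text \<open>The composite enters as a separate family \<open>l\<close> constrained only on
  \<open>I\<close>. This way the same rule yields functoriality, where \<open>l\<close> is a
  pointwise composite, and the slice condition, where \<open>l\<close> is the given family of
  objects over the \<open>X i\<close>.\<close>

lemma coproduct_arrow_comp:
  assumes A: "A \<in> I \<rightarrow>\<^sub>E Obj C" and B: "B \<in> I \<rightarrow>\<^sub>E Obj C" and D: "D \<in> I \<rightarrow>\<^sub>E Obj C"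
    and f: "\<And>i. i \<in> I \<Longrightarrow> f i \<in> Hom C (A i) (B i)"
    and g: "\<And>i. i \<in> I \<Longrightarrow> g i \<in> Hom C (B i) (D i)"
    and l: "\<And>i. i \<in> I \<Longrightarrow> l i = g i \<cdot> f i"
  shows "coproduct_arrow C I K l = coproduct_arrow C I K g \<cdot> coproduct_arrow C I K f"
proof (rule coproduct_arrow(3)[OF A D])
  have F: "coproduct_arrow C I K f \<in> Hom C (fst (K A)) (fst (K B))"
    "\<And>i. i \<in> I \<Longrightarrow> coproduct_arrow C I K f \<cdot> snd (K A) i = snd (K B) i \<cdot> f i"
    by (rule coproduct_arrow[OF A B], rule f, assumption)+
  have G: "coproduct_arrow C I K g \<in> Hom C (fst (K B)) (fst (K D))"
    "\<And>i. i \<in> I \<Longrightarrow> coproduct_arrow C I K g \<cdot> snd (K B) i = snd (K D) i \<cdot> g i"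
    by (rule coproduct_arrow[OF B D], rule g, assumption)+
  show "l i \<in> Hom C (A i) (D i)" if "i \<in> I" for i using that l comp_hom[OF g f] by simp
  show "coproduct_arrow C I K g \<cdot> coproduct_arrow C I K f \<in> Hom C (fst (K A)) (fst (K D))"
    using comp_hom[OF G(1) F(1)] .
  fix i assume i: "i \<in> I"
  note \<iota>A = coproduct_injection[OF chosen[OF A] i] and \<iota>B = coproduct_injection[OF chosen[OF B] i]
    and \<iota>D = coproduct_injection[OF chosen[OF D] i]
  have "(coproduct_arrow C I K g \<cdot> coproduct_arrow C I K f) \<cdot> snd (K A) i
      = coproduct_arrow C I K g \<cdot> snd (K B) i \<cdot> f i"
    using comp_assoc[OF G(1) F(1) \<iota>A] F(2) i by simp
  also have "\<dots> = (snd (K D) i \<cdot> g i) \<cdot> f i"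
    using comp_assoc[OF G(1) \<iota>B f[OF i]] G(2) i by simp
  also have "\<dots> = snd (K D) i \<cdot> l i"
    using comp_assoc[OF \<iota>D g[OF i] f[OF i]] l i by simp
  finally show "(coproduct_arrow C I K g \<cdot> coproduct_arrow C I K f) \<cdot> snd (K A) i
      = snd (K D) i \<cdot> l i" .
qed

abbreviation (input) slices where "slices X \<equiv> product_category I (\<lambda>i. slice C (X i))"

lemma slices_Hom:
  assumes "f \<in> Obj (slices X)" "g \<in> Obj (slices X)"
  shows "\<phi> \<in> Hom (slices X) f g \<longleftrightarrow>
    (\<exists>h. (\<forall>i\<in>I. h i \<in> Hom C (Dom C (f i)) (Dom C (g i)) \<and> g i \<cdot> h i = f i) \<and>
         \<phi> = (\<lambda>i\<in>I. (f i, h i, g i)))" (is "_ \<longleftrightarrow> ?R")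
proof -
  have 1: "\<phi> \<in> Hom (slices X) f g \<longleftrightarrow> \<phi> \<in> (\<Pi>\<^sub>E i\<in>I. Hom (slice C (X i)) (f i) (g i))"
    using assms by (subst product_category_Hom) auto
  show ?thesis
  proof
    assume "\<phi> \<in> Hom (slices X) f g"
    then have \<phi>: "\<phi> \<in> (\<Pi>\<^sub>E i\<in>I. Hom (slice C (X i)) (f i) (g i))" using 1 by simp
    then have "\<forall>i\<in>I. \<phi> i = (f i, fst (snd (\<phi> i)), g i) \<and>
        fst (snd (\<phi> i)) \<in> Hom C (Dom C (f i)) (Dom C (g i)) \<and> g i \<cdot> fst (snd (\<phi> i)) = f i"
      by (auto simp: PiE_iff slice_Hom)
    then show ?R using \<phi>
      by (intro exI[of _ "\<lambda>i. fst (snd (\<phi> i))"]) (auto intro!: extensionalityI[of _ I] simp: PiE_iff)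
  next
    assume ?R
    then show "\<phi> \<in> Hom (slices X) f g"
      using assms unfolding 1 by (auto simp: slice_Obj slice_Hom PiE_iff)
  qed
qed


lemma slices_dom: "f \<in> Obj (slices X) \<Longrightarrow> (\<lambda>i\<in>I. Dom C (f i)) \<in> I \<rightarrow>\<^sub>E Obj C"
  and slices_hom: "f \<in> Obj (slices X) \<Longrightarrow> i \<in> I \<Longrightarrow> f i \<in> Hom C ((\<lambda>i\<in>I. Dom C (f i)) i) (X i)"
  using Arr_Obj by (auto simp: slice_Obj PiE_iff Hom_def)

lemma coproduct_functor_FObj: "FObj (coproduct_functor C I K) = coproduct_arrow C I K"
  by (simp add: coproduct_functor_def)

lemma coproduct_functor_FArr:
  "FArr (coproduct_functor C I K) (\<lambda>i\<in>I. (f i, h i, g i)) =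
     (coproduct_arrow C I K f, coproduct_arrow C I K h, coproduct_arrow C I K g)"
proof -
  have "coproduct_arrow C I K (\<lambda>i\<in>I. f i) = coproduct_arrow C I K f" for f
    unfolding coproduct_arrow_def Let_def
    by (rule arg_cong[where f = The]) (auto simp: fun_eq_iff cong: restrict_cong)
  from this[of f] this[of h] this[of g] show ?thesis
    by (simp add: coproduct_functor_def cong: restrict_cong)
qed

lemma coproduct_functor_is_functor:
  assumes X: "X \<in> I \<rightarrow>\<^sub>E Obj C"
  shows "is_functor (slices X) (slice C (fst (K X))) (coproduct_functor C I K)"
proof -
  let ?F = "coproduct_arrow C I K"
  note dom = slices_dom and hom = slices_hom[where X = X]
    and obj = coproduct_functor_FObj and arr = coproduct_functor_FArr
  have F: "?F f \<in> Hom C (fst (K (\<lambda>i\<in>I. Dom C (f i)))) (fst (K X))" if "f \<in> Obj (slices X)" for f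
    using coproduct_arrow(1)[OF dom[OF that] X hom[OF that]] .
  have Fh: "(?F f, ?F h, ?F g) \<in> Hom (slice C (fst (K X))) (?F f) (?F g)"
    if fg: "f \<in> Obj (slices X)" "g \<in> Obj (slices X)"
      and h: "\<And>i. i \<in> I \<Longrightarrow> h i \<in> Hom C (Dom C (f i)) (Dom C (g i)) \<and> g i \<cdot> h i = f i" for f g h
  proof -
    have h': "h i \<in> Hom C ((\<lambda>i\<in>I. Dom C (f i)) i) ((\<lambda>i\<in>I. Dom C (g i)) i)" if "i \<in> I" for i
      using h that by simp
    have *: "?F h \<in> Hom C (fst (K (\<lambda>i\<in>I. Dom C (f i)))) (fst (K (\<lambda>i\<in>I. Dom C (g i))))"
      using coproduct_arrow(1)[OF dom[OF fg(1)] dom[OF fg(2)] h'] .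
    \<comment> \<open>The triangles \<open>g i \<cdot> h i = f i\<close> over the \<open>X i\<close>
      are sent to a triangle over the coproduct, because the coproduct respects composition.\<close>
    have "?F f = ?F g \<cdot> ?F h"
      by (rule coproduct_arrow_comp[OF dom[OF fg(1)] dom[OF fg(2)] X h' hom[OF fg(2)]])
        (use h in auto)
    then show "(?F f, ?F h, ?F g) \<in> Hom (slice C (fst (K X))) (?F f) (?F g)"
      unfolding slice_Hom using F[OF fg(1)] F[OF fg(2)] * by (auto simp: Hom_def)
  qed
  interpret P: cat "slices X"
    by unfold_locales (rule product_category_category, rule slice_category)
  show ?thesis
    unfolding is_functor_def
  proof (intro conjI ballI impI)
    show "FObj (coproduct_functor C I K) f \<in> Obj (slice C (fst (K X)))" if "f \<in> Obj (slices X)" for f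
      using F[OF that] by (simp add: obj slice_Obj Hom_def)
  next
    fix \<phi> assume "\<phi> \<in> Arr (slices X)"
    then obtain f g where fg: "\<phi> \<in> Hom (slices X) f g" using HomI by metis
    note o = P.Hom_Obj[OF fg]
    obtain h where h: "\<And>i. i \<in> I \<Longrightarrow> h i \<in> Hom C (Dom C (f i)) (Dom C (g i)) \<and> g i \<cdot> h i = f i"
      and \<phi>: "\<phi> = (\<lambda>i\<in>I. (f i, h i, g i))"
      using fg unfolding slices_Hom[OF o] by blast
    have d: "Dom (slices X) \<phi> = f" "Cod (slices X) \<phi> = g" using fg HomD by metis+
    show "FArr (coproduct_functor C I K) \<phi> \<in> Hom (slice C (fst (K X)))
        (FObj (coproduct_functor C I K) (Dom (slices X) \<phi>))
        (FObj (coproduct_functor C I K) (Cod (slices X) \<phi>))"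
      unfolding d obj unfolding \<phi> arr by (rule Fh[OF o h])
    fix \<psi> assume "\<psi> \<in> Arr (slices X)" "Cod (slices X) \<phi> = Dom (slices X) \<psi>"
    then obtain l where gl: "\<psi> \<in> Hom (slices X) g l" using HomI d by metis
    note o' = P.Hom_Obj[OF gl]
    obtain k where k: "\<And>i. i \<in> I \<Longrightarrow> k i \<in> Hom C (Dom C (g i)) (Dom C (l i)) \<and> l i \<cdot> k i = g i"
      and \<psi>: "\<psi> = (\<lambda>i\<in>I. (g i, k i, l i))"
      using gl unfolding slices_Hom[OF o'] by blast
    have c: "Comp (slices X) \<psi> \<phi> = (\<lambda>i\<in>I. (f i, k i \<cdot> h i, l i))"
      unfolding \<phi> \<psi> by (auto intro!: restrict_ext)
    have "?F (\<lambda>i. k i \<cdot> h i) = ?F k \<cdot> ?F h"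
      by (rule coproduct_arrow_comp[OF dom[OF o(1)] dom[OF o(2)] dom[OF o'(2)]]) (use h k in auto)
    then show "FArr (coproduct_functor C I K) (Comp (slices X) \<psi> \<phi>) =
        Comp (slice C (fst (K X))) (FArr (coproduct_functor C I K) \<psi>)
          (FArr (coproduct_functor C I K) \<phi>)"
      unfolding c unfolding \<phi> \<psi> arr by simp
  next
    fix f assume f: "f \<in> Obj (slices X)"
    have id: "Ident (slices X) f = (\<lambda>i\<in>I. (f i, Ident C (Dom C (f i)), f i))" by simp
    have "?F (\<lambda>i. Ident C (Dom C (f i))) = Ident C (Dom C (?F f))"
      using coproduct_arrow_ident[OF dom[OF f], of "\<lambda>i. Ident C (Dom C (f i))"] F[OF f]
      by (simp add: Hom_def)
    then show "FArr (coproduct_functor C I K) (Ident (slices X) f) =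
        Ident (slice C (fst (K X))) (FObj (coproduct_functor C I K) f)"
      unfolding id arr obj by simp
  qed
qed

text \<open>
  Extensivity splits into fullness and faithfulness, which follow from the squares of coproduct
  injections being pullbacks, and essential surjectivity, which follows from pulling a coproduct
  decomposition back along any morphism.
\<close>

theorem coproduct_functor_equivalence:
  assumes X: "X \<in> I \<rightarrow>\<^sub>E Obj C"
    and decompose: "\<And>f T. f \<in> Hom C T (fst (K X)) \<Longrightarrow>
      \<exists>B g j. B \<in> I \<rightarrow>\<^sub>E Obj C \<and> is_coproduct C I B T j \<and>
        (\<forall>i\<in>I. g i \<in> Hom C (B i) (X i) \<and> f \<cdot> j i = snd (K X) i \<cdot> g i)"
    and pullback: "\<And>B S j g h T a b i. \<lbrakk>is_coproduct C I B S j; h \<in> Hom C S (fst (K X));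
        \<And>i. i \<in> I \<Longrightarrow> g i \<in> Hom C (B i) (X i); \<And>i. i \<in> I \<Longrightarrow> h \<cdot> j i = snd (K X) i \<cdot> g i;
        i \<in> I; a \<in> Hom C T S; b \<in> Hom C T (X i); h \<cdot> a = snd (K X) i \<cdot> b\<rbrakk>
      \<Longrightarrow> \<exists>!c. c \<in> Hom C T (B i) \<and> j i \<cdot> c = a \<and> g i \<cdot> c = b"
  shows "is_equivalence (slices X) (slice C (fst (K X))) (coproduct_functor C I K)"
proof (rule fully_faithful_essentially_surjective_equivalence)
  let ?F = "coproduct_arrow C I K"
  let ?dom = "\<lambda>f. \<lambda>i\<in>I. Dom C (f i)"
  note dom = slices_dom and hom = slices_hom[where X = X]
    and obj = coproduct_functor_FObj and arr = coproduct_functor_FArr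
  have F: "?F f \<in> Hom C (fst (K (?dom f))) (fst (K X))"
    and F\<iota>: "\<And>i. i \<in> I \<Longrightarrow> ?F f \<cdot> snd (K (?dom f)) i = snd (K X) i \<cdot> f i"
    if "f \<in> Obj (slices X)" for f
    by (rule coproduct_arrow[OF dom[OF that] X], rule hom[OF that], assumption)+
  show "is_category (slices X)" by (rule product_category_category, rule slice_category)
  show "is_category (slice C (fst (K X)))" by (rule slice_category)
  show "is_functor (slices X) (slice C (fst (K X))) (coproduct_functor C I K)"
    by (rule coproduct_functor_is_functor[OF X])
  {
    fix f g \<kappa> assume f: "f \<in> Obj (slices X)" and g: "g \<in> Obj (slices X)"
      and "\<kappa> \<in> Hom (slice C (fst (K X))) (FObj (coproduct_functor C I K) f)
              (FObj (coproduct_functor C I K) g)"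
    then obtain k where \<kappa>: "\<kappa> = (?F f, k, ?F g)"
      and k: "k \<in> Hom C (fst (K (?dom f))) (fst (K (?dom g)))" "?F g \<cdot> k = ?F f"
      unfolding obj slice_Hom using F[OF f] F[OF g] by (auto simp: Hom_def)
    note A = chosen[OF dom[OF f]] and B = chosen[OF dom[OF g]]
    \<comment> \<open>On the summand with index \<open>i\<close>, the arrow \<open>k\<close> after
      the injection and the arrow \<open>f i\<close> form a commutative square over
      \<open>?F g\<close> and the injection of \<open>X i\<close>. The arrow into the pullback is
      the only possible component at \<open>i\<close> of a preimage of \<open>k\<close>.\<close>
    have "\<exists>!c. c \<in> Hom C (?dom f i) (?dom g i) \<and> snd (K (?dom g)) i \<cdot> c = k \<cdot> snd (K (?dom f)) i
            \<and> g i \<cdot> c = f i" if i: "i \<in> I" for i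
    proof (rule pullback[OF B F[OF g] hom[OF g] F\<iota>[OF g] i])
      note \<iota> = coproduct_injection[OF A i]
      show "k \<cdot> snd (K (?dom f)) i \<in> Hom C (?dom f i) (fst (K (?dom g)))"
        using comp_hom[OF k(1) \<iota>] .
      show "f i \<in> Hom C (?dom f i) (X i)" using hom[OF f i] .
      show "?F g \<cdot> k \<cdot> snd (K (?dom f)) i = snd (K X) i \<cdot> f i"
        using comp_assoc[OF F[OF g] k(1) \<iota>] k(2) F\<iota>[OF f i] by simp
    qed
    then obtain c where c: "\<And>i. i \<in> I \<Longrightarrow> c i \<in> Hom C (?dom f i) (?dom g i) \<and>
        snd (K (?dom g)) i \<cdot> c i = k \<cdot> snd (K (?dom f)) i \<and> g i \<cdot> c i = f i"
      and uniq: "\<And>i c'. \<lbrakk>i \<in> I; c' \<in> Hom C (?dom f i) (?dom g i);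
        snd (K (?dom g)) i \<cdot> c' = k \<cdot> snd (K (?dom f)) i; g i \<cdot> c' = f i\<rbrakk> \<Longrightarrow> c' = c i"
      by metis
    show "\<exists>!\<phi>. \<phi> \<in> Hom (slices X) f g \<and> FArr (coproduct_functor C I K) \<phi> = \<kappa>"
    proof (rule ex1I[where a = "\<lambda>i\<in>I. (f i, c i, g i)"])
      have "?F c = k"
        by (rule coproduct_arrow(3)[OF dom[OF f] dom[OF g]]) (use c k in auto)
      moreover have "(\<lambda>i\<in>I. (f i, c i, g i)) \<in> Hom (slices X) f g"
        unfolding slices_Hom[OF f g] using c by (intro exI[of _ c]) auto
      ultimately show "(\<lambda>i\<in>I. (f i, c i, g i)) \<in> Hom (slices X) f g \<and>
          FArr (coproduct_functor C I K) (\<lambda>i\<in>I. (f i, c i, g i)) = \<kappa>"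
        unfolding arr \<kappa> by simp
    next
      fix \<phi> assume as: "\<phi> \<in> Hom (slices X) f g \<and> FArr (coproduct_functor C I K) \<phi> = \<kappa>"
      then obtain h where h: "\<And>i. i \<in> I \<Longrightarrow> h i \<in> Hom C (Dom C (f i)) (Dom C (g i)) \<and> g i \<cdot> h i = f i"
        and \<phi>: "\<phi> = (\<lambda>i\<in>I. (f i, h i, g i))"
        unfolding slices_Hom[OF f g] by blast
      have "?F h = k" using as unfolding \<phi> arr \<kappa> by simp
      \<comment> \<open>The defining equation of \<open>?F h\<close> is the first of the two
        equations that characterize \<open>c i\<close>; the slice condition on \<open>h i\<close> is
        the second.\<close>
      moreover have "?F h \<cdot> snd (K (?dom f)) i = snd (K (?dom g)) i \<cdot> h i" if "i \<in> I" for i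
        by (rule coproduct_arrow(2)[OF dom[OF f] dom[OF g]]) (use h that in auto)
      ultimately have "h i = c i" if "i \<in> I" for i
        using uniq[OF that, of "h i"] h[OF that] that by simp
      then show "\<phi> = (\<lambda>i\<in>I. (f i, c i, g i))" unfolding \<phi> by (auto intro!: restrict_ext)
    qed
  next
    fix f assume "f \<in> Obj (slice C (fst (K X)))"
    then have f: "f \<in> Hom C (Dom C f) (fst (K X))" by (simp add: slice_Obj Hom_def)
    obtain B g j where B: "B \<in> I \<rightarrow>\<^sub>E Obj C" and cop: "is_coproduct C I B (Dom C f) j"
      and g: "\<And>i. i \<in> I \<Longrightarrow> g i \<in> Hom C (B i) (X i)"
      and j: "\<And>i. i \<in> I \<Longrightarrow> f \<cdot> j i = snd (K X) i \<cdot> g i"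
      using decompose[OF f] by blast
    \<comment> \<open>\<open>Dom C f\<close> is some coproduct of \<open>B\<close>, whereas the
      functor produces the chosen one. The comparison \<open>\<theta>\<close> becomes the
      isomorphism from the image of \<open>g'\<close> to \<open>f\<close> in the slice.\<close>
    obtain \<theta> where \<theta>: "\<theta> \<in> Hom C (fst (K B)) (Dom C f)" "is_iso C \<theta>"
      "\<And>i. i \<in> I \<Longrightarrow> \<theta> \<cdot> snd (K B) i = j i"
      using coproduct_comparison[OF chosen[OF B] cop] by blast
    \<comment> \<open>Objects of the product category are extensional, while \<open>g\<close> may be
      anything off \<open>I\<close>.\<close>
    define g' where "g' = restrict g I"
    have g': "g' \<in> Obj (slices X)" using g by (auto simp: g'_def slice_Obj Hom_def)
    have "?F g' = f \<cdot> \<theta>"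
    proof (rule coproduct_arrow(3)[OF B X])
      show "g' i \<in> Hom C (B i) (X i)" if "i \<in> I" for i using g that by (simp add: g'_def)
      show "f \<cdot> \<theta> \<in> Hom C (fst (K B)) (fst (K X))" using comp_hom[OF f \<theta>(1)] .
      show "(f \<cdot> \<theta>) \<cdot> snd (K B) i = snd (K X) i \<cdot> g' i" if i: "i \<in> I" for i
        using comp_assoc[OF f \<theta>(1) coproduct_injection[OF chosen[OF B] i]] \<theta>(3)[OF i] j[OF i] i
        by (simp add: g'_def)
    qed
    moreover have "?dom g' = B"
      using HomD[OF g] B by (auto simp: g'_def PiE_iff intro!: extensionalityI[of _ I])
    ultimately have "(?F g', \<theta>, f) \<in> Hom (slice C (fst (K X))) (?F g') f \<and>
        is_iso (slice C (fst (K X))) (?F g', \<theta>, f)"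
      using slice_iso[OF F[OF g'] f _ \<theta>(2)] \<theta>(1) by metis
    then show "\<exists>x\<in>Obj (slices X). \<exists>e\<in>Hom (slice C (fst (K X)))
        (FObj (coproduct_functor C I K) x) f. is_iso (slice C (fst (K X))) e"
      using g' unfolding obj by blast
  }
qed

end

section \<open>Universes and size\<close>

locale universe =
  fixes elts :: "'s \<Rightarrow> 's set" and U :: 's
  assumes membership: "membership_structure elts"
    and grothendieck: "grothendieck_universe elts U"
begin

lemma inj_elts: "inj elts"
  using membership by (simp add: membership_structure_def)

lemma
  shows members: "\<forall>x\<in>elts U. elts x \<subseteq> elts U"
    and pairs: "\<forall>x\<in>elts U. \<forall>y\<in>elts U. \<exists>p\<in>elts U. elts p = {x, y}"
    and powersets: "\<forall>x\<in>elts U. \<exists>p\<in>elts U. elts ` elts p = Pow (elts x)"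
    and unions: "\<forall>x\<in>elts U. \<forall>f\<in>elts x \<rightarrow> elts U. \<exists>s\<in>elts U. elts s = (\<Union>i\<in>elts x. elts (f i))"
  using grothendieck[unfolded grothendieck_universe_def] by - (elim conjE, assumption)+

lemma transitive: "x \<in> elts U \<Longrightarrow> y \<in> elts x \<Longrightarrow> y \<in> elts U"
  using members by blast

text \<open>Separation comes out of the powerset condition: it provides a name for every subset of
  \<open>x\<close>, and transitivity puts this name into the universe.\<close>

lemma subset_member:
  assumes "x \<in> elts U" "B \<subseteq> elts x"
  shows "\<exists>y\<in>elts U. elts y = B"
proof -
  obtain p where p: "p \<in> elts U" "elts ` elts p = Pow (elts x)"
    using powersets assms(1) by blast
  then obtain y where "y \<in> elts p" "elts y = B" using assms(2) by (metis PowI imageE)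
  then show ?thesis using p(1) transitive by blast
qed

lemma UN_member:
  assumes "x \<in> elts U" "\<And>i. i \<in> elts x \<Longrightarrow> \<exists>y\<in>elts U. elts y = B i"
  shows "\<exists>s\<in>elts U. elts s = (\<Union>i\<in>elts x. B i)"
proof -
  obtain f where f: "\<And>i. i \<in> elts x \<Longrightarrow> f i \<in> elts U \<and> elts (f i) = B i"
    using assms(2) by metis
  then have "f \<in> elts x \<rightarrow> elts U" by blast
  then obtain s where "s \<in> elts U" "elts s = (\<Union>i\<in>elts x. elts (f i))"
    using unions assms(1) by meson
  then show ?thesis using f by auto
qed

lemma pair_member: "x \<in> elts U \<Longrightarrow> y \<in> elts U \<Longrightarrow> \<exists>p\<in>elts U. elts p = {x, y}"
  using pairs by blast

text \<open>Replacement, obtained as a union of the singletons \<open>{f i}\<close>.\<close>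

lemma image_member:
  assumes "x \<in> elts U" "\<And>i. i \<in> elts x \<Longrightarrow> f i \<in> elts U"
  shows "\<exists>s\<in>elts U. elts s = f ` elts x"
proof -
  have "\<exists>s\<in>elts U. elts s = (\<Union>i\<in>elts x. {f i})"
    by (rule UN_member[OF assms(1)]) (use pair_member assms(2) in fastforce)
  then show ?thesis by (simp add: UNION_singleton_eq_range)
qed

definition upair :: "'s \<Rightarrow> 's \<Rightarrow> 's" where
  "upair x y = (SOME p. p \<in> elts U \<and> elts p = {x, y})"

text \<open>The Kuratowski pair, meaningful for members of \<open>U\<close>. It tags an object with
  the index of its summand, so that the objects of a coproduct are again elements of type
  \<open>'s\<close>.\<close>

definition opair :: "'s \<Rightarrow> 's \<Rightarrow> 's" where
  "opair x y = upair (upair x x) (upair x y)"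

lemma upair: "x \<in> elts U \<Longrightarrow> y \<in> elts U \<Longrightarrow> upair x y \<in> elts U \<and> elts (upair x y) = {x, y}"
  unfolding upair_def using someI_ex[of "\<lambda>p. p \<in> elts U \<and> elts p = {x, y}"] pair_member by blast

lemma opair_member: "x \<in> elts U \<Longrightarrow> y \<in> elts U \<Longrightarrow> opair x y \<in> elts U"
  unfolding opair_def using upair by blast

lemma opair_inject:
  assumes "x \<in> elts U" "y \<in> elts U" "x' \<in> elts U" "y' \<in> elts U"
  shows "opair x y = opair x' y' \<longleftrightarrow> x = x' \<and> y = y'"
proof
  assume "opair x y = opair x' y'"
  moreover have "elts (opair a b) = {upair a a, upair a b}" if "a \<in> elts U" "b \<in> elts U" for a b
    unfolding opair_def using upair that by blast
  ultimately have "{upair x x, upair x y} = {upair x' x', upair x' y'}" using assms by metis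
  then have "elts ` {upair x x, upair x y} = elts ` {upair x' x', upair x' y'}" by simp
  then have "{{x}, {x, y}} = {{x'}, {x', y'}}" using upair assms by simp
  then show "x = x' \<and> y = y'" by (auto simp: doubleton_eq_iff)
qed simp

text \<open>The disjoint union inside the universe. With \<open>B i\<close> the objects of a family
  of \<open>V\<close>-categories it supplies the objects of their coproduct; with \<open>B\<close>
  constant it bounds cartesian products.\<close>

lemma Sigma_member:
  assumes "x \<in> elts U" "\<And>i. i \<in> elts x \<Longrightarrow> \<exists>y\<in>elts U. elts y = B i"
  shows "\<exists>s\<in>elts U. elts s = (\<Union>i\<in>elts x. opair i ` B i)"
proof (rule UN_member[OF assms(1)])
  fix i assume i: "i \<in> elts x"
  obtain y where y: "y \<in> elts U" "elts y = B i" using assms(2)[OF i] by blast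
  show "\<exists>s\<in>elts U. elts s = opair i ` B i"
    using image_member[OF y(1), of "opair i"] y transitive opair_member assms(1) i by metis
qed

text \<open>Size for sets of any type. An injection is easier to exhibit than a bijection, and
  closure of the universe under subsets turns one into the other.\<close>

definition small :: "'x set \<Rightarrow> bool" where
  "small X \<longleftrightarrow> (\<exists>u\<in>elts U. X \<lesssim> elts u)"

lemma small_eqpoll: "small X \<Longrightarrow> \<exists>u\<in>elts U. X \<approx> elts u"
proof -
  assume "small X"
  then obtain u f where u: "u \<in> elts U" and f: "inj_on f X" "f ` X \<subseteq> elts u"
    unfolding small_def lepoll_def by blast
  obtain v where "v \<in> elts U" "elts v = f ` X" using subset_member[OF u f(2)] by blast
  then show ?thesis using inj_on_image_eqpoll_self[OF f(1)] eqpoll_sym by metis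
qed

lemma small_lepoll: "small Y \<Longrightarrow> X \<lesssim> Y \<Longrightarrow> small X"
  unfolding small_def using lepoll_trans by blast

text \<open>The members of \<open>p\<close> name the subsets of \<open>u\<close>, each exactly once
  because \<open>elts\<close> is injective; so \<open>p\<close> has the size of the
  powerset.\<close>

lemma small_Pow: "small X \<Longrightarrow> small (Pow X)"
proof -
  assume "small X"
  then obtain u where u: "u \<in> elts U" "X \<lesssim> elts u" unfolding small_def by blast
  obtain p where p: "p \<in> elts U" "elts ` elts p = Pow (elts u)"
    using powersets u(1) by blast
  have "Pow (elts u) \<approx> elts p"
    using inj_on_image_eqpoll_self[of elts "elts p"] inj_elts p(2) by (metis inj_on_subset subset_UNIV)
  moreover have "Pow X \<lesssim> Pow (elts u)"
  proof -
    obtain f where "inj_on f X" "f ` X \<subseteq> elts u" using u(2) unfolding lepoll_def by blast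
    then have "inj_on (image f) (Pow X)" "image f ` Pow X \<subseteq> Pow (elts u)"
      by (auto intro: inj_on_image_Pow)
    then show ?thesis unfolding lepoll_def by blast
  qed
  ultimately show ?thesis using p(1) unfolding small_def by (meson lepoll_trans eqpoll_imp_lepoll)
qed

lemma small_Times: "small X \<Longrightarrow> small Y \<Longrightarrow> small (X \<times> Y)"
proof -
  assume "small X" "small Y"
  then obtain u v where u: "u \<in> elts U" "X \<lesssim> elts u" and v: "v \<in> elts U" "Y \<lesssim> elts v"
    unfolding small_def by blast
  obtain s where s: "s \<in> elts U" "elts s = (\<Union>i\<in>elts u. opair i ` elts v)"
    using Sigma_member[OF u(1), of "\<lambda>_. elts v"] v(1) by blast
  have "inj_on (\<lambda>(i, j). opair i j) (elts u \<times> elts v)"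
    using opair_inject transitive[OF u(1)] transitive[OF v(1)] by (auto simp: inj_on_def)
  moreover have "(\<lambda>(i, j). opair i j) ` (elts u \<times> elts v) \<subseteq> elts s" unfolding s(2) by auto
  ultimately have "elts u \<times> elts v \<lesssim> elts s" unfolding lepoll_def by blast
  then show ?thesis using s(1) times_lepoll_mono[OF u(2) v(2)] lepoll_trans unfolding small_def by blast
qed

end

text \<open>Makes the size encodings below injective: they record a component of a
  \<open>V\<close>-category or \<open>V\<close>-functor by its graph over the objects, and
  extensionality recovers the rest.\<close>

lemma graph_inject:
  assumes "f \<in> extensional D" "g \<in> extensional D" "(\<lambda>x. (x, f x)) ` D = (\<lambda>x. (x, g x)) ` D"
  shows "f = g"
  by (rule extensionalityI[OF assms(1,2)]) (use assms(3) in auto)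

section \<open>Components of enriched categories and functors, and the size of their
  category\<close>

lemma
  assumes "is_vcat V M A"
  shows vcat_Hom: "\<And>x y. x \<in> VObj A \<Longrightarrow> y \<in> VObj A \<Longrightarrow> VHom A (x, y) \<in> Obj V"
    and vcat_Comp: "\<And>x y z. x \<in> VObj A \<Longrightarrow> y \<in> VObj A \<Longrightarrow> z \<in> VObj A \<Longrightarrow>
      VComp A (x, y, z) \<in> Hom V (Prod M (VHom A (y, z)) (VHom A (x, y))) (VHom A (x, z))"
    and vcat_Ident: "\<And>x. x \<in> VObj A \<Longrightarrow> VIdent A x \<in> Hom V (Unit M) (VHom A (x, x))"
    and vcat_Hom_ext: "VHom A \<in> extensional (VObj A \<times> VObj A)"
    and vcat_Comp_ext: "VComp A \<in> extensional (VObj A \<times> VObj A \<times> VObj A)"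
    and vcat_Ident_ext: "VIdent A \<in> extensional (VObj A)"
proof -
  have H: "VHom A \<in> VObj A \<times> VObj A \<rightarrow>\<^sub>E Obj V"
    and C: "VComp A \<in> (\<Pi>\<^sub>E (x, y, z)\<in>VObj A \<times> VObj A \<times> VObj A.
                  Hom V (Prod M (VHom A (y, z)) (VHom A (x, y))) (VHom A (x, z)))"
    and I: "VIdent A \<in> (\<Pi>\<^sub>E x\<in>VObj A. Hom V (Unit M) (VHom A (x, x)))"
    using assms[unfolded is_vcat_def] by - (elim conjE, assumption)+
  show "VHom A \<in> extensional (VObj A \<times> VObj A)"
    "VComp A \<in> extensional (VObj A \<times> VObj A \<times> VObj A)" "VIdent A \<in> extensional (VObj A)"
    using H C I by (simp_all only: PiE_def) simp_all
  show "VHom A (x, y) \<in> Obj V" if "x \<in> VObj A" "y \<in> VObj A" for x y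
    using PiE_mem[OF H, of "(x, y)"] that by simp
  show "VComp A (x, y, z) \<in> Hom V (Prod M (VHom A (y, z)) (VHom A (x, y))) (VHom A (x, z))"
    if "x \<in> VObj A" "y \<in> VObj A" "z \<in> VObj A" for x y z
    using PiE_mem[OF C, of "(x, y, z)"] that by simp
  show "VIdent A x \<in> Hom V (Unit M) (VHom A (x, x))" if "x \<in> VObj A" for x
    using PiE_mem[OF I that] .
qed

lemma
  assumes "is_vfunctor V M F"
  shows vfunctor_Obj: "\<And>x. x \<in> VObj (VSrc F) \<Longrightarrow> VFObj F x \<in> VObj (VTgt F)"
    and vfunctor_Hom: "\<And>x y. x \<in> VObj (VSrc F) \<Longrightarrow> y \<in> VObj (VSrc F) \<Longrightarrow>
      VFHom F (x, y) \<in> Hom V (VHom (VSrc F) (x, y)) (VHom (VTgt F) (VFObj F x, VFObj F y))"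
    and vfunctor_Obj_ext: "VFObj F \<in> extensional (VObj (VSrc F))"
    and vfunctor_Hom_ext: "VFHom F \<in> extensional (VObj (VSrc F) \<times> VObj (VSrc F))"
    and vfunctor_Comp: "\<And>x y z. x \<in> VObj (VSrc F) \<Longrightarrow> y \<in> VObj (VSrc F) \<Longrightarrow> z \<in> VObj (VSrc F) \<Longrightarrow>
      Comp V (VFHom F (x, z)) (VComp (VSrc F) (x, y, z)) =
      Comp V (VComp (VTgt F) (VFObj F x, VFObj F y, VFObj F z))
        (prod_arrow V M (VFHom F (y, z)) (VFHom F (x, y)))"
    and vfunctor_Ident: "\<And>x. x \<in> VObj (VSrc F) \<Longrightarrow>
      Comp V (VFHom F (x, x)) (VIdent (VSrc F) x) = VIdent (VTgt F) (VFObj F x)"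
proof -
  have T: "VFObj F \<in> VObj (VSrc F) \<rightarrow>\<^sub>E VObj (VTgt F)"
    and H: "VFHom F \<in> (\<Pi>\<^sub>E (x, y)\<in>VObj (VSrc F) \<times> VObj (VSrc F).
        Hom V (VHom (VSrc F) (x, y)) (VHom (VTgt F) (VFObj F x, VFObj F y)))"
    and C: "\<forall>x\<in>VObj (VSrc F). \<forall>y\<in>VObj (VSrc F). \<forall>z\<in>VObj (VSrc F).
      Comp V (VFHom F (x, z)) (VComp (VSrc F) (x, y, z)) =
      Comp V (VComp (VTgt F) (VFObj F x, VFObj F y, VFObj F z))
        (prod_arrow V M (VFHom F (y, z)) (VFHom F (x, y)))"
    and I: "\<forall>x\<in>VObj (VSrc F). Comp V (VFHom F (x, x)) (VIdent (VSrc F) x) = VIdent (VTgt F) (VFObj F x)"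
    using assms[unfolded is_vfunctor_def Let_def] by - (elim conjE, assumption)+
  show "VFObj F \<in> extensional (VObj (VSrc F))"
    "VFHom F \<in> extensional (VObj (VSrc F) \<times> VObj (VSrc F))"
    using T H by (simp_all only: PiE_def) simp_all
  show "VFObj F x \<in> VObj (VTgt F)" if "x \<in> VObj (VSrc F)" for x using PiE_mem[OF T that] .
  show "VFHom F (x, y) \<in> Hom V (VHom (VSrc F) (x, y)) (VHom (VTgt F) (VFObj F x, VFObj F y))"
    if "x \<in> VObj (VSrc F)" "y \<in> VObj (VSrc F)" for x y
    using PiE_mem[OF H, of "(x, y)"] that by simp
  show "Comp V (VFHom F (x, z)) (VComp (VSrc F) (x, y, z)) =
      Comp V (VComp (VTgt F) (VFObj F x, VFObj F y, VFObj F z))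
        (prod_arrow V M (VFHom F (y, z)) (VFHom F (x, y)))"
    if "x \<in> VObj (VSrc F)" "y \<in> VObj (VSrc F)" "z \<in> VObj (VSrc F)" for x y z
    using C that by (elim ballE) blast+
  show "Comp V (VFHom F (x, x)) (VIdent (VSrc F) x) = VIdent (VTgt F) (VFObj F x)"
    if "x \<in> VObj (VSrc F)" for x using I that by (elim ballE) blast+
qed

text \<open>A small \<open>V\<close>-category is encoded by its set of objects and the graphs of its
  three structure maps, hence by subsets of products of \<open>elts U1\<close>, \<open>Obj V\<close>
  and \<open>Arr V\<close>. A universe is closed under products and powersets up to bijection, so
  \<open>U2\<close> bounds all the codes; functors are handled likewise.\<close>

lemma VCat_large:
  assumes u: "universes elts U1 U2" and V: "large_category elts U2 V"
    and cat: "is_category (VCat elts U1 V M)"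
  shows "large_category elts U2 (VCat elts U1 V M)"
proof -
  interpret U1: universe elts U1 using u by unfold_locales (auto simp: universes_def)
  interpret U2: universe elts U2 using u by unfold_locales (auto simp: universes_def)
  let ?S = "elts U1"
  \<comment> \<open>Here \<open>U1\<close> has to be a member of \<open>U2\<close>: all objects of
    all small \<open>V\<close>-categories lie in this one set.\<close>
  have S: "U2.small ?S" using u unfolding U2.small_def universes_def by (metis lepoll_refl)
  have O: "U2.small (Obj V)" and A: "U2.small (Arr V)"
    using V unfolding U2.small_def large_category_def by (meson eqpoll_imp_lepoll)+
  note small = U2.small_Times U2.small_Pow S O A
  let ?C = "Collect (is_small_vcat elts U1 V M)"
  define enc where "enc B = (VObj B, (\<lambda>p. (p, VHom B p)) ` (VObj B \<times> VObj B),
      (\<lambda>p. (p, VComp B p)) ` (VObj B \<times> VObj B \<times> VObj B), (\<lambda>x. (x, VIdent B x)) ` VObj B)"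
    for B :: "('a, 'b, 'c) vcat"
  have obj: "VObj B \<subseteq> ?S" if "B \<in> ?C" for B
    using that U1.transitive unfolding is_small_vcat_def by blast
  have C: "is_vcat V M B" if "B \<in> ?C" for B using that unfolding is_small_vcat_def by blast
  have Csmall: "U2.small ?C"
  proof (rule U2.small_lepoll)
    show "U2.small (Pow ?S \<times> Pow ((?S \<times> ?S) \<times> Obj V) \<times> Pow ((?S \<times> ?S \<times> ?S) \<times> Arr V) \<times> Pow (?S \<times> Arr V))"
      by (intro small)
    have "inj_on enc ?C"
    proof (rule inj_onI)
      fix B B' assume as: "B \<in> ?C" "B' \<in> ?C" "enc B = enc B'"
      have e: "VObj B = VObj B'" using as(3) by (simp add: enc_def)
      have "VHom B = VHom B'" "VComp B = VComp B'" "VIdent B = VIdent B'"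
        using graph_inject[OF vcat_Hom_ext[OF C[OF as(1)]], of "VHom B'"]
          graph_inject[OF vcat_Comp_ext[OF C[OF as(1)]], of "VComp B'"]
          graph_inject[OF vcat_Ident_ext[OF C[OF as(1)]], of "VIdent B'"]
          vcat_Hom_ext[OF C[OF as(2)]] vcat_Comp_ext[OF C[OF as(2)]] vcat_Ident_ext[OF C[OF as(2)]]
          as(3) unfolding enc_def e by simp_all
      then show "B = B'" using e by (simp add: vcat.equality)
    qed
    moreover have "enc B \<in> Pow ?S \<times> Pow ((?S \<times> ?S) \<times> Obj V) \<times> Pow ((?S \<times> ?S \<times> ?S) \<times> Arr V) \<times> Pow (?S \<times> Arr V)"
      if B: "B \<in> ?C" for B
    proof -
      have "VHom B p \<in> Obj V" if "p \<in> VObj B \<times> VObj B" for p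
        using that vcat_Hom[OF C[OF B]] by auto
      moreover have "VComp B p \<in> Arr V" if "p \<in> VObj B \<times> VObj B \<times> VObj B" for p
        using that HomD[OF vcat_Comp[OF C[OF B]]] by auto
      moreover have "VIdent B x \<in> Arr V" if "x \<in> VObj B" for x
        using HomD[OF vcat_Ident[OF C[OF B] that]] by simp
      ultimately show ?thesis using obj[OF B] unfolding enc_def by auto
    qed
    ultimately show "?C \<lesssim> Pow ?S \<times> Pow ((?S \<times> ?S) \<times> Obj V) \<times> Pow ((?S \<times> ?S \<times> ?S) \<times> Arr V) \<times> Pow (?S \<times> Arr V)"
      unfolding lepoll_def by blast
  qed
  let ?A = "Arr (VCat elts U1 V M)"
  \<comment> \<open>Source and target are kept as whole records, which is harmless because the set
    of small \<open>V\<close>-categories has just been bounded.\<close>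
  define enc' where "enc' F = (VSrc F, VTgt F, (\<lambda>x. (x, VFObj F x)) ` VObj (VSrc F),
      (\<lambda>p. (p, VFHom F p)) ` (VObj (VSrc F) \<times> VObj (VSrc F)))" for F :: "('a, 'b, 'c) vfunctor"
  have A: "is_vfunctor V M F" "VSrc F \<in> ?C" "VTgt F \<in> ?C" if "F \<in> ?A" for F
    using that by (auto simp: VCat_def)
  have Asmall: "U2.small ?A"
  proof (rule U2.small_lepoll)
    show "U2.small (?C \<times> ?C \<times> Pow (?S \<times> ?S) \<times> Pow ((?S \<times> ?S) \<times> Arr V))"
      by (intro small Csmall)
    have "inj_on enc' ?A"
    proof (rule inj_onI)
      fix F F' assume as: "F \<in> ?A" "F' \<in> ?A" "enc' F = enc' F'"
      have e: "VSrc F = VSrc F'" "VTgt F = VTgt F'" using as(3) by (simp_all add: enc'_def)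
      have "VFObj F = VFObj F'" "VFHom F = VFHom F'"
        using graph_inject[OF vfunctor_Obj_ext[OF A(1)[OF as(1)]], of "VFObj F'"]
          graph_inject[OF vfunctor_Hom_ext[OF A(1)[OF as(1)]], of "VFHom F'"]
          vfunctor_Obj_ext[OF A(1)[OF as(2)]] vfunctor_Hom_ext[OF A(1)[OF as(2)]]
          as(3) unfolding enc'_def e by simp_all
      then show "F = F'" using e by (simp add: vfunctor.equality)
    qed
    moreover have "enc' F \<in> ?C \<times> ?C \<times> Pow (?S \<times> ?S) \<times> Pow ((?S \<times> ?S) \<times> Arr V)" if F: "F \<in> ?A" for F
    proof -
      have "VFObj F x \<in> ?S" if "x \<in> VObj (VSrc F)" for x
        using vfunctor_Obj[OF A(1)[OF F] that] obj[OF A(3)[OF F]] by blast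
      moreover have "VFHom F p \<in> Arr V" if "p \<in> VObj (VSrc F) \<times> VObj (VSrc F)" for p
        using that HomD[OF vfunctor_Hom[OF A(1)[OF F]]] by auto
      ultimately show ?thesis using obj[OF A(2)[OF F]] A(2,3)[OF F] unfolding enc'_def by auto
    qed
    ultimately show "?A \<lesssim> ?C \<times> ?C \<times> Pow (?S \<times> ?S) \<times> Pow ((?S \<times> ?S) \<times> Arr V)"
      unfolding lepoll_def by blast
  qed
  have "Obj (VCat elts U1 V M) = ?C" by (simp add: VCat_def)
  then show ?thesis
    using cat U2.small_eqpoll[OF Csmall] U2.small_eqpoll[OF Asmall] by (simp add: large_category_def)
qed

section \<open>Cartesian categories and enriched categories\<close>

locale cartesian_category = cat V for V :: "('o, 'a) category" +
  fixes M :: "('o, 'a) cartesian"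
  assumes cartesian: "is_cartesian_structure V M"
begin

abbreviation vcomp (infixr "\<cdot>" 70) where "g \<cdot> f \<equiv> Comp V g f"
abbreviation prod_obj (infixr "\<boxtimes>" 75) where "x \<boxtimes> y \<equiv> Prod M x y"
abbreviation tensor (infixr "\<otimes>" 75) where "f \<otimes> g \<equiv> prod_arrow V M f g"

lemma Unit_Obj: "Unit M \<in> Obj V"
  using cartesian by (simp add: is_cartesian_structure_def is_terminal_def)

lemma product:
  assumes "x \<in> Obj V" "y \<in> Obj V"
  shows Prod_Obj: "x \<boxtimes> y \<in> Obj V"
    and Fst_hom: "Fst M x y \<in> Hom V (x \<boxtimes> y) x"
    and Snd_hom: "Snd M x y \<in> Hom V (x \<boxtimes> y) y"
    and pair_ex1: "\<And>t f g. \<lbrakk>f \<in> Hom V t x; g \<in> Hom V t y\<rbrakk>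
      \<Longrightarrow> \<exists>!h. h \<in> Hom V t (x \<boxtimes> y) \<and> Fst M x y \<cdot> h = f \<and> Snd M x y \<cdot> h = g"
proof -
  have b: "is_binary_product V x y (x \<boxtimes> y) (Fst M x y) (Snd M x y)"
    using cartesian assms by (simp add: is_cartesian_structure_def)
  show "x \<boxtimes> y \<in> Obj V" "Fst M x y \<in> Hom V (x \<boxtimes> y) x" "Snd M x y \<in> Hom V (x \<boxtimes> y) y"
    using b unfolding is_binary_product_def by simp_all
  show "\<exists>!h. h \<in> Hom V t (x \<boxtimes> y) \<and> Fst M x y \<cdot> h = f \<and> Snd M x y \<cdot> h = g"
    if "f \<in> Hom V t x" "g \<in> Hom V t y" for t f g
    using b that Hom_Obj(1)[OF that(1)] unfolding is_binary_product_def by simp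
qed

lemma pair_arrow:
  assumes "f \<in> Hom V t x" "g \<in> Hom V t y"
  shows pair_hom: "pair_arrow V M f g \<in> Hom V t (x \<boxtimes> y)"
    and Fst_pair: "Fst M x y \<cdot> pair_arrow V M f g = f"
    and Snd_pair: "Snd M x y \<cdot> pair_arrow V M f g = g"
proof -
  have "pair_arrow V M f g =
      (THE h. h \<in> Hom V t (x \<boxtimes> y) \<and> Fst M x y \<cdot> h = f \<and> Snd M x y \<cdot> h = g)"
    unfolding pair_arrow_def using HomD[OF assms(1)] HomD[OF assms(2)] by simp
  then show "pair_arrow V M f g \<in> Hom V t (x \<boxtimes> y)" "Fst M x y \<cdot> pair_arrow V M f g = f"
    "Snd M x y \<cdot> pair_arrow V M f g = g"
    using theI'[OF pair_ex1[OF Hom_Obj(2)[OF assms(1)] Hom_Obj(2)[OF assms(2)] assms]] by simp_all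
qed

lemma product_eqI:
  assumes "x \<in> Obj V" "y \<in> Obj V" "h \<in> Hom V t (x \<boxtimes> y)" "k \<in> Hom V t (x \<boxtimes> y)"
    and "Fst M x y \<cdot> h = Fst M x y \<cdot> k" "Snd M x y \<cdot> h = Snd M x y \<cdot> k"
  shows "h = k"
  using pair_ex1[OF assms(1,2) comp_hom[OF Fst_hom[OF assms(1,2)] assms(4)]
      comp_hom[OF Snd_hom[OF assms(1,2)] assms(4)]] assms(3-6) by blast

lemma tensor:
  assumes f: "f \<in> Hom V a b" and g: "g \<in> Hom V c d"
  shows tensor_hom: "f \<otimes> g \<in> Hom V (a \<boxtimes> c) (b \<boxtimes> d)"
    and Fst_tensor: "Fst M b d \<cdot> (f \<otimes> g) = f \<cdot> Fst M a c"
    and Snd_tensor: "Snd M b d \<cdot> (f \<otimes> g) = g \<cdot> Snd M a c"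
proof -
  note o = Hom_Obj(1)[OF f] Hom_Obj(1)[OF g]
  have "f \<otimes> g = pair_arrow V M (f \<cdot> Fst M a c) (g \<cdot> Snd M a c)"
    unfolding prod_arrow_def using HomD[OF f] HomD[OF g] by simp
  then show "f \<otimes> g \<in> Hom V (a \<boxtimes> c) (b \<boxtimes> d)" "Fst M b d \<cdot> (f \<otimes> g) = f \<cdot> Fst M a c"
    "Snd M b d \<cdot> (f \<otimes> g) = g \<cdot> Snd M a c"
    using pair_arrow[OF comp_hom[OF f Fst_hom[OF o]] comp_hom[OF g Snd_hom[OF o]]] by simp_all
qed

text \<open>The interchange law, checked on both projections. It is what allows preservation of
  composition to be pasted and cancelled later.\<close>

lemma tensor_comp:
  assumes f: "f \<in> Hom V a b" and f': "f' \<in> Hom V b c" and g: "g \<in> Hom V x y" and g': "g' \<in> Hom V y z"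
  shows "(f' \<otimes> g') \<cdot> (f \<otimes> g) = (f' \<cdot> f) \<otimes> (g' \<cdot> g)"
proof (rule product_eqI)
  note t = tensor_hom[OF f g] and t' = tensor_hom[OF f' g']
  note ff = comp_hom[OF f' f] and gg = comp_hom[OF g' g]
  note cz = Hom_Obj(2)[OF f'] Hom_Obj(2)[OF g'] and byo = Hom_Obj(2)[OF f] Hom_Obj(2)[OF g]
    and ax = Hom_Obj(1)[OF f] Hom_Obj(1)[OF g]
  show "c \<in> Obj V" "z \<in> Obj V" by (rule cz)+
  show "(f' \<otimes> g') \<cdot> (f \<otimes> g) \<in> Hom V (a \<boxtimes> x) (c \<boxtimes> z)" by (rule comp_hom[OF t' t])
  show "(f' \<cdot> f) \<otimes> (g' \<cdot> g) \<in> Hom V (a \<boxtimes> x) (c \<boxtimes> z)" by (rule tensor_hom[OF ff gg])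
  show "Fst M c z \<cdot> (f' \<otimes> g') \<cdot> (f \<otimes> g) = Fst M c z \<cdot> ((f' \<cdot> f) \<otimes> (g' \<cdot> g))"
    using comp_assoc[OF Fst_hom[OF cz] t' t] comp_assoc[OF f' Fst_hom[OF byo] t]
      comp_assoc[OF f' f Fst_hom[OF ax]] Fst_tensor[OF ff gg] Fst_tensor[OF f' g']
      Fst_tensor[OF f g] by simp
  show "Snd M c z \<cdot> (f' \<otimes> g') \<cdot> (f \<otimes> g) = Snd M c z \<cdot> ((f' \<cdot> f) \<otimes> (g' \<cdot> g))"
    using comp_assoc[OF Snd_hom[OF cz] t' t] comp_assoc[OF g' Snd_hom[OF byo] t]
      comp_assoc[OF g' g Snd_hom[OF ax]] Snd_tensor[OF ff gg] Snd_tensor[OF f' g']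
      Snd_tensor[OF f g] by simp
qed

lemma tensor_ident:
  assumes "x \<in> Obj V" "y \<in> Obj V"
  shows "Ident V x \<otimes> Ident V y = Ident V (x \<boxtimes> y)"
proof (rule product_eqI[OF assms])
  note i = ident_hom[OF assms(1)] ident_hom[OF assms(2)]
  show "Ident V x \<otimes> Ident V y \<in> Hom V (x \<boxtimes> y) (x \<boxtimes> y)" by (rule tensor_hom[OF i])
  show "Ident V (x \<boxtimes> y) \<in> Hom V (x \<boxtimes> y) (x \<boxtimes> y)" by (rule ident_hom[OF Prod_Obj[OF assms]])
  show "Fst M x y \<cdot> (Ident V x \<otimes> Ident V y) = Fst M x y \<cdot> Ident V (x \<boxtimes> y)"
    using Fst_tensor[OF i] comp_ident_left[OF Fst_hom[OF assms]] comp_ident_right[OF Fst_hom[OF assms]]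
    by simp
  show "Snd M x y \<cdot> (Ident V x \<otimes> Ident V y) = Snd M x y \<cdot> Ident V (x \<boxtimes> y)"
    using Snd_tensor[OF i] comp_ident_left[OF Snd_hom[OF assms]] comp_ident_right[OF Snd_hom[OF assms]]
    by simp
qed

text \<open>Needed because composition has a product as its source: a law can be tested after
  precomposing with two hom-isomorphisms at once.\<close>

lemma tensor_iso:
  assumes f: "f \<in> Hom V a b" "is_iso V f" and g: "g \<in> Hom V c d" "is_iso V g"
  shows "is_iso V (f \<otimes> g)"
proof -
  obtain f' where f': "f' \<in> Hom V b a" "f' \<cdot> f = Ident V a" "f \<cdot> f' = Ident V b"
    using is_isoE f by metis
  obtain g' where g': "g' \<in> Hom V d c" "g' \<cdot> g = Ident V c" "g \<cdot> g' = Ident V d"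
    using is_isoE g by metis
  show ?thesis
    by (rule is_isoI[OF tensor_hom[OF f(1) g(1)] tensor_hom[OF f'(1) g'(1)]])
      (simp_all add: tensor_comp[OF f(1) f'(1) g(1) g'(1)] tensor_comp[OF f'(1) f(1) g'(1) g(1)]
        f' g' tensor_ident Hom_Obj[OF f(1)] Hom_Obj[OF g(1)])
qed

lemma assoc_hom:
  assumes o: "x \<in> Obj V" "y \<in> Obj V" "w \<in> Obj V"
  shows "assoc_arrow V M x y w \<in> Hom V ((x \<boxtimes> y) \<boxtimes> w) (x \<boxtimes> y \<boxtimes> w)"
proof -
  note xy = Prod_Obj[OF o(1,2)]
  note p = Fst_hom[OF xy o(3)] and q = Snd_hom[OF xy o(3)]
  show ?thesis unfolding assoc_arrow_def Let_def
    by (rule pair_hom[OF comp_hom[OF Fst_hom[OF o(1,2)] p]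
          pair_hom[OF comp_hom[OF Snd_hom[OF o(1,2)] p] q]])
qed

text \<open>Only the types of the two sides of associativity matter here. When their common source
  is initial, the law follows without any computation with the associator.\<close>

lemma assoc_sides_hom:
  assumes "c1 \<in> Hom V (d \<boxtimes> c) e" "c2 \<in> Hom V (a \<boxtimes> b) d" "c3 \<in> Hom V (a \<boxtimes> d') e"
    "c4 \<in> Hom V (b \<boxtimes> c) d'" "a \<in> Obj V" "b \<in> Obj V" "c \<in> Obj V"
  shows "c1 \<cdot> (c2 \<otimes> Ident V c) \<in> Hom V ((a \<boxtimes> b) \<boxtimes> c) e"
    and "(c3 \<cdot> (Ident V a \<otimes> c4)) \<cdot> assoc_arrow V M a b c \<in> Hom V ((a \<boxtimes> b) \<boxtimes> c) e"
   apply (rule comp_hom[OF assms(1) tensor_hom[OF assms(2) ident_hom[OF assms(7)]]])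
  apply (rule comp_hom[OF comp_hom[OF assms(3) tensor_hom[OF ident_hom[OF assms(5)] assms(4)]]
        assoc_hom[OF assms(5-7)]])
  done

lemma vcatI:
  assumes H: "\<And>x y. x \<in> VObj A \<Longrightarrow> y \<in> VObj A \<Longrightarrow> VHom A (x, y) \<in> Obj V"
    and C: "\<And>x y z. x \<in> VObj A \<Longrightarrow> y \<in> VObj A \<Longrightarrow> z \<in> VObj A \<Longrightarrow>
      VComp A (x, y, z) \<in> Hom V (VHom A (y, z) \<boxtimes> VHom A (x, y)) (VHom A (x, z))"
    and I: "\<And>x. x \<in> VObj A \<Longrightarrow> VIdent A x \<in> Hom V (Unit M) (VHom A (x, x))"
    and ext: "VHom A \<in> extensional (VObj A \<times> VObj A)"
      "VComp A \<in> extensional (VObj A \<times> VObj A \<times> VObj A)" "VIdent A \<in> extensional (VObj A)"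
    and assoc: "\<And>w x y z. w \<in> VObj A \<Longrightarrow> x \<in> VObj A \<Longrightarrow> y \<in> VObj A \<Longrightarrow> z \<in> VObj A \<Longrightarrow>
      VComp A (w, x, z) \<cdot> (VComp A (x, y, z) \<otimes> Ident V (VHom A (w, x))) =
      (VComp A (w, y, z) \<cdot> (Ident V (VHom A (y, z)) \<otimes> VComp A (w, x, y))) \<cdot>
        assoc_arrow V M (VHom A (y, z)) (VHom A (x, y)) (VHom A (w, x))"
    and left: "\<And>x y. x \<in> VObj A \<Longrightarrow> y \<in> VObj A \<Longrightarrow>
      VComp A (x, y, y) \<cdot> (VIdent A y \<otimes> Ident V (VHom A (x, y))) = Snd M (Unit M) (VHom A (x, y))"
    and right: "\<And>x y. x \<in> VObj A \<Longrightarrow> y \<in> VObj A \<Longrightarrow>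
      VComp A (x, x, y) \<cdot> (Ident V (VHom A (x, y)) \<otimes> VIdent A x) = Fst M (VHom A (x, y)) (Unit M)"
  shows "is_vcat V M A"
  unfolding is_vcat_def
proof (intro conjI ballI)
  show "VHom A \<in> VObj A \<times> VObj A \<rightarrow>\<^sub>E Obj V"
    using H ext(1) by (auto simp: PiE_iff)
  show "VComp A \<in> (\<Pi>\<^sub>E (x, y, z)\<in>VObj A \<times> VObj A \<times> VObj A.
      Hom V (VHom A (y, z) \<boxtimes> VHom A (x, y)) (VHom A (x, z)))"
    using C ext(2) by (auto simp: PiE_iff)
  show "VIdent A \<in> (\<Pi>\<^sub>E x\<in>VObj A. Hom V (Unit M) (VHom A (x, x)))"
    using I ext(3) by (auto simp: PiE_iff)
qed (intro assoc left right; assumption)+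

lemma
  assumes "is_vcat V M A"
  shows vcat_assoc: "\<And>w x y z. w \<in> VObj A \<Longrightarrow> x \<in> VObj A \<Longrightarrow> y \<in> VObj A \<Longrightarrow> z \<in> VObj A \<Longrightarrow>
      VComp A (w, x, z) \<cdot> (VComp A (x, y, z) \<otimes> Ident V (VHom A (w, x))) =
      (VComp A (w, y, z) \<cdot> (Ident V (VHom A (y, z)) \<otimes> VComp A (w, x, y))) \<cdot>
        assoc_arrow V M (VHom A (y, z)) (VHom A (x, y)) (VHom A (w, x))"
    and vcat_unit_left: "\<And>x y. x \<in> VObj A \<Longrightarrow> y \<in> VObj A \<Longrightarrow>
      VComp A (x, y, y) \<cdot> (VIdent A y \<otimes> Ident V (VHom A (x, y))) = Snd M (Unit M) (VHom A (x, y))"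
    and vcat_unit_right: "\<And>x y. x \<in> VObj A \<Longrightarrow> y \<in> VObj A \<Longrightarrow>
      VComp A (x, x, y) \<cdot> (Ident V (VHom A (x, y)) \<otimes> VIdent A x) = Fst M (VHom A (x, y)) (Unit M)"
proof -
  have a: "\<forall>w\<in>VObj A. \<forall>x\<in>VObj A. \<forall>y\<in>VObj A. \<forall>z\<in>VObj A.
      VComp A (w, x, z) \<cdot> (VComp A (x, y, z) \<otimes> Ident V (VHom A (w, x))) =
      (VComp A (w, y, z) \<cdot> (Ident V (VHom A (y, z)) \<otimes> VComp A (w, x, y))) \<cdot>
        assoc_arrow V M (VHom A (y, z)) (VHom A (x, y)) (VHom A (w, x))"
    and u: "\<forall>x\<in>VObj A. \<forall>y\<in>VObj A.
      VComp A (x, y, y) \<cdot> (VIdent A y \<otimes> Ident V (VHom A (x, y))) = Snd M (Unit M) (VHom A (x, y)) \<and>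
      VComp A (x, x, y) \<cdot> (Ident V (VHom A (x, y)) \<otimes> VIdent A x) = Fst M (VHom A (x, y)) (Unit M)"
    using assms[unfolded is_vcat_def] by - (elim conjE, assumption)+
  show "VComp A (w, x, z) \<cdot> (VComp A (x, y, z) \<otimes> Ident V (VHom A (w, x))) =
      (VComp A (w, y, z) \<cdot> (Ident V (VHom A (y, z)) \<otimes> VComp A (w, x, y))) \<cdot>
        assoc_arrow V M (VHom A (y, z)) (VHom A (x, y)) (VHom A (w, x))"
    if "w \<in> VObj A" "x \<in> VObj A" "y \<in> VObj A" "z \<in> VObj A" for w x y z
    using bspec[OF bspec[OF bspec[OF bspec[OF a that(1)] that(2)] that(3)] that(4)] .
  show "VComp A (x, y, y) \<cdot> (VIdent A y \<otimes> Ident V (VHom A (x, y))) = Snd M (Unit M) (VHom A (x, y))"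
    "VComp A (x, x, y) \<cdot> (Ident V (VHom A (x, y)) \<otimes> VIdent A x) = Fst M (VHom A (x, y)) (Unit M)"
    if "x \<in> VObj A" "y \<in> VObj A" for x y
    using bspec[OF bspec[OF u that(1)] that(2)] by simp_all
qed

end

section \<open>The category of small \<open>V\<close>-categories and
  \<open>V\<close>-functors\<close>

locale enriched = cartesian_category V M + universe elts U
  for V :: "('o, 'a) category" and M :: "('o, 'a) cartesian" and elts :: "'s \<Rightarrow> 's set" and U :: 's
begin

abbreviation \<V>Cat :: "(('s, 'o, 'a) vcat, ('s, 'o, 'a) vfunctor) category" where
  "\<V>Cat \<equiv> VCat elts U V M"

abbreviation fcomp (infixr "\<odot>" 70) where "G \<odot> F \<equiv> Comp \<V>Cat G F"

lemma \<V>Cat_Obj: "A \<in> Obj \<V>Cat \<longleftrightarrow> is_vcat V M A \<and> (\<exists>u\<in>elts U. VObj A = elts u)"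
  by (simp add: VCat_def is_small_vcat_def)

lemma Obj_vcat: "A \<in> Obj \<V>Cat \<Longrightarrow> is_vcat V M A"
  by (simp add: \<V>Cat_Obj)

lemma \<V>Cat_Hom: "F \<in> Hom \<V>Cat A B \<longleftrightarrow>
    is_vfunctor V M F \<and> VSrc F = A \<and> VTgt F = B \<and> A \<in> Obj \<V>Cat \<and> B \<in> Obj \<V>Cat"
  by (auto simp: Hom_def VCat_def)

lemma
  assumes F: "F \<in> Hom \<V>Cat A B"
  shows fun_src: "A \<in> Obj \<V>Cat" and fun_tgt: "B \<in> Obj \<V>Cat"
    and fun_Obj: "\<And>x. x \<in> VObj A \<Longrightarrow> VFObj F x \<in> VObj B"
    and fun_Hom: "\<And>x y. x \<in> VObj A \<Longrightarrow> y \<in> VObj A \<Longrightarrow>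
      VFHom F (x, y) \<in> Hom V (VHom A (x, y)) (VHom B (VFObj F x, VFObj F y))"
    and fun_Comp: "\<And>x y z. x \<in> VObj A \<Longrightarrow> y \<in> VObj A \<Longrightarrow> z \<in> VObj A \<Longrightarrow>
      VFHom F (x, z) \<cdot> VComp A (x, y, z) =
      VComp B (VFObj F x, VFObj F y, VFObj F z) \<cdot> (VFHom F (y, z) \<otimes> VFHom F (x, y))"
    and fun_Ident: "\<And>x. x \<in> VObj A \<Longrightarrow> VFHom F (x, x) \<cdot> VIdent A x = VIdent B (VFObj F x)"
proof -
  have f: "is_vfunctor V M F" and s: "VSrc F = A" "VTgt F = B" "A \<in> Obj \<V>Cat" "B \<in> Obj \<V>Cat"
    using F by (simp_all add: \<V>Cat_Hom)
  show "A \<in> Obj \<V>Cat" "B \<in> Obj \<V>Cat" by (rule s)+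
  show "VFObj F x \<in> VObj B" if "x \<in> VObj A" for x using vfunctor_Obj[OF f] s that by simp
  show "VFHom F (x, y) \<in> Hom V (VHom A (x, y)) (VHom B (VFObj F x, VFObj F y))"
    if "x \<in> VObj A" "y \<in> VObj A" for x y using vfunctor_Hom[OF f] s that by simp
  show "VFHom F (x, z) \<cdot> VComp A (x, y, z) =
      VComp B (VFObj F x, VFObj F y, VFObj F z) \<cdot> (VFHom F (y, z) \<otimes> VFHom F (x, y))"
    if "x \<in> VObj A" "y \<in> VObj A" "z \<in> VObj A" for x y z using vfunctor_Comp[OF f] s that by simp
  show "VFHom F (x, x) \<cdot> VIdent A x = VIdent B (VFObj F x)"
    if "x \<in> VObj A" for x using vfunctor_Ident[OF f] s that by simp
qed

lemma fun_eqI: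
  assumes F: "F \<in> Hom \<V>Cat A B" and G: "G \<in> Hom \<V>Cat A B"
    and O: "\<And>x. x \<in> VObj A \<Longrightarrow> VFObj F x = VFObj G x"
    and H: "\<And>x y. x \<in> VObj A \<Longrightarrow> y \<in> VObj A \<Longrightarrow> VFHom F (x, y) = VFHom G (x, y)"
  shows "F = G"
proof -
  have f: "is_vfunctor V M F" "VSrc F = A" "VTgt F = B" "is_vfunctor V M G" "VSrc G = A" "VTgt G = B"
    using F G by (simp_all add: \<V>Cat_Hom)
  have "VFObj F = VFObj G"
    using vfunctor_Obj_ext[OF f(1)] vfunctor_Obj_ext[OF f(4)] f O
    by (auto intro!: extensionalityI[of _ "VObj A"])
  moreover have "VFHom F = VFHom G"
    using vfunctor_Hom_ext[OF f(1)] vfunctor_Hom_ext[OF f(4)] f H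
    by (auto intro!: extensionalityI[of _ "VObj A \<times> VObj A"])
  ultimately show ?thesis using f by (simp add: vfunctor.equality)
qed

text \<open>The restrictions are built in, so a functor can be specified by its values on objects
  and pairs of objects alone.\<close>

definition mk_fun ::
    "('s, 'o, 'a) vcat \<Rightarrow> ('s, 'o, 'a) vcat \<Rightarrow> ('s \<Rightarrow> 's) \<Rightarrow> ('s \<Rightarrow> 's \<Rightarrow> 'a) \<Rightarrow> ('s, 'o, 'a) vfunctor" where
  "mk_fun A B T H = \<lparr>VSrc = A, VTgt = B, VFObj = restrict T (VObj A),
     VFHom = (\<lambda>(x, y)\<in>VObj A \<times> VObj A. H x y)\<rparr>"

lemma mk_fun_simps [simp]:
  "x \<in> VObj A \<Longrightarrow> VFObj (mk_fun A B T H) x = T x"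
  "x \<in> VObj A \<Longrightarrow> y \<in> VObj A \<Longrightarrow> VFHom (mk_fun A B T H) (x, y) = H x y"
  by (simp_all add: mk_fun_def)

lemma mk_fun_hom:
  assumes AB: "A \<in> Obj \<V>Cat" "B \<in> Obj \<V>Cat"
    and O: "\<And>x. x \<in> VObj A \<Longrightarrow> T x \<in> VObj B"
    and H: "\<And>x y. x \<in> VObj A \<Longrightarrow> y \<in> VObj A \<Longrightarrow> H x y \<in> Hom V (VHom A (x, y)) (VHom B (T x, T y))"
    and C: "\<And>x y z. x \<in> VObj A \<Longrightarrow> y \<in> VObj A \<Longrightarrow> z \<in> VObj A \<Longrightarrow>
      H x z \<cdot> VComp A (x, y, z) = VComp B (T x, T y, T z) \<cdot> (H y z \<otimes> H x y)"
    and I: "\<And>x. x \<in> VObj A \<Longrightarrow> H x x \<cdot> VIdent A x = VIdent B (T x)"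
  shows "mk_fun A B T H \<in> Hom \<V>Cat A B"
  unfolding \<V>Cat_Hom
proof (intro conjI)
  show "is_vfunctor V M (mk_fun A B T H)"
    unfolding is_vfunctor_def Let_def
  proof (intro conjI ballI)
    have s: "VSrc (mk_fun A B T H) = A" "VTgt (mk_fun A B T H) = B" by (simp_all add: mk_fun_def)
    show "is_vcat V M (VSrc (mk_fun A B T H))" "is_vcat V M (VTgt (mk_fun A B T H))"
      using AB s Obj_vcat by simp_all
    show "VFObj (mk_fun A B T H) \<in> VObj (VSrc (mk_fun A B T H)) \<rightarrow>\<^sub>E VObj (VTgt (mk_fun A B T H))"
      unfolding s using O by (simp add: mk_fun_def)
    show "VFHom (mk_fun A B T H) \<in> (\<Pi>\<^sub>E (x, y)\<in>VObj (VSrc (mk_fun A B T H)) \<times> VObj (VSrc (mk_fun A B T H)).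
        Hom V (VHom (VSrc (mk_fun A B T H)) (x, y))
          (VHom (VTgt (mk_fun A B T H)) (VFObj (mk_fun A B T H) x, VFObj (mk_fun A B T H) y)))"
      unfolding s using H by (auto simp: mk_fun_def PiE_iff)
  qed (use C I in \<open>simp_all add: mk_fun_def\<close>)
qed (use AB in \<open>simp_all add: mk_fun_def\<close>)

lemma Comp_simps:
  assumes F: "F \<in> Hom \<V>Cat A B"
  shows "\<And>x. x \<in> VObj A \<Longrightarrow> VFObj (G \<odot> F) x = VFObj G (VFObj F x)"
    and "\<And>x y. x \<in> VObj A \<Longrightarrow> y \<in> VObj A \<Longrightarrow>
      VFHom (G \<odot> F) (x, y) = VFHom G (VFObj F x, VFObj F y) \<cdot> VFHom F (x, y)"
  using F by (simp_all add: \<V>Cat_Hom) (simp_all add: VCat_def vfunctor_comp_def)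

lemma Ident_simps:
  "\<And>x. x \<in> VObj A \<Longrightarrow> VFObj (Ident \<V>Cat A) x = x"
  "\<And>x y. x \<in> VObj A \<Longrightarrow> y \<in> VObj A \<Longrightarrow> VFHom (Ident \<V>Cat A) (x, y) = Ident V (VHom A (x, y))"
  by (simp_all add: VCat_def vfunctor_ident_def)

text \<open>The squares expressing preservation of composition by \<open>F\<close> and by
  \<open>G\<close> are pasted, and the interchange law merges the two products of hom-arrows into
  one.\<close>

lemma Comp_hom:
  assumes F: "F \<in> Hom \<V>Cat A B" and G: "G \<in> Hom \<V>Cat B C"
  shows "G \<odot> F \<in> Hom \<V>Cat A C"
proof -
  have eq: "G \<odot> F = mk_fun A C (\<lambda>x. VFObj G (VFObj F x))
      (\<lambda>x y. VFHom G (VFObj F x, VFObj F y) \<cdot> VFHom F (x, y))"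
    using F G by (simp add: \<V>Cat_Hom) (simp add: VCat_def vfunctor_comp_def mk_fun_def)
  note A = Obj_vcat[OF fun_src[OF F]] and B = Obj_vcat[OF fun_tgt[OF F]] and C = Obj_vcat[OF fun_tgt[OF G]]
  note o = fun_Obj[OF F]
  show ?thesis unfolding eq
  proof (rule mk_fun_hom)
    show "A \<in> Obj \<V>Cat" "C \<in> Obj \<V>Cat" using fun_src[OF F] fun_tgt[OF G] by auto
    show "VFObj G (VFObj F x) \<in> VObj C" if "x \<in> VObj A" for x using fun_Obj[OF G o[OF that]] .
    show "VFHom G (VFObj F x, VFObj F y) \<cdot> VFHom F (x, y)
        \<in> Hom V (VHom A (x, y)) (VHom C (VFObj G (VFObj F x), VFObj G (VFObj F y)))"
      if "x \<in> VObj A" "y \<in> VObj A" for x y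
      using comp_hom[OF fun_Hom[OF G o[OF that(1)] o[OF that(2)]] fun_Hom[OF F that]] .
    show "(VFHom G (VFObj F x, VFObj F z) \<cdot> VFHom F (x, z)) \<cdot> VComp A (x, y, z) =
        VComp C (VFObj G (VFObj F x), VFObj G (VFObj F y), VFObj G (VFObj F z)) \<cdot>
        ((VFHom G (VFObj F y, VFObj F z) \<cdot> VFHom F (y, z)) \<otimes>
         (VFHom G (VFObj F x, VFObj F y) \<cdot> VFHom F (x, y)))"
      if x: "x \<in> VObj A" and y: "y \<in> VObj A" and z: "z \<in> VObj A" for x y z
    proof -
      note Fxz = fun_Hom[OF F x z] and Fxy = fun_Hom[OF F x y] and Fyz = fun_Hom[OF F y z]
      note Gxz = fun_Hom[OF G o[OF x] o[OF z]] and Gxy = fun_Hom[OF G o[OF x] o[OF y]]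
        and Gyz = fun_Hom[OF G o[OF y] o[OF z]]
      note GG = tensor_hom[OF Gyz Gxy] and FF = tensor_hom[OF Fyz Fxy]
      show ?thesis
        using comp_assoc[OF Gxz Fxz vcat_Comp[OF A x y z]] fun_Comp[OF F x y z]
          comp_assoc[OF Gxz vcat_Comp[OF B o[OF x] o[OF y] o[OF z]] FF]
          fun_Comp[OF G o[OF x] o[OF y] o[OF z]]
          comp_assoc[OF vcat_Comp[OF C fun_Obj[OF G o[OF x]] fun_Obj[OF G o[OF y]] fun_Obj[OF G o[OF z]]] GG FF]
          tensor_comp[OF Fyz Gyz Fxy Gxy] by simp
    qed
    show "(VFHom G (VFObj F x, VFObj F x) \<cdot> VFHom F (x, x)) \<cdot> VIdent A x =
        VIdent C (VFObj G (VFObj F x))" if x: "x \<in> VObj A" for x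
      using comp_assoc[OF fun_Hom[OF G o[OF x] o[OF x]] fun_Hom[OF F x x] vcat_Ident[OF A x]]
        fun_Ident[OF F x] fun_Ident[OF G o[OF x]] by simp
  qed
qed

lemma Ident_hom:
  assumes A: "A \<in> Obj \<V>Cat"
  shows "Ident \<V>Cat A \<in> Hom \<V>Cat A A"
proof -
  have eq: "Ident \<V>Cat A = mk_fun A A (\<lambda>x. x) (\<lambda>x y. Ident V (VHom A (x, y)))"
    by (auto simp: VCat_def vfunctor_ident_def mk_fun_def intro!: restrict_ext)
  note A' = Obj_vcat[OF A]
  show ?thesis unfolding eq
  proof (rule mk_fun_hom[OF A A])
    show "Ident V (VHom A (x, y)) \<in> Hom V (VHom A (x, y)) (VHom A (x, y))"
      if "x \<in> VObj A" "y \<in> VObj A" for x y using ident_hom[OF vcat_Hom[OF A' that]] .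
    show "Ident V (VHom A (x, z)) \<cdot> VComp A (x, y, z) =
        VComp A (x, y, z) \<cdot> (Ident V (VHom A (y, z)) \<otimes> Ident V (VHom A (x, y)))"
      if "x \<in> VObj A" "y \<in> VObj A" "z \<in> VObj A" for x y z
      using vcat_Comp[OF A' that] vcat_Hom[OF A'] that
      by (simp add: comp_ident_left comp_ident_right tensor_ident)
    show "Ident V (VHom A (x, x)) \<cdot> VIdent A x = VIdent A x" if "x \<in> VObj A" for x
      using vcat_Ident[OF A' that] by (simp add: comp_ident_left)
  qed
qed

lemma \<V>Cat_category: "is_category \<V>Cat"
  unfolding is_category_def
proof (intro conjI ballI impI)
  show "Ident \<V>Cat A \<in> Hom \<V>Cat A A" if "A \<in> Obj \<V>Cat" for A using Ident_hom[OF that] .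
next
  fix F assume "F \<in> Arr \<V>Cat"
  then obtain A B where F: "F \<in> Hom \<V>Cat A B" using HomI by metis
  then have dc: "Dom \<V>Cat F = A" "Cod \<V>Cat F = B" by (auto dest: HomD)
  show "Dom \<V>Cat F \<in> Obj \<V>Cat" "Cod \<V>Cat F \<in> Obj \<V>Cat" unfolding dc using F fun_src fun_tgt by auto
  note I = Ident_hom[OF fun_src[OF F]] and J = Ident_hom[OF fun_tgt[OF F]]
  show "F \<odot> Ident \<V>Cat (Dom \<V>Cat F) = F" unfolding dc
    by (rule fun_eqI[OF Comp_hom[OF I F] F])
      (simp_all add: Comp_simps[OF I] Ident_simps comp_ident_right[OF fun_Hom[OF F]])
  show "Ident \<V>Cat (Cod \<V>Cat F) \<odot> F = F" unfolding dc
    by (rule fun_eqI[OF Comp_hom[OF F J] F])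
      (simp_all add: Comp_simps[OF F] Ident_simps fun_Obj[OF F] comp_ident_left[OF fun_Hom[OF F]])
  fix G assume "G \<in> Arr \<V>Cat" "Cod \<V>Cat F = Dom \<V>Cat G"
  then obtain C where G: "G \<in> Hom \<V>Cat B C" using HomI dc by metis
  then have "Cod \<V>Cat G = C" by (auto dest: HomD)
  then show "G \<odot> F \<in> Hom \<V>Cat (Dom \<V>Cat F) (Cod \<V>Cat G)" unfolding dc using Comp_hom[OF F G] by simp
  fix H assume "H \<in> Arr \<V>Cat" "Cod \<V>Cat G = Dom \<V>Cat H"
  then obtain D where H: "H \<in> Hom \<V>Cat C D" using HomI \<open>Cod \<V>Cat G = C\<close> by metis
  note GF = Comp_hom[OF F G] and HG = Comp_hom[OF G H]
  show "H \<odot> G \<odot> F = (H \<odot> G) \<odot> F"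
    by (rule fun_eqI[OF Comp_hom[OF GF H] Comp_hom[OF F HG]])
      (simp_all add: Comp_simps[OF F] Comp_simps[OF G] Comp_simps[OF GF] fun_Obj[OF F]
        comp_assoc[OF fun_Hom[OF H] fun_Hom[OF G] fun_Hom[OF F]] fun_Obj[OF G])
qed

sublocale VC: cat \<V>Cat
  by unfold_locales (rule \<V>Cat_category)

end

section \<open>Embeddings of enriched categories\<close>

context enriched
begin

text \<open>An isomorphism onto a full subcategory. Requiring isomorphisms on hom-objects instead of
  identities makes the notion invariant under isomorphism of \<open>V\<close>-categories, as
  arbitrary coproducts require.\<close>

definition embedding :: "('s, 'o, 'a) vfunctor \<Rightarrow> ('s, 'o, 'a) vcat \<Rightarrow> ('s, 'o, 'a) vcat \<Rightarrow> bool" where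
  "embedding m A B \<longleftrightarrow> m \<in> Hom \<V>Cat A B \<and> inj_on (VFObj m) (VObj A) \<and>
     (\<forall>x\<in>VObj A. \<forall>y\<in>VObj A. is_iso V (VFHom m (x, y)))"

lemma embeddingD:
  assumes "embedding m A B"
  shows "m \<in> Hom \<V>Cat A B" "inj_on (VFObj m) (VObj A)"
    "\<And>x y. x \<in> VObj A \<Longrightarrow> y \<in> VObj A \<Longrightarrow> is_iso V (VFHom m (x, y))"
  using assms by (auto simp: embedding_def)

lemma embedding_comp:
  assumes m: "embedding m A B" and n: "embedding n B C"
  shows "embedding (n \<odot> m) A C"
proof -
  note M = embeddingD[OF m] and N = embeddingD[OF n]
  have "inj_on (VFObj (n \<odot> m)) (VObj A)"
    using M(2) N(2) fun_Obj[OF M(1)] by (auto simp: inj_on_def Comp_simps[OF M(1)])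
  moreover have "is_iso V (VFHom (n \<odot> m) (x, y))" if xy: "x \<in> VObj A" "y \<in> VObj A" for x y
    unfolding Comp_simps(2)[OF M(1) xy]
    using iso_comp[OF M(3)[OF xy] N(3) fun_Hom[OF M(1) xy] fun_Hom[OF N(1)]] fun_Obj[OF M(1)] xy
    by simp
  ultimately show ?thesis unfolding embedding_def using Comp_hom[OF M(1) N(1)] by blast
qed

text \<open>Embeddings are monomorphisms. Injectivity first equates the object maps; only then do
  the hom-arrows of \<open>f\<close> and \<open>g\<close> have the same codomain, and the
  isomorphism of \<open>m\<close> can be cancelled.\<close>

lemma embedding_cancel:
  assumes m: "embedding m A B" and f: "f \<in> Hom \<V>Cat T A" and g: "g \<in> Hom \<V>Cat T A"
    and eq: "m \<odot> f = m \<odot> g"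
  shows "f = g"
proof (rule fun_eqI[OF f g])
  note M = embeddingD[OF m]
  show o: "VFObj f t = VFObj g t" if t: "t \<in> VObj T" for t
    using Comp_simps(1)[OF f t, of m] Comp_simps(1)[OF g t, of m] eq
      inj_onD[OF M(2)] fun_Obj[OF f t] fun_Obj[OF g t] by simp
  show "VFHom f (s, t) = VFHom g (s, t)" if s: "s \<in> VObj T" and t: "t \<in> VObj T" for s t
  proof (rule iso_cancel_left[OF M(3) fun_Hom[OF M(1)]])
    show "VFObj f s \<in> VObj A" "VFObj f t \<in> VObj A" "VFObj f s \<in> VObj A" "VFObj f t \<in> VObj A"
      using fun_Obj[OF f] s t by auto
    show "VFHom f (s, t) \<in> Hom V (VHom T (s, t)) (VHom A (VFObj f s, VFObj f t))"
      using fun_Hom[OF f s t] .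
    show "VFHom g (s, t) \<in> Hom V (VHom T (s, t)) (VHom A (VFObj f s, VFObj f t))"
      using fun_Hom[OF g s t] o s t by simp
    show "VFHom m (VFObj f s, VFObj f t) \<cdot> VFHom f (s, t)
        = VFHom m (VFObj f s, VFObj f t) \<cdot> VFHom g (s, t)"
      using Comp_simps(2)[OF f s t, of m] Comp_simps(2)[OF g s t, of m] eq o s t by simp
  qed
qed

text \<open>On objects, \<open>u t\<close> is a preimage of \<open>VFObj a t\<close>; on
  hom-objects, \<open>a\<close> is followed by the inverse of the isomorphism of \<open>m\<close>.
  The functor laws may be tested after applying \<open>m\<close>, where they become those of
  \<open>a\<close>.\<close>

lemma embedding_factor:
  assumes m: "embedding m A B" and a: "a \<in> Hom \<V>Cat T B"
    and im: "\<And>t. t \<in> VObj T \<Longrightarrow> VFObj a t \<in> VFObj m ` VObj A"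
  shows "\<exists>c. c \<in> Hom \<V>Cat T A \<and> m \<odot> c = a"
proof -
  note M = embeddingD[OF m]
  note T' = Obj_vcat[OF fun_src[OF a]] and A' = Obj_vcat[OF fun_src[OF M(1)]]
    and B' = Obj_vcat[OF fun_tgt[OF a]]
  obtain u where u: "\<And>t. t \<in> VObj T \<Longrightarrow> u t \<in> VObj A" "\<And>t. t \<in> VObj T \<Longrightarrow> VFObj m (u t) = VFObj a t"
  proof -
    have "\<forall>t\<in>VObj T. \<exists>y. y \<in> VObj A \<and> VFObj m y = VFObj a t"
      using im by (auto simp: image_iff) metis
    from bchoice[OF this] show thesis using that by blast
  qed
  have mH: "VFHom m (u s, u t) \<in> Hom V (VHom A (u s, u t)) (VHom B (VFObj a s, VFObj a t))"
    and mI: "is_iso V (VFHom m (u s, u t))"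
    if "s \<in> VObj T" "t \<in> VObj T" for s t
    using fun_Hom[OF M(1) u(1)[OF that(1)] u(1)[OF that(2)], unfolded u(2)[OF that(1)] u(2)[OF that(2)]]
      M(3)[OF u(1)[OF that(1)] u(1)[OF that(2)]] by this+
  have "\<exists>h. h \<in> Hom V (VHom T (s, t)) (VHom A (u s, u t)) \<and> VFHom m (u s, u t) \<cdot> h = VFHom a (s, t)"
    if st: "s \<in> VObj T" "t \<in> VObj T" for s t
  proof -
    obtain n where n: "n \<in> Hom V (VHom B (VFObj a s, VFObj a t)) (VHom A (u s, u t))"
      "VFHom m (u s, u t) \<cdot> n = Ident V (VHom B (VFObj a s, VFObj a t))"
      using is_isoE[OF mI[OF st] mH[OF st]] by metis
    note h = fun_Hom[OF a st]
    show ?thesis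
      using comp_hom[OF n(1) h] comp_assoc[OF mH[OF st] n(1) h] n(2) comp_ident_left[OF h] by auto
  qed
  then obtain H where H: "\<And>s t. \<lbrakk>s \<in> VObj T; t \<in> VObj T\<rbrakk> \<Longrightarrow>
      H s t \<in> Hom V (VHom T (s, t)) (VHom A (u s, u t))"
    and mHa: "\<And>s t. \<lbrakk>s \<in> VObj T; t \<in> VObj T\<rbrakk> \<Longrightarrow> VFHom m (u s, u t) \<cdot> H s t = VFHom a (s, t)"
    by metis
  have c: "mk_fun T A u H \<in> Hom \<V>Cat T A"
  proof (rule mk_fun_hom[OF fun_src[OF a] fun_src[OF M(1)] u(1) H])
    fix x y z assume x: "x \<in> VObj T" and y: "y \<in> VObj T" and z: "z \<in> VObj T"
    note ux = u(1)[OF x] and uy = u(1)[OF y] and uz = u(1)[OF z]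
    note cT = vcat_Comp[OF T' x y z] and cA = vcat_Comp[OF A' ux uy uz]
      and cB = vcat_Comp[OF B' fun_Obj[OF a x] fun_Obj[OF a y] fun_Obj[OF a z]]
    note HH = tensor_hom[OF H[OF y z] H[OF x y]] and mm = tensor_hom[OF mH[OF y z] mH[OF x y]]
    show "H x z \<cdot> VComp T (x, y, z) = VComp A (u x, u y, u z) \<cdot> (H y z \<otimes> H x y)"
    proof (rule iso_cancel_left[OF mI[OF x z] mH[OF x z] comp_hom[OF H[OF x z] cT] comp_hom[OF cA HH]])
      have "VFHom m (u x, u z) \<cdot> H x z \<cdot> VComp T (x, y, z) = VFHom a (x, z) \<cdot> VComp T (x, y, z)"
        using comp_assoc[OF mH[OF x z] H[OF x z] cT] mHa[OF x z] by simp
      also have "\<dots> = VComp B (VFObj a x, VFObj a y, VFObj a z) \<cdot> (VFHom a (y, z) \<otimes> VFHom a (x, y))"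
        using fun_Comp[OF a x y z] .
      also have "VFHom a (y, z) \<otimes> VFHom a (x, y) =
          (VFHom m (u y, u z) \<otimes> VFHom m (u x, u y)) \<cdot> (H y z \<otimes> H x y)"
        using tensor_comp[OF H[OF y z] mH[OF y z] H[OF x y] mH[OF x y]] mHa[OF y z] mHa[OF x y] by simp
      also have "VComp B (VFObj a x, VFObj a y, VFObj a z) \<cdot> \<dots> =
          (VComp B (VFObj a x, VFObj a y, VFObj a z) \<cdot> (VFHom m (u y, u z) \<otimes> VFHom m (u x, u y))) \<cdot>
          (H y z \<otimes> H x y)"
        using comp_assoc[OF cB mm HH] by simp
      also have "\<dots> = (VFHom m (u x, u z) \<cdot> VComp A (u x, u y, u z)) \<cdot> (H y z \<otimes> H x y)"
        using fun_Comp[OF M(1) ux uy uz] u(2) x y z by simp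
      also have "\<dots> = VFHom m (u x, u z) \<cdot> VComp A (u x, u y, u z) \<cdot> (H y z \<otimes> H x y)"
        using comp_assoc[OF mH[OF x z] cA HH] .
      finally show "VFHom m (u x, u z) \<cdot> H x z \<cdot> VComp T (x, y, z) =
          VFHom m (u x, u z) \<cdot> VComp A (u x, u y, u z) \<cdot> (H y z \<otimes> H x y)" .
    qed
  next
    fix x assume x: "x \<in> VObj T"
    note iT = vcat_Ident[OF T' x] and iA = vcat_Ident[OF A' u(1)[OF x]]
    show "H x x \<cdot> VIdent T x = VIdent A (u x)"
    proof (rule iso_cancel_left[OF mI[OF x x] mH[OF x x] comp_hom[OF H[OF x x] iT] iA])
      show "VFHom m (u x, u x) \<cdot> H x x \<cdot> VIdent T x = VFHom m (u x, u x) \<cdot> VIdent A (u x)"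
        using comp_assoc[OF mH[OF x x] H[OF x x] iT] mHa[OF x x] fun_Ident[OF a x]
          fun_Ident[OF M(1) u(1)[OF x]] u(2)[OF x] by simp
    qed
  qed
  moreover have "m \<odot> mk_fun T A u H = a"
    by (rule fun_eqI[OF Comp_hom[OF c M(1)] a]) (simp_all add: Comp_simps[OF c] u(2) mHa)
  ultimately show ?thesis by blast
qed

text \<open>The inverse functor supplies inverses on objects and on each hom-object. This lets the
  comparison isomorphism of two coproducts transport embeddings and coverings from one to the
  other.\<close>

lemma iso_embedding:
  assumes \<theta>: "\<theta> \<in> Hom \<V>Cat A B" and iso: "is_iso \<V>Cat \<theta>"
  shows "embedding \<theta> A B" "VFObj \<theta> ` VObj A = VObj B"
proof -
  obtain \<phi> where \<phi>: "\<phi> \<in> Hom \<V>Cat B A" and \<phi>\<theta>: "\<phi> \<odot> \<theta> = Ident \<V>Cat A" and \<theta>\<phi>: "\<theta> \<odot> \<phi> = Ident \<V>Cat B"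
    using VC.is_isoE[OF iso \<theta>] by metis
  have a: "VFObj \<phi> (VFObj \<theta> x) = x" if "x \<in> VObj A" for x
    using \<phi>\<theta> Comp_simps(1)[OF \<theta> that, of \<phi>] Ident_simps(1)[OF that] by simp
  have b: "VFObj \<theta> (VFObj \<phi> x) = x" if "x \<in> VObj B" for x
    using \<theta>\<phi> Comp_simps(1)[OF \<phi> that, of \<theta>] Ident_simps(1)[OF that] by simp
  have inj: "inj_on (VFObj \<theta>) (VObj A)" using a by (metis inj_onI)
  show "VFObj \<theta> ` VObj A = VObj B"
  proof
    show "VFObj \<theta> ` VObj A \<subseteq> VObj B" using fun_Obj[OF \<theta>] by blast
    show "VObj B \<subseteq> VFObj \<theta> ` VObj A" using b fun_Obj[OF \<phi>] by (metis imageI subsetI)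
  qed
  have "is_iso V (VFHom \<theta> (x, y))" if xy: "x \<in> VObj A" "y \<in> VObj A" for x y
  proof (rule is_isoI[OF fun_Hom[OF \<theta> xy]])
    note o = fun_Obj[OF \<theta> xy(1)] fun_Obj[OF \<theta> xy(2)]
    show "VFHom \<phi> (VFObj \<theta> x, VFObj \<theta> y) \<in> Hom V (VHom B (VFObj \<theta> x, VFObj \<theta> y)) (VHom A (x, y))"
      using fun_Hom[OF \<phi> o] a xy by simp
    show "VFHom \<phi> (VFObj \<theta> x, VFObj \<theta> y) \<cdot> VFHom \<theta> (x, y) = Ident V (VHom A (x, y))"
      using \<phi>\<theta> Comp_simps(2)[OF \<theta> xy, of \<phi>] Ident_simps(2)[OF xy] by simp
    show "VFHom \<theta> (x, y) \<cdot> VFHom \<phi> (VFObj \<theta> x, VFObj \<theta> y) = Ident V (VHom B (VFObj \<theta> x, VFObj \<theta> y))"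
      using \<theta>\<phi> Comp_simps(2)[OF \<phi> o, of \<theta>] Ident_simps(2)[OF o] a xy by simp
  qed
  then show "embedding \<theta> A B" using inj \<theta> by (simp add: embedding_def)
qed

section \<open>Full subcategories and their inclusions\<close>

definition restrict_vcat :: "('s, 'o, 'a) vcat \<Rightarrow> 's set \<Rightarrow> ('s, 'o, 'a) vcat" where
  "restrict_vcat A S = \<lparr>VObj = S, VHom = restrict (VHom A) (S \<times> S),
     VComp = restrict (VComp A) (S \<times> S \<times> S), VIdent = restrict (VIdent A) S\<rparr>"

lemma restrict_vcat_simps [simp]:
  "VObj (restrict_vcat A S) = S"
  "x \<in> S \<Longrightarrow> y \<in> S \<Longrightarrow> VHom (restrict_vcat A S) (x, y) = VHom A (x, y)"
  "x \<in> S \<Longrightarrow> y \<in> S \<Longrightarrow> z \<in> S \<Longrightarrow> VComp (restrict_vcat A S) (x, y, z) = VComp A (x, y, z)"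
  "x \<in> S \<Longrightarrow> VIdent (restrict_vcat A S) x = VIdent A x"
  by (simp_all add: restrict_vcat_def)

text \<open>Every axiom is an instance of the same axiom of \<open>A\<close>. Smallness holds
  because the universe also names the subsets of the sets it names.\<close>

lemma restrict_vcat_Obj:
  assumes A: "A \<in> Obj \<V>Cat" and S: "S \<subseteq> VObj A"
  shows "restrict_vcat A S \<in> Obj \<V>Cat"
  unfolding \<V>Cat_Obj
proof
  note A' = Obj_vcat[OF A]
  show "is_vcat V M (restrict_vcat A S)"
  proof (rule vcatI, unfold restrict_vcat_simps)
    show "VHom (restrict_vcat A S) \<in> extensional (S \<times> S)"
      "VComp (restrict_vcat A S) \<in> extensional (S \<times> S \<times> S)"
      "VIdent (restrict_vcat A S) \<in> extensional S"
      by (simp_all add: restrict_vcat_def)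
  qed (use S in \<open>simp_all add: subset_iff vcat_Hom[OF A'] vcat_Comp[OF A'] vcat_Ident[OF A']
         vcat_assoc[OF A'] vcat_unit_left[OF A'] vcat_unit_right[OF A']\<close>)
  show "\<exists>u\<in>elts U. VObj (restrict_vcat A S) = elts u"
    using A S subset_member unfolding \<V>Cat_Obj by (metis restrict_vcat_simps(1))
qed

definition inclusion :: "('s, 'o, 'a) vcat \<Rightarrow> 's set \<Rightarrow> ('s, 'o, 'a) vfunctor" where
  "inclusion A S = mk_fun (restrict_vcat A S) A (\<lambda>x. x) (\<lambda>x y. Ident V (VHom A (x, y)))"

lemma inclusion_embedding:
  assumes A: "A \<in> Obj \<V>Cat" and S: "S \<subseteq> VObj A"
  shows "embedding (inclusion A S) (restrict_vcat A S) A"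
    and "\<And>x. x \<in> S \<Longrightarrow> VFObj (inclusion A S) x = x"
proof -
  note A' = Obj_vcat[OF A]
  have in_A: "x \<in> VObj A" if "x \<in> S" for x using S that by blast
  show o: "VFObj (inclusion A S) x = x" if "x \<in> S" for x using that by (simp add: inclusion_def)
  have "inclusion A S \<in> Hom \<V>Cat (restrict_vcat A S) A"
    unfolding inclusion_def
  proof (rule mk_fun_hom[OF restrict_vcat_Obj[OF A S] A], unfold restrict_vcat_simps(1))
    fix x y z assume "x \<in> S" "y \<in> S" "z \<in> S"
    then show "Ident V (VHom A (x, z)) \<cdot> VComp (restrict_vcat A S) (x, y, z) =
        VComp A (x, y, z) \<cdot> (Ident V (VHom A (y, z)) \<otimes> Ident V (VHom A (x, y)))"
      by (simp add: in_A vcat_Hom[OF A'] tensor_ident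
          comp_ident_left[OF vcat_Comp[OF A' in_A in_A in_A]]
          comp_ident_right[OF vcat_Comp[OF A' in_A in_A in_A]])
  next
    fix x assume "x \<in> S"
    then show "Ident V (VHom A (x, x)) \<cdot> VIdent (restrict_vcat A S) x = VIdent A x"
      by (simp add: comp_ident_left[OF vcat_Ident[OF A' in_A]])
  qed (simp_all add: in_A ident_hom[OF vcat_Hom[OF A']])
  moreover have "inj_on (VFObj (inclusion A S)) S" using o by (simp add: inj_on_def)
  moreover have "is_iso V (VFHom (inclusion A S) (x, y))" if "x \<in> S" "y \<in> S" for x y
    using iso_ident[OF vcat_Hom[OF A' in_A in_A]] that by (simp add: inclusion_def)
  ultimately show "embedding (inclusion A S) (restrict_vcat A S) A" by (simp add: embedding_def)
qed

end

section \<open>Coproducts of enriched categories\<close>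

locale strict_enriched = enriched V M elts U
  for V :: "('o, 'a) category" and M :: "('o, 'a) cartesian" and elts :: "'s \<Rightarrow> 's set" and U :: 's +
  fixes zero :: 'o
  assumes strict: "is_strict_initial V zero"
begin

lemma zero_initial: "is_initial V zero"
  using strict by (simp add: is_strict_initial_def)

lemma initial_eqI:
  assumes "is_initial V x" "f \<in> Hom V x y" "g \<in> Hom V x y"
  shows "f = g"
  using assms Hom_Obj(2)[OF assms(2)] unfolding is_initial_def by blast

lemma initial_arrow: "is_initial V x \<Longrightarrow> y \<in> Obj V \<Longrightarrow> \<exists>f. f \<in> Hom V x y"
  unfolding is_initial_def by blast

text \<open>Strictness is assumed for \<open>zero\<close> only. Following \<open>f\<close> by an
  arrow from \<open>y\<close> to \<open>zero\<close> gives an invertible arrow from \<open>x\<close>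
  to \<open>zero\<close>, so \<open>x\<close> is isomorphic to \<open>zero\<close>; any arrow out of
  \<open>x\<close> is determined by its composite with the inverse \<open>k\<close>.\<close>

lemma strict_initial:
  assumes f: "f \<in> Hom V x y" and y: "is_initial V y"
  shows "is_initial V x"
proof -
  have z: "zero \<in> Obj V" using zero_initial by (simp add: is_initial_def)
  obtain g where "g \<in> Hom V y zero" using initial_arrow[OF y z] by blast
  then have h: "g \<cdot> f \<in> Hom V x zero" using comp_hom f by blast
  then have "is_iso V (g \<cdot> f)" using strict HomD[OF h] unfolding is_strict_initial_def by blast
  then obtain k where k: "k \<in> Hom V zero x" "k \<cdot> (g \<cdot> f) = Ident V x"
    using is_isoE[OF _ h] by metis
  show ?thesis unfolding is_initial_def
  proof (intro conjI ballI)
    show "x \<in> Obj V" using Hom_Obj[OF f] by blast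
    fix t assume t: "t \<in> Obj V"
    obtain e where e: "e \<in> Hom V zero t" using initial_arrow[OF zero_initial t] by blast
    show "\<exists>!l. l \<in> Hom V x t"
    proof (rule ex1I)
      show "e \<cdot> (g \<cdot> f) \<in> Hom V x t" using comp_hom[OF e h] .
      fix l assume l: "l \<in> Hom V x t"
      have "l \<cdot> k = e" using initial_eqI[OF zero_initial comp_hom[OF l k(1)] e] .
      then show "l = e \<cdot> (g \<cdot> f)"
        using comp_assoc[OF l k(1) h] k(2) comp_ident_right[OF l] by simp
    qed
  qed
qed

lemma initial_product:
  assumes "x \<in> Obj V" "y \<in> Obj V" "is_initial V x \<or> is_initial V y"
  shows "is_initial V (x \<boxtimes> y)"
  using assms(3) strict_initial Fst_hom[OF assms(1,2)] Snd_hom[OF assms(1,2)] by blast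

text \<open>
  These are exactly the coproduct cocones; unlike the universal property, the condition passes to
  preimages under any functor.
\<close>

definition decomposition ::
    "'i set \<Rightarrow> ('i \<Rightarrow> ('s, 'o, 'a) vcat) \<Rightarrow> ('s, 'o, 'a) vcat \<Rightarrow> ('i \<Rightarrow> ('s, 'o, 'a) vfunctor) \<Rightarrow> bool" where
  "decomposition I X S \<iota> \<longleftrightarrow> S \<in> Obj \<V>Cat \<and> (\<forall>i\<in>I. embedding (\<iota> i) (X i) S) \<and>
     VObj S \<subseteq> (\<Union>i\<in>I. VFObj (\<iota> i) ` VObj (X i)) \<and>
     (\<forall>i\<in>I. \<forall>j\<in>I. i \<noteq> j \<longrightarrow> (\<forall>x\<in>VObj (X i). \<forall>y\<in>VObj (X j).
        VFObj (\<iota> i) x \<noteq> VFObj (\<iota> j) y \<and> is_initial V (VHom S (VFObj (\<iota> i) x, VFObj (\<iota> j) y))))"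

lemma decompositionD:
  assumes "decomposition I X S \<iota>"
  shows "S \<in> Obj \<V>Cat" "\<And>i. i \<in> I \<Longrightarrow> embedding (\<iota> i) (X i) S"
    "\<And>s. s \<in> VObj S \<Longrightarrow> \<exists>i x. i \<in> I \<and> x \<in> VObj (X i) \<and> VFObj (\<iota> i) x = s"
    "\<And>i j x y. \<lbrakk>i \<in> I; j \<in> I; x \<in> VObj (X i); y \<in> VObj (X j); VFObj (\<iota> i) x = VFObj (\<iota> j) y\<rbrakk> \<Longrightarrow> i = j"
    "\<And>i j x y. \<lbrakk>i \<in> I; j \<in> I; i \<noteq> j; x \<in> VObj (X i); y \<in> VObj (X j)\<rbrakk>
      \<Longrightarrow> is_initial V (VHom S (VFObj (\<iota> i) x, VFObj (\<iota> j) y))"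
  using assms unfolding decomposition_def by blast+

text \<open>A functor out of \<open>S\<close> is prescribed within each summand, where the injection
  is invertible on hom-objects, and leaves no freedom between different summands, where the
  hom-object is initial. The same dichotomy proves its laws and its uniqueness.\<close>

theorem decomposition_coproduct:
  assumes dec: "decomposition I X S \<iota>"
  shows "is_coproduct \<V>Cat I X S \<iota>"
  unfolding is_coproduct_def
proof (intro conjI ballI allI impI)
  note D = decompositionD[OF dec]
  note E = embeddingD[OF D(2)]
  show "S \<in> Obj \<V>Cat" by (rule D(1))
  show "\<iota> i \<in> Hom \<V>Cat (X i) S" if "i \<in> I" for i using E(1)[OF that] .
  fix T f assume T: "T \<in> Obj \<V>Cat" and "\<forall>i\<in>I. f i \<in> Hom \<V>Cat (X i) T"
  then have f: "\<And>i. i \<in> I \<Longrightarrow> f i \<in> Hom \<V>Cat (X i) T" by blast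
  note S' = Obj_vcat[OF D(1)] and T' = Obj_vcat[OF T] and X' = Obj_vcat[OF fun_src[OF f]]
  \<comment> \<open>Covering gives each object of \<open>S\<close> a summand \<open>idx s\<close>
    and a preimage \<open>el s\<close> in it; disjointness and injectivity make these the unique
    ones.\<close>
  obtain idx el where idx: "\<And>s. s \<in> VObj S \<Longrightarrow> idx s \<in> I"
    and el: "\<And>s. s \<in> VObj S \<Longrightarrow> el s \<in> VObj (X (idx s))"
    and \<iota>el: "\<And>s. s \<in> VObj S \<Longrightarrow> VFObj (\<iota> (idx s)) (el s) = s"
    using D(3) by metis
  have \<iota>S: "VFObj (\<iota> i) x \<in> VObj S" if "i \<in> I" "x \<in> VObj (X i)" for i x
    using fun_Obj[OF E(1)] that by blast
  have idx\<iota>: "idx (VFObj (\<iota> i) x) = i" if ix: "i \<in> I" "x \<in> VObj (X i)" for i x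
    using D(4)[OF idx[OF \<iota>S[OF ix]] ix(1) el[OF \<iota>S[OF ix]] ix(2)] \<iota>el[OF \<iota>S[OF ix]] by blast
  have el\<iota>: "el (VFObj (\<iota> i) x) = x" if ix: "i \<in> I" "x \<in> VObj (X i)" for i x
    using inj_onD[OF E(2)[OF ix(1)] _ _ ix(2)] \<iota>el[OF \<iota>S[OF ix]] el[OF \<iota>S[OF ix]] idx\<iota>[OF ix] by metis
  define u where "u s = VFObj (f (idx s)) (el s)" for s
  have u: "u s \<in> VObj T" if "s \<in> VObj S" for s
    unfolding u_def using fun_Obj[OF f[OF idx[OF that]] el[OF that]] .
  have \<iota>H: "VFHom (\<iota> i) (el s, el t) \<in> Hom V (VHom (X i) (el s, el t)) (VHom S (s, t))"
    and \<iota>I: "is_iso V (VFHom (\<iota> i) (el s, el t))"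
    and fH: "VFHom (f i) (el s, el t) \<in> Hom V (VHom (X i) (el s, el t)) (VHom T (u s, u t))"
    and elX: "el s \<in> VObj (X i)"
    if "s \<in> VObj S" "t \<in> VObj S" "idx s = i" "idx t = i" for s t i
  proof -
    note e = el[OF that(1), unfolded that] el[OF that(2), unfolded that] and i = idx[OF that(1), unfolded that]
    show "VFHom (\<iota> i) (el s, el t) \<in> Hom V (VHom (X i) (el s, el t)) (VHom S (s, t))"
      using fun_Hom[OF E(1)[OF i] e] \<iota>el that by metis
    show "is_iso V (VFHom (\<iota> i) (el s, el t))" using E(3)[OF i e] .
    show "VFHom (f i) (el s, el t) \<in> Hom V (VHom (X i) (el s, el t)) (VHom T (u s, u t))"
      using fun_Hom[OF f[OF i] e] that by (simp add: u_def)
    show "el s \<in> VObj (X i)" by (rule e)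
  qed
  have init: "is_initial V (VHom S (s, t))" if "s \<in> VObj S" "t \<in> VObj S" "idx s \<noteq> idx t" for s t
    using D(5)[OF idx idx that(3) el el] \<iota>el that by metis
  \<comment> \<open>Within a summand, \<open>h\<close> is the inverse of the hom-isomorphism of the
    injection followed by the arrow of \<open>f\<close>. Across summands it is the arrow out of an
    initial object.\<close>
  have "\<exists>h. h \<in> Hom V (VHom S (s, t)) (VHom T (u s, u t)) \<and>
      (idx s = idx t \<longrightarrow> h \<cdot> VFHom (\<iota> (idx s)) (el s, el t) = VFHom (f (idx s)) (el s, el t))"
    if st: "s \<in> VObj S" "t \<in> VObj S" for s t
  proof (cases "idx s = idx t")
    case True
    note \<iota>' = \<iota>H[OF st refl True[symmetric]] and f' = fH[OF st refl True[symmetric]]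
    obtain n where n: "n \<in> Hom V (VHom S (s, t)) (VHom (X (idx s)) (el s, el t))"
      "n \<cdot> VFHom (\<iota> (idx s)) (el s, el t) = Ident V (VHom (X (idx s)) (el s, el t))"
      using is_isoE[OF \<iota>I[OF st refl True[symmetric]] \<iota>'] by metis
    show ?thesis
      using comp_hom[OF f' n(1)] comp_assoc[OF f' n(1) \<iota>'] n(2) comp_ident_right[OF f'] by auto
  next
    case False
    then show ?thesis
      using initial_arrow[OF init[OF st False] vcat_Hom[OF T' u[OF st(1)] u[OF st(2)]]] by blast
  qed
  then obtain H where H: "\<And>s t. \<lbrakk>s \<in> VObj S; t \<in> VObj S\<rbrakk> \<Longrightarrow> H s t \<in> Hom V (VHom S (s, t)) (VHom T (u s, u t))"
    and H\<iota>': "\<And>s t. \<lbrakk>s \<in> VObj S; t \<in> VObj S; idx s = idx t\<rbrakk> \<Longrightarrow>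
      H s t \<cdot> VFHom (\<iota> (idx s)) (el s, el t) = VFHom (f (idx s)) (el s, el t)"
    by metis
  have H\<iota>: "H s t \<cdot> VFHom (\<iota> i) (el s, el t) = VFHom (f i) (el s, el t)"
    if "s \<in> VObj S" "t \<in> VObj S" "idx s = i" "idx t = i" for s t i
    using H\<iota>'[OF that(1,2)] that(3,4) by simp
  have h: "mk_fun S T u H \<in> Hom \<V>Cat S T"
  proof (rule mk_fun_hom[OF D(1) T u H])
    fix x y z assume x: "x \<in> VObj S" and y: "y \<in> VObj S" and z: "z \<in> VObj S"
    note cS = vcat_Comp[OF S' x y z] and cT = vcat_Comp[OF T' u[OF x] u[OF y] u[OF z]]
    note HH = tensor_hom[OF H[OF y z] H[OF x y]]
    note lhs = comp_hom[OF H[OF x z] cS] and rhs = comp_hom[OF cT HH]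
    show "H x z \<cdot> VComp S (x, y, z) = VComp T (u x, u y, u z) \<cdot> (H y z \<otimes> H x y)"
    proof (cases "idx x = idx y \<and> idx y = idx z")
      case True
      define i where "i = idx x"
      have i: "i \<in> I" "idx x = i" "idx y = i" "idx z = i" using True idx[OF x] by (auto simp: i_def)
      note ex = elX[OF x x i(2,2)] and ey = elX[OF y y i(3,3)] and ez = elX[OF z z i(4,4)]
      note xy = x y i(2,3) and yz = y z i(3,4) and xz = x z i(2,4)
      note cX = vcat_Comp[OF X'[OF i(1)] ex ey ez]
      note \<iota>\<iota> = tensor_hom[OF \<iota>H[OF yz] \<iota>H[OF xy]]
      have \<iota>': "VFObj (\<iota> i) (el x) = x" "VFObj (\<iota> i) (el y) = y" "VFObj (\<iota> i) (el z) = z"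
        using \<iota>el x y z i by metis+
      show ?thesis
      \<comment> \<open>Precomposed with the hom-isomorphisms of the injection, both sides turn into
        the two sides of the law for \<open>f i\<close>.\<close>
      proof (rule iso_cancel_right[OF tensor_iso[OF \<iota>H[OF yz] \<iota>I[OF yz] \<iota>H[OF xy] \<iota>I[OF xy]] \<iota>\<iota> lhs rhs])
        have "(H x z \<cdot> VComp S (x, y, z)) \<cdot> (VFHom (\<iota> i) (el y, el z) \<otimes> VFHom (\<iota> i) (el x, el y))
            = H x z \<cdot> VFHom (\<iota> i) (el x, el z) \<cdot> VComp (X i) (el x, el y, el z)"
          using comp_assoc[OF H[OF x z] cS \<iota>\<iota>] fun_Comp[OF E(1)[OF i(1)] ex ey ez] \<iota>' by simp
        also have "\<dots> = VFHom (f i) (el x, el z) \<cdot> VComp (X i) (el x, el y, el z)"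
          using comp_assoc[OF H[OF x z] \<iota>H[OF xz] cX] H\<iota>[OF xz] by simp
        also have "\<dots> = VComp T (u x, u y, u z) \<cdot> (VFHom (f i) (el y, el z) \<otimes> VFHom (f i) (el x, el y))"
          using fun_Comp[OF f[OF i(1)] ex ey ez] i by (simp add: u_def)
        also have "VFHom (f i) (el y, el z) \<otimes> VFHom (f i) (el x, el y) =
            (H y z \<otimes> H x y) \<cdot> (VFHom (\<iota> i) (el y, el z) \<otimes> VFHom (\<iota> i) (el x, el y))"
          using tensor_comp[OF \<iota>H[OF yz] H[OF y z] \<iota>H[OF xy] H[OF x y]] H\<iota>[OF xy] H\<iota>[OF yz] by simp
        also have "VComp T (u x, u y, u z) \<cdot> \<dots> =
            (VComp T (u x, u y, u z) \<cdot> (H y z \<otimes> H x y)) \<cdot>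
            (VFHom (\<iota> i) (el y, el z) \<otimes> VFHom (\<iota> i) (el x, el y))"
          using comp_assoc[OF cT HH \<iota>\<iota>] by simp
        finally show "(H x z \<cdot> VComp S (x, y, z)) \<cdot> (VFHom (\<iota> i) (el y, el z) \<otimes> VFHom (\<iota> i) (el x, el y))
            = (VComp T (u x, u y, u z) \<cdot> (H y z \<otimes> H x y)) \<cdot>
              (VFHom (\<iota> i) (el y, el z) \<otimes> VFHom (\<iota> i) (el x, el y))" .
      qed
    next
      case False
      \<comment> \<open>This also covers the case where \<open>x\<close> and \<open>z\<close> share
        a summand and only \<open>y\<close> lies elsewhere: the target need not be initial, but the
        source is.\<close>
      then have "is_initial V (VHom S (y, z) \<boxtimes> VHom S (x, y))"
        using initial_product[OF vcat_Hom[OF S' y z] vcat_Hom[OF S' x y]] init[OF x y] init[OF y z] by blast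
      then show ?thesis by (rule initial_eqI[OF _ lhs rhs])
    qed
  next
    fix x assume x: "x \<in> VObj S"
    note i = idx[OF x] and ex = el[OF x]
    note iX = vcat_Ident[OF X'[OF i] ex]
    show "H x x \<cdot> VIdent S x = VIdent T (u x)"
      using comp_assoc[OF H[OF x x] \<iota>H[OF x x refl refl] iX] H\<iota>[OF x x refl refl]
        fun_Ident[OF E(1)[OF i] ex] fun_Ident[OF f[OF i] ex] \<iota>el[OF x] by (simp add: u_def)
  qed
  show "\<exists>!h. h \<in> Hom \<V>Cat S T \<and> (\<forall>i\<in>I. h \<odot> \<iota> i = f i)"
  proof (rule ex1I[where a = "mk_fun S T u H"])
    show "mk_fun S T u H \<in> Hom \<V>Cat S T \<and> (\<forall>i\<in>I. mk_fun S T u H \<odot> \<iota> i = f i)"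
    proof (intro conjI ballI h)
      fix i assume i: "i \<in> I"
      note \<iota>i = E(1)[OF i]
      show "mk_fun S T u H \<odot> \<iota> i = f i"
      proof (rule fun_eqI[OF Comp_hom[OF \<iota>i h] f[OF i]])
        fix x assume x: "x \<in> VObj (X i)"
        show "VFObj (mk_fun S T u H \<odot> \<iota> i) x = VFObj (f i) x"
          using \<iota>S[OF i x] idx\<iota>[OF i x] el\<iota>[OF i x] by (simp add: Comp_simps[OF \<iota>i] x u_def)
        fix y assume y: "y \<in> VObj (X i)"
        show "VFHom (mk_fun S T u H \<odot> \<iota> i) (x, y) = VFHom (f i) (x, y)"
          using \<iota>S[OF i x] \<iota>S[OF i y] H\<iota>[OF \<iota>S[OF i x] \<iota>S[OF i y] idx\<iota>[OF i x] idx\<iota>[OF i y]]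
            el\<iota>[OF i x] el\<iota>[OF i y] by (simp add: Comp_simps[OF \<iota>i] x y)
      qed
    qed
  next
    fix k assume k: "k \<in> Hom \<V>Cat S T \<and> (\<forall>i\<in>I. k \<odot> \<iota> i = f i)"
    then have k': "k \<in> Hom \<V>Cat S T" by blast
    have o: "VFObj k s = u s" if s: "s \<in> VObj S" for s
    proof -
      have "VFObj (k \<odot> \<iota> (idx s)) (el s) = VFObj (f (idx s)) (el s)" using k idx[OF s] by simp
      then show ?thesis using Comp_simps(1)[OF E(1)[OF idx[OF s]] el[OF s], of k] \<iota>el[OF s] by (simp add: u_def)
    qed
    show "k = mk_fun S T u H"
    proof (rule fun_eqI[OF k' h])
      show "VFObj k s = VFObj (mk_fun S T u H) s" if "s \<in> VObj S" for s using that o by simp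
      fix s t assume s: "s \<in> VObj S" and t: "t \<in> VObj S"
      have kH: "VFHom k (s, t) \<in> Hom V (VHom S (s, t)) (VHom T (u s, u t))"
        using fun_Hom[OF k' s t] o s t by simp
      have "VFHom k (s, t) = H s t"
      proof (cases "idx s = idx t")
        case True
        define i where "i = idx s"
        have i: "i \<in> I" "idx s = i" "idx t = i" using True idx[OF s] by (auto simp: i_def)
        note st = s t i(2,3)
        have "VFHom (k \<odot> \<iota> i) (el s, el t) = VFHom (f i) (el s, el t)" using k i by simp
        then have "VFHom k (s, t) \<cdot> VFHom (\<iota> i) (el s, el t) = H s t \<cdot> VFHom (\<iota> i) (el s, el t)"
          using Comp_simps(2)[OF E(1)[OF i(1)] elX[OF s s i(2,2)] elX[OF t t i(3,3)], of k] H\<iota>[OF st]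
            \<iota>el[OF s] \<iota>el[OF t] i by simp
        then show ?thesis by (rule iso_cancel_right[OF \<iota>I[OF st] \<iota>H[OF st] kH H[OF s t]])
      next
        case False
        then show ?thesis by (rule initial_eqI[OF init[OF s t] kH H[OF s t]])
      qed
      then show "VFHom k (s, t) = VFHom (mk_fun S T u H) (s, t)" using s t by simp
    qed
  qed
qed

text \<open>The explicit cocone \<open>\<iota>\<close> and the given cocone \<open>\<kappa>\<close>
  differ by an isomorphism of \<open>V\<close>-categories, and each clause of a decomposition is
  invariant under such an isomorphism.\<close>

lemma coproduct_decomposition:
  assumes dec: "decomposition I X S \<iota>" and cop: "is_coproduct \<V>Cat I X T \<kappa>"
  shows "decomposition I X T \<kappa>"
proof -
  note D = decompositionD[OF dec]
  note E = embeddingD[OF D(2)]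
  obtain \<theta> where \<theta>: "\<theta> \<in> Hom \<V>Cat S T" "is_iso \<V>Cat \<theta>" and \<theta>\<iota>: "\<And>i. i \<in> I \<Longrightarrow> \<theta> \<odot> \<iota> i = \<kappa> i"
    using VC.coproduct_comparison[OF decomposition_coproduct[OF dec] cop] by blast
  note emb = iso_embedding[OF \<theta>]
  have \<kappa>: "VFObj (\<kappa> i) x = VFObj \<theta> (VFObj (\<iota> i) x)" if "i \<in> I" "x \<in> VObj (X i)" for i x
    using \<theta>\<iota>[OF that(1)] Comp_simps(1)[OF E(1)[OF that(1)] that(2), of \<theta>] by simp
  have \<iota>S: "VFObj (\<iota> i) x \<in> VObj S" if "i \<in> I" "x \<in> VObj (X i)" for i x
    using fun_Obj[OF E(1)] that by blast
  show ?thesis unfolding decomposition_def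
  proof (intro conjI ballI impI)
    show "T \<in> Obj \<V>Cat" using fun_tgt[OF \<theta>(1)] .
    show "embedding (\<kappa> i) (X i) T" if "i \<in> I" for i
      using embedding_comp[OF D(2)[OF that] emb(1)] \<theta>\<iota>[OF that] by simp
    show "VObj T \<subseteq> (\<Union>i\<in>I. VFObj (\<kappa> i) ` VObj (X i))"
    proof
      fix t assume "t \<in> VObj T"
      then obtain s where s: "s \<in> VObj S" "VFObj \<theta> s = t" unfolding emb(2)[symmetric] by blast
      then obtain i x where "i \<in> I" "x \<in> VObj (X i)" "VFObj (\<iota> i) x = s" using D(3)[OF s(1)] by blast
      then have "i \<in> I" "x \<in> VObj (X i)" "t = VFObj (\<kappa> i) x" using \<kappa>[of i x] s by simp_all
      then show "t \<in> (\<Union>i\<in>I. VFObj (\<kappa> i) ` VObj (X i))" by blast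
    qed
    fix i j x y assume ij: "i \<in> I" "j \<in> I" "i \<noteq> j" and x: "x \<in> VObj (X i)" and y: "y \<in> VObj (X j)"
    note \<iota>x = \<iota>S[OF ij(1) x] and \<iota>y = \<iota>S[OF ij(2) y]
    show "VFObj (\<kappa> i) x \<noteq> VFObj (\<kappa> j) y"
      using inj_onD[OF embeddingD(2)[OF emb(1)] _ \<iota>x \<iota>y] D(4)[OF ij(1,2) x y] ij \<kappa> x y by metis
    have "is_iso V (VFHom \<theta> (VFObj (\<iota> i) x, VFObj (\<iota> j) y))"
      using embeddingD(3)[OF emb(1) \<iota>x \<iota>y] .
    \<comment> \<open>The inverse hom-arrow maps the hom-object of \<open>T\<close> to an initial
      one of \<open>S\<close>, so strictness applies.\<close>
    then obtain n where "n \<in> Hom V (VHom T (VFObj (\<kappa> i) x, VFObj (\<kappa> j) y))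
        (VHom S (VFObj (\<iota> i) x, VFObj (\<iota> j) y))"
      using is_isoE[OF _ fun_Hom[OF \<theta>(1) \<iota>x \<iota>y]] \<kappa> ij x y by metis
    then show "is_initial V (VHom T (VFObj (\<kappa> i) x, VFObj (\<kappa> j) y))"
      using strict_initial D(5)[OF ij x y] by blast
  qed
qed

section \<open>Gluing a family of enriched categories along initial hom-objects\<close>

definition glue_hom ::
    "('i \<Rightarrow> ('s, 'o, 'a) vcat) \<Rightarrow> ('s \<Rightarrow> 'i) \<Rightarrow> ('s \<Rightarrow> 's) \<Rightarrow> 's \<Rightarrow> 's \<Rightarrow> 'o" where
  "glue_hom X idx el s t = (if idx s = idx t then VHom (X (idx s)) (el s, el t) else zero)"

text \<open>When the three objects do not share a summand, the source of the composition is initial,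
  so the choice picks the only arrow of the required type.\<close>

definition glue_comp ::
    "('i \<Rightarrow> ('s, 'o, 'a) vcat) \<Rightarrow> ('s \<Rightarrow> 'i) \<Rightarrow> ('s \<Rightarrow> 's) \<Rightarrow> 's \<Rightarrow> 's \<Rightarrow> 's \<Rightarrow> 'a" where
  "glue_comp X idx el x y z =
     (if idx x = idx y \<and> idx y = idx z then VComp (X (idx x)) (el x, el y, el z)
      else SOME f. f \<in> Hom V (glue_hom X idx el y z \<boxtimes> glue_hom X idx el x y) (glue_hom X idx el x z))"

text \<open>\<open>idx s\<close> and \<open>el s\<close> say which object of which summand
  \<open>s\<close> stands for; how objects are tagged stays outside the construction. Identities
  need no case distinction, since an object shares a summand with itself.\<close>

definition glue ::
    "('i \<Rightarrow> ('s, 'o, 'a) vcat) \<Rightarrow> 's set \<Rightarrow> ('s \<Rightarrow> 'i) \<Rightarrow> ('s \<Rightarrow> 's) \<Rightarrow> ('s, 'o, 'a) vcat" where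
  "glue X S idx el = \<lparr>VObj = S,
     VHom = (\<lambda>(x, y)\<in>S \<times> S. glue_hom X idx el x y),
     VComp = (\<lambda>(x, y, z)\<in>S \<times> S \<times> S. glue_comp X idx el x y z),
     VIdent = (\<lambda>x\<in>S. VIdent (X (idx x)) (el x))\<rparr>"

lemma glue_simps [simp]:
  "VObj (glue X S idx el) = S"
  "x \<in> S \<Longrightarrow> y \<in> S \<Longrightarrow> VHom (glue X S idx el) (x, y) = glue_hom X idx el x y"
  "x \<in> S \<Longrightarrow> y \<in> S \<Longrightarrow> z \<in> S \<Longrightarrow> VComp (glue X S idx el) (x, y, z) = glue_comp X idx el x y z"
  "x \<in> S \<Longrightarrow> VIdent (glue X S idx el) x = VIdent (X (idx x)) (el x)"
  by (simp_all add: glue_def)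

lemma glue_vcat:
  assumes X: "\<And>s. s \<in> S \<Longrightarrow> is_vcat V M (X (idx s))"
    and el: "\<And>s. s \<in> S \<Longrightarrow> el s \<in> VObj (X (idx s))"
  shows "is_vcat V M (glue X S idx el)"
proof -
  let ?H = "glue_hom X idx el" and ?C = "glue_comp X idx el"
  let ?I = "\<lambda>x. VIdent (X (idx x)) (el x)"
  have H: "?H x y \<in> Obj V" if "x \<in> S" "y \<in> S" for x y
    using vcat_Hom[OF X[OF that(1)] el[OF that(1)], of "el y"] el[OF that(2)] zero_initial
    by (auto simp: glue_hom_def is_initial_def)
  have init: "is_initial V (?H x y)" if "idx x \<noteq> idx y" for x y
    using that zero_initial by (simp add: glue_hom_def)
  have init_pair: "is_initial V (?H y z \<boxtimes> ?H x y)"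
    if xyz: "x \<in> S" "y \<in> S" "z \<in> S" and ne: "\<not> (idx x = idx y \<and> idx y = idx z)" for x y z
    using initial_product[OF H[OF xyz(2,3)] H[OF xyz(1,2)]] init[of y z] init[of x y] ne by blast
  have same_hom: "?H x y = VHom (X i) (el x, el y)" if "idx x = i" "idx y = i" for x y i
    using that by (simp add: glue_hom_def)
  have same_comp: "?C x y z = VComp (X i) (el x, el y, el z)" if "idx x = i" "idx y = i" "idx z = i" for x y z i
    using that by (simp add: glue_comp_def)
  have C: "?C x y z \<in> Hom V (?H y z \<boxtimes> ?H x y) (?H x z)" if xyz: "x \<in> S" "y \<in> S" "z \<in> S" for x y z
  proof (cases "idx x = idx y \<and> idx y = idx z")
    case True
    then show ?thesis
      using vcat_Comp[OF X[OF xyz(1)] el[OF xyz(1)], of "el y" "el z"] el[OF xyz(2)] el[OF xyz(3)]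
      by (simp add: glue_comp_def glue_hom_def)
  next
    case False
    then have "?C x y z = (SOME f. f \<in> Hom V (?H y z \<boxtimes> ?H x y) (?H x z))"
      unfolding glue_comp_def by (rule if_not_P)
    then show ?thesis
      using someI_ex[OF initial_arrow[OF init_pair[OF xyz False] H[OF xyz(1,3)]]] by simp
  qed
  have I: "?I x \<in> Hom V (Unit M) (?H x x)" if "x \<in> S" for x
    using vcat_Ident[OF X[OF that] el[OF that]] by (simp add: glue_hom_def)
  show ?thesis
  proof (rule vcatI, unfold glue_simps(1))
    show "VHom (glue X S idx el) \<in> extensional (S \<times> S)"
      "VComp (glue X S idx el) \<in> extensional (S \<times> S \<times> S)"
      "VIdent (glue X S idx el) \<in> extensional S" by (simp_all add: glue_def)
  next
    fix w x y z assume w: "w \<in> S" and x: "x \<in> S" and y: "y \<in> S" and z: "z \<in> S"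
    have "?C w x z \<cdot> (?C x y z \<otimes> Ident V (?H w x)) =
        (?C w y z \<cdot> (Ident V (?H y z) \<otimes> ?C w x y)) \<cdot> assoc_arrow V M (?H y z) (?H x y) (?H w x)"
    proof (cases "idx w = idx x \<and> idx x = idx y \<and> idx y = idx z")
      case True
      define i where "i = idx w"
      have i: "idx w = i" "idx x = i" "idx y = i" "idx z = i" using True by (auto simp: i_def)
      have e: "el w \<in> VObj (X i)" "el x \<in> VObj (X i)" "el y \<in> VObj (X i)" "el z \<in> VObj (X i)"
        using el[OF w] el[OF x] el[OF y] el[OF z] i by simp_all
      have Xi: "is_vcat V M (X i)" using X[OF w] i by simp
      show ?thesis using vcat_assoc[OF Xi e] i by (simp only: same_hom same_comp)
    next
      case False
      \<comment> \<open>If the four objects do not share a summand, one of the consecutive pairs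
        \<open>w, x\<close>, then \<open>x, y\<close>, then \<open>y, z\<close> straddles two, and
        its hom-object is a factor of the common source of both sides.\<close>
      have "is_initial V ((?H y z \<boxtimes> ?H x y) \<boxtimes> ?H w x)"
      proof (rule initial_product[OF Prod_Obj[OF H[OF y z] H[OF x y]] H[OF w x]])
        show "is_initial V (?H y z \<boxtimes> ?H x y) \<or> is_initial V (?H w x)"
          using False init[of w x] init_pair[OF x y z] by blast
      qed
      then show ?thesis
        by (rule initial_eqI[OF _ assoc_sides_hom[OF C[OF w x z] C[OF x y z] C[OF w y z] C[OF w x y]
              H[OF y z] H[OF x y] H[OF w x]]])
    qed
    then show "VComp (glue X S idx el) (w, x, z) \<cdot>
        (VComp (glue X S idx el) (x, y, z) \<otimes> Ident V (VHom (glue X S idx el) (w, x))) =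
      (VComp (glue X S idx el) (w, y, z) \<cdot>
        (Ident V (VHom (glue X S idx el) (y, z)) \<otimes> VComp (glue X S idx el) (w, x, y))) \<cdot>
        assoc_arrow V M (VHom (glue X S idx el) (y, z)) (VHom (glue X S idx el) (x, y))
          (VHom (glue X S idx el) (w, x))"
      using w x y z by simp
  next
    fix x y assume x: "x \<in> S" and y: "y \<in> S"
    note Hxy = H[OF x y] and id = ident_hom[OF H[OF x y]]
    have "?C x y y \<cdot> (?I y \<otimes> Ident V (?H x y)) = Snd M (Unit M) (?H x y) \<and>
        ?C x x y \<cdot> (Ident V (?H x y) \<otimes> ?I x) = Fst M (?H x y) (Unit M)"
    proof (cases "idx x = idx y")
      case True
      define i where "i = idx x"
      have i: "idx x = i" "idx y = i" using True by (auto simp: i_def)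
      have e: "el x \<in> VObj (X i)" "el y \<in> VObj (X i)" using el[OF x] el[OF y] i by simp_all
      have Xi: "is_vcat V M (X i)" using X[OF x] i by simp
      show ?thesis using vcat_unit_left[OF Xi e] vcat_unit_right[OF Xi e] i
        by (simp only: same_hom same_comp)
    next
      case False
      \<comment> \<open>The sources of the unit laws are products of the unit with the hom-object
        from \<open>x\<close> to \<open>y\<close>, which is initial here.\<close>
      note l = initial_product[OF Unit_Obj Hxy disjI2[OF init[OF False]]]
        and r = initial_product[OF Hxy Unit_Obj disjI1[OF init[OF False]]]
      show ?thesis
        using initial_eqI[OF l comp_hom[OF C[OF x y y] tensor_hom[OF I[OF y] id]] Snd_hom[OF Unit_Obj Hxy]]
          initial_eqI[OF r comp_hom[OF C[OF x x y] tensor_hom[OF id I[OF x]]] Fst_hom[OF Hxy Unit_Obj]]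
        by blast
    qed
    then show "VComp (glue X S idx el) (x, y, y) \<cdot>
        (VIdent (glue X S idx el) y \<otimes> Ident V (VHom (glue X S idx el) (x, y))) =
        Snd M (Unit M) (VHom (glue X S idx el) (x, y))"
      "VComp (glue X S idx el) (x, x, y) \<cdot>
        (Ident V (VHom (glue X S idx el) (x, y)) \<otimes> VIdent (glue X S idx el) x) =
        Fst M (VHom (glue X S idx el) (x, y)) (Unit M)"
      using x y by simp_all
  qed (simp_all add: H C I)
qed

text \<open>The objects are pairs of an index and an object of that summand. Since such pairs are
  injective, \<open>idx\<close> and \<open>el\<close> invert the tagging, and the glued category has
  the summands as its full parts.\<close>

lemma decomposition_exists:
  assumes u: "u \<in> elts U" and X: "\<And>i. i \<in> elts u \<Longrightarrow> X i \<in> Obj \<V>Cat"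
  shows "\<exists>S \<iota>. decomposition (elts u) X S \<iota>"
proof -
  define S where "S = (\<Union>i\<in>elts u. opair i ` VObj (X i))"
  have S: "\<exists>s\<in>elts U. S = elts s"
    using Sigma_member[OF u, of "\<lambda>i. VObj (X i)"] X unfolding \<V>Cat_Obj S_def by metis
  have iU: "i \<in> elts U" if "i \<in> elts u" for i using transitive[OF u that] .
  have xU: "x \<in> elts U" if "i \<in> elts u" "x \<in> VObj (X i)" for i x
    using X[OF that(1)] that(2) transitive unfolding \<V>Cat_Obj by blast
  have inj: "i = j \<and> x = y"
    if "i \<in> elts u" "x \<in> VObj (X i)" "j \<in> elts u" "y \<in> VObj (X j)" "opair i x = opair j y" for i j x y
    using opair_inject[OF iU[OF that(1)] xU[OF that(1,2)] iU[OF that(3)] xU[OF that(3,4)]] that(5) by blast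
  have "\<forall>s\<in>S. \<exists>i x. i \<in> elts u \<and> x \<in> VObj (X i) \<and> opair i x = s" unfolding S_def by blast
  then obtain idx el where idx: "\<And>s. s \<in> S \<Longrightarrow> idx s \<in> elts u"
    and el: "\<And>s. s \<in> S \<Longrightarrow> el s \<in> VObj (X (idx s))" and pair: "\<And>s. s \<in> S \<Longrightarrow> opair (idx s) (el s) = s"
    by metis
  have in_S: "opair i x \<in> S" if "i \<in> elts u" "x \<in> VObj (X i)" for i x
    using that unfolding S_def by blast
  have idx_opair: "idx (opair i x) = i" and el_opair: "el (opair i x) = x"
    if ix: "i \<in> elts u" "x \<in> VObj (X i)" for i x
    using inj[OF idx[OF in_S[OF ix]] el[OF in_S[OF ix]] ix pair[OF in_S[OF ix]]] by simp_all
  define A where "A = glue X S idx el"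
  have A: "A \<in> Obj \<V>Cat"
    unfolding \<V>Cat_Obj A_def using glue_vcat[of S X idx el] Obj_vcat[OF X[OF idx]] el S by simp
  \<comment> \<open>Identity arrows have the right type: the hom-object between two objects tagged
    with \<open>i\<close> is by construction the one in \<open>X i\<close>.\<close>
  define \<iota> where "\<iota> i = mk_fun (X i) A (opair i) (\<lambda>x y. Ident V (VHom (X i) (x, y)))" for i
  have hom: "\<iota> i \<in> Hom \<V>Cat (X i) A" if i: "i \<in> elts u" for i
    unfolding \<iota>_def
  proof (rule mk_fun_hom[OF X[OF i] A])
    note Xi = Obj_vcat[OF X[OF i]]
    show "opair i x \<in> VObj A" if "x \<in> VObj (X i)" for x using in_S[OF i that] by (simp add: A_def)
    show "Ident V (VHom (X i) (x, y)) \<in> Hom V (VHom (X i) (x, y)) (VHom A (opair i x, opair i y))"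
      if "x \<in> VObj (X i)" "y \<in> VObj (X i)" for x y
      using ident_hom[OF vcat_Hom[OF Xi that]] in_S[OF i] idx_opair[OF i] el_opair[OF i] that
      by (simp add: A_def glue_hom_def)
    show "Ident V (VHom (X i) (x, z)) \<cdot> VComp (X i) (x, y, z) =
        VComp A (opair i x, opair i y, opair i z) \<cdot>
        (Ident V (VHom (X i) (y, z)) \<otimes> Ident V (VHom (X i) (x, y)))"
      if xyz: "x \<in> VObj (X i)" "y \<in> VObj (X i)" "z \<in> VObj (X i)" for x y z
    proof -
      have "VComp A (opair i x, opair i y, opair i z) = VComp (X i) (x, y, z)"
        using in_S[OF i] idx_opair[OF i] el_opair[OF i] xyz by (simp add: A_def glue_comp_def)
      then show ?thesis
        by (simp add: tensor_ident vcat_Hom[OF Xi] xyz comp_ident_left[OF vcat_Comp[OF Xi xyz]]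
            comp_ident_right[OF vcat_Comp[OF Xi xyz]])
    qed
    show "Ident V (VHom (X i) (x, x)) \<cdot> VIdent (X i) x = VIdent A (opair i x)"
      if "x \<in> VObj (X i)" for x
      using in_S[OF i that] idx_opair[OF i that] el_opair[OF i that]
      by (simp add: A_def comp_ident_left[OF vcat_Ident[OF Xi that]])
  qed
  have \<iota>_obj: "VFObj (\<iota> i) x = opair i x" if "x \<in> VObj (X i)" for i x
    using that by (simp add: \<iota>_def)
  have "decomposition (elts u) X A \<iota>"
    unfolding decomposition_def
  proof (intro conjI ballI impI A)
    fix i assume i: "i \<in> elts u"
    have "inj_on (VFObj (\<iota> i)) (VObj (X i))"
      using inj[OF i _ i] by (auto simp: inj_on_def \<iota>_obj)
    moreover have "is_iso V (VFHom (\<iota> i) (x, y))" if "x \<in> VObj (X i)" "y \<in> VObj (X i)" for x y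
      using iso_ident[OF vcat_Hom[OF Obj_vcat[OF X[OF i]] that]] that by (simp add: \<iota>_def)
    ultimately show "embedding (\<iota> i) (X i) A" using hom[OF i] by (simp add: embedding_def)
  next
    show "VObj A \<subseteq> (\<Union>i\<in>elts u. VFObj (\<iota> i) ` VObj (X i))"
      by (auto simp: A_def S_def \<iota>_obj)
  next
    fix i j x y assume ij: "i \<in> elts u" "j \<in> elts u" "i \<noteq> j" and x: "x \<in> VObj (X i)" and y: "y \<in> VObj (X j)"
    show "VFObj (\<iota> i) x \<noteq> VFObj (\<iota> j) y" using inj[OF ij(1) x ij(2) y] ij(3) x y by (auto simp: \<iota>_obj)
    show "is_initial V (VHom A (VFObj (\<iota> i) x, VFObj (\<iota> j) y))"
      using in_S[OF ij(1) x] in_S[OF ij(2) y] idx_opair[OF ij(1) x] idx_opair[OF ij(2) y] ij(3) zero_initial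
      by (simp add: \<iota>_obj x y A_def glue_hom_def)
  qed
  then show ?thesis by blast
qed

text \<open>Replaces the universal property by concrete data for every coproduct over a small index
  set, in particular for whatever coproducts a choice selects.\<close>

lemma coproduct_is_decomposition:
  assumes u: "u \<in> elts U" and X: "\<And>i. i \<in> elts u \<Longrightarrow> X i \<in> Obj \<V>Cat"
    and cop: "is_coproduct \<V>Cat (elts u) X S \<iota>"
  shows "decomposition (elts u) X S \<iota>"
proof -
  obtain S' \<iota>' where "decomposition (elts u) X S' \<iota>'" using decomposition_exists[OF u, of X] X by blast
  then show ?thesis by (rule coproduct_decomposition[OF _ cop])
qed

section \<open>Decompositions under pullback and preimage\<close>

lemma decomposition_pullback:
  assumes dS: "decomposition I B S j" and dX: "decomposition I X P \<iota>"
    and h: "h \<in> Hom \<V>Cat S P" and g: "\<And>i. i \<in> I \<Longrightarrow> g i \<in> Hom \<V>Cat (B i) (X i)"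
    and sq: "\<And>i. i \<in> I \<Longrightarrow> h \<odot> j i = \<iota> i \<odot> g i" and i: "i \<in> I"
    and a: "a \<in> Hom \<V>Cat T S" and b: "b \<in> Hom \<V>Cat T (X i)" and eq: "h \<odot> a = \<iota> i \<odot> b"
  shows "\<exists>!c. c \<in> Hom \<V>Cat T (B i) \<and> j i \<odot> c = a \<and> g i \<odot> c = b"
proof -
  note DS = decompositionD[OF dS] and DX = decompositionD[OF dX]
  note jE = DS(2) and \<iota>E = DX(2)
  note jH = embeddingD(1)[OF jE] and \<iota>H = embeddingD(1)[OF \<iota>E]
  \<comment> \<open>The object \<open>VFObj a t\<close> lies in some summand \<open>k\<close> of
    \<open>S\<close>, so its image under \<open>h\<close> lies in summand \<open>k\<close> of
    \<open>P\<close>. The square puts that image into summand \<open>i\<close>, and disjointness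
    gives \<open>k = i\<close>.\<close>
  have im: "VFObj a t \<in> VFObj (j i) ` VObj (B i)" if t: "t \<in> VObj T" for t
  proof -
    obtain k y where k: "k \<in> I" "y \<in> VObj (B k)" and y: "VFObj (j k) y = VFObj a t"
      using DS(3)[OF fun_Obj[OF a t]] by blast
    have "VFObj (\<iota> k) (VFObj (g k) y) = VFObj (h \<odot> j k) y"
      using Comp_simps(1)[OF g[OF k(1)] k(2), of "\<iota> k"] sq[OF k(1)] by simp
    also have "\<dots> = VFObj (h \<odot> a) t"
      using Comp_simps(1)[OF jH[OF k(1)] k(2), of h] Comp_simps(1)[OF a t, of h] y by simp
    also have "\<dots> = VFObj (\<iota> i) (VFObj b t)" using Comp_simps(1)[OF b t, of "\<iota> i"] eq by simp
    finally have "k = i" by (rule DX(4)[OF k(1) i fun_Obj[OF g[OF k(1)] k(2)] fun_Obj[OF b t]])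
    then show ?thesis using k y by (metis imageI)
  qed
  obtain c where c: "c \<in> Hom \<V>Cat T (B i)" "j i \<odot> c = a"
    using embedding_factor[OF jE[OF i] a im] by blast
  \<comment> \<open>The second projection equation comes for free: both sides agree after the
    monomorphism \<open>\<iota> i\<close>.\<close>
  have "\<iota> i \<odot> g i \<odot> c = \<iota> i \<odot> b"
    using VC.comp_assoc[OF \<iota>H[OF i] g[OF i] c(1)] VC.comp_assoc[OF h jH[OF i] c(1)] sq[OF i] c(2) eq by simp
  then have "g i \<odot> c = b"
    by (rule embedding_cancel[OF \<iota>E[OF i] Comp_hom[OF c(1) g[OF i]] b])
  moreover have "c' = c" if "c' \<in> Hom \<V>Cat T (B i)" "j i \<odot> c' = a" for c'
    using embedding_cancel[OF jE[OF i] that(1) c(1)] that(2) c(2) by simp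
  ultimately show ?thesis using c by blast
qed

text \<open>Each \<open>j i\<close> includes the full subcategory of objects that \<open>f\<close>
  sends into summand \<open>i\<close>, and \<open>g i\<close> is the factorization of
  \<open>f\<close> on it through the embedding \<open>\<iota> i\<close>. Preimages of disjoint
  summands are disjoint, and strictness gives initial hom-objects between them.\<close>

lemma decomposition_preimage:
  assumes dX: "decomposition I X P \<iota>" and f: "f \<in> Hom \<V>Cat T P"
  shows "\<exists>B g j. B \<in> I \<rightarrow>\<^sub>E Obj \<V>Cat \<and> decomposition I B T j \<and>
    (\<forall>i\<in>I. g i \<in> Hom \<V>Cat (B i) (X i) \<and> f \<odot> j i = \<iota> i \<odot> g i)"
proof -
  note D = decompositionD[OF dX]
  note T = fun_src[OF f]
  define S where "S i = {t \<in> VObj T. VFObj f t \<in> VFObj (\<iota> i) ` VObj (X i)}" for i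
  have sub: "S i \<subseteq> VObj T" for i by (auto simp: S_def)
  define B where "B = (\<lambda>i\<in>I. restrict_vcat T (S i))"
  define j where "j i = inclusion T (S i)" for i
  have B: "VObj (B i) = S i" if "i \<in> I" for i using that by (simp add: B_def)
  have j: "embedding (j i) (B i) T" if "i \<in> I" for i
    using inclusion_embedding(1)[OF T sub] that by (simp add: B_def j_def)
  have jo: "VFObj (j i) x = x" if "x \<in> S i" for i x
    using inclusion_embedding(2)[OF T sub that] by (simp add: j_def)
  note jH = embeddingD(1)[OF j]
  have "\<exists>g. g \<in> Hom \<V>Cat (B i) (X i) \<and> \<iota> i \<odot> g = f \<odot> j i" if i: "i \<in> I" for i
  proof (rule embedding_factor[OF D(2)[OF i] Comp_hom[OF jH[OF i] f]])
    fix t assume t: "t \<in> VObj (B i)"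
    then show "VFObj (f \<odot> j i) t \<in> VFObj (\<iota> i) ` VObj (X i)"
      using Comp_simps(1)[OF jH[OF i] t, of f] jo[of t i] B[OF i] by (simp add: S_def)
  qed
  then obtain g where g: "\<And>i. i \<in> I \<Longrightarrow> g i \<in> Hom \<V>Cat (B i) (X i) \<and> \<iota> i \<odot> g i = f \<odot> j i"
    by metis
  have "decomposition I B T j"
    unfolding decomposition_def
  proof (intro conjI ballI impI T j)
    show "VObj T \<subseteq> (\<Union>i\<in>I. VFObj (j i) ` VObj (B i))"
    proof
      fix t assume t: "t \<in> VObj T"
      obtain i x where i: "i \<in> I" and "x \<in> VObj (X i)" "VFObj (\<iota> i) x = VFObj f t"
        using D(3)[OF fun_Obj[OF f t]] by blast
      then have "t \<in> S i" using t unfolding S_def by force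
      then show "t \<in> (\<Union>i\<in>I. VFObj (j i) ` VObj (B i))" using i B[OF i] jo by force
    qed
    fix i k x y assume ik: "i \<in> I" "k \<in> I" "i \<noteq> k" and "x \<in> VObj (B i)" "y \<in> VObj (B k)"
    then have x: "x \<in> S i" and y: "y \<in> S k" using B by simp_all
    obtain p where p: "p \<in> VObj (X i)" "VFObj f x = VFObj (\<iota> i) p" using x by (auto simp: S_def)
    obtain q where q: "q \<in> VObj (X k)" "VFObj f y = VFObj (\<iota> k) q" using y by (auto simp: S_def)
    show "VFObj (j i) x \<noteq> VFObj (j k) y"
      using D(4)[OF ik(1,2) p(1) q(1)] p(2) q(2) ik(3) jo[OF x] jo[OF y] by auto
    have "is_initial V (VHom P (VFObj f x, VFObj f y))"
      using D(5)[OF ik p(1) q(1)] p(2) q(2) by simp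
    moreover have "VFHom f (x, y) \<in> Hom V (VHom T (x, y)) (VHom P (VFObj f x, VFObj f y))"
      using fun_Hom[OF f] x y sub by blast
    ultimately show "is_initial V (VHom T (VFObj (j i) x, VFObj (j k) y))"
      using strict_initial jo[OF x] jo[OF y] by simp
  qed
  moreover have "B \<in> I \<rightarrow>\<^sub>E Obj \<V>Cat" using restrict_vcat_Obj[OF T sub] by (simp add: B_def)
  ultimately show ?thesis using g by metis
qed

theorem \<V>Cat_extensive:
  assumes universes: "universes elts U U2" and V: "large_category elts U2 V"
  shows "extensive elts U U2 \<V>Cat"
  unfolding extensive_def
proof (intro conjI ballI allI impI)
  show "large_category elts U2 \<V>Cat" by (rule VCat_large[OF universes V \<V>Cat_category])
  show "has_small_coproducts elts U \<V>Cat"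
    unfolding has_small_coproducts_def using decomposition_exists decomposition_coproduct by blast
  fix u K X assume u: "u \<in> elts U" and K: "is_coproduct_choice \<V>Cat (elts u) K"
    and X: "X \<in> elts u \<rightarrow>\<^sub>E Obj \<V>Cat"
  interpret K: coproduct_choice \<V>Cat "elts u" K by unfold_locales (rule K)
  \<comment> \<open>The choice \<open>K\<close> is arbitrary, so its value at \<open>X\<close> is
    first recognized as a decomposition.\<close>
  have dec: "decomposition (elts u) X (fst (K X)) (snd (K X))"
    using coproduct_is_decomposition[OF u _ K.chosen[OF X]] X by blast
  show "is_equivalence (product_category (elts u) (\<lambda>i. slice \<V>Cat (X i))) (slice \<V>Cat (fst (K X)))
      (coproduct_functor \<V>Cat (elts u) K)"
  proof (rule K.coproduct_functor_equivalence[OF X])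
    show "\<exists>B g j. B \<in> elts u \<rightarrow>\<^sub>E Obj \<V>Cat \<and> is_coproduct \<V>Cat (elts u) B T j \<and>
        (\<forall>i\<in>elts u. g i \<in> Hom \<V>Cat (B i) (X i) \<and> f \<odot> j i = snd (K X) i \<odot> g i)"
      if "f \<in> Hom \<V>Cat T (fst (K X))" for f T
      using decomposition_preimage[OF dec that] decomposition_coproduct by blast
  next
    fix B S j g h T a b i
    assume cop: "is_coproduct \<V>Cat (elts u) B S j" and h: "h \<in> Hom \<V>Cat S (fst (K X))"
      and g: "\<And>i. i \<in> elts u \<Longrightarrow> g i \<in> Hom \<V>Cat (B i) (X i)"
      and rest: "\<And>i. i \<in> elts u \<Longrightarrow> h \<odot> j i = snd (K X) i \<odot> g i" "i \<in> elts u"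
        "a \<in> Hom \<V>Cat T S" "b \<in> Hom \<V>Cat T (X i)" "h \<odot> a = snd (K X) i \<odot> b"
    \<comment> \<open>The cocone \<open>j\<close> is known only through its universal property. The
      functors \<open>g\<close> show that the \<open>B i\<close> are small
      \<open>V\<close>-categories, so the concrete description is available for it too.\<close>
    have "decomposition (elts u) B S j"
      by (rule coproduct_is_decomposition[OF u fun_src[OF g] cop])
    then show "\<exists>!c. c \<in> Hom \<V>Cat T (B i) \<and> j i \<odot> c = a \<and> g i \<odot> c = b"
      by (rule decomposition_pullback[OF _ dec h g rest])
  qed
qed

end

theorem proposition6p6:
  fixes elts :: "'s \<Rightarrow> 's set" and U1 U2 :: 's
    and V :: "('o, 'a) category" and M :: "('o, 'a) cartesian"
  assumes "universes elts U1 U2"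
    and "large_category elts U2 V"
    and "\<exists>z. is_strict_initial V z"
    and "has_finite_products V"
    and "is_cartesian_structure V M"
  shows "extensive elts U1 U2 (VCat elts U1 V M)"
proof -
  obtain zero where "is_strict_initial V zero" using assms(3) by blast
  then interpret strict_enriched V M elts U1 zero
    using assms(1,2,5) by unfold_locales (auto simp: universes_def large_category_def)
  show ?thesis by (rule \<V>Cat_extensive[OF assms(1,2)])
qed

end
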